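(* Let $H:\mathbb R^d\to\mathbb R$ satisfy the assumptions on the Hamiltonian listed in the context, let $f$, $B$ satisfy the assumptions on the random forcing listed in the context, and assume in addition that $f$ is not constant on $\mathbb R^d$ (that is, it is not the case that $f(\cdot,\omega)$ is constant for $\mathbf P$-almost every $\omega$). Let $\overline H$ be the effective Hamiltonian defined in the context. Then $$\overline H(p)>H(p)\quad\text{for all }p\in\mathbb R^d.$$
   Context: $C^1_b$ is the space of functions that are bounded and continuous together with their first derivatives. Assumptions on the Hamiltonian. $H:\mathbb R^d\to\mathbb R$ is convex and, for some $C>1$ and $q>1$, $\frac1C|p|^q-C\le H(p)\le C(|p|^q+1)$ for all $p\in\mathbb R^d$. With $H^*(v)=\sup_{p}(p\cdot v-H(p))$ and $q'=q/(q-1)$, it is also assumed that, for some $C>0$, $|H^*(p_1)-H^*(p_2)|\le C(1+|p_1|^{q'-1}+|p_2|^{q'-1})|p_1-p_2|$ for all $p_1,p_2\in\mathbb R^d$. Assumptions on the random forcing. $(\Omega,\mathbf F,\mathbf P)$ is a probability space with expectation $\mathbf E$; $B:[0,\infty)\times\Omega\to\mathbb R^m$ is a standard Brownian motion; $f:\mathbb R^d\times\Omega\to\mathbb R^m$ is a random field with $f(\cdot,\omega)\in C^1_b(\mathbb R^d,\mathbb R^m)$ with probability one; $f$ and $B$ are independent; and there is a group of transformations $(\tau_x)_{x\in\mathbb R^d}$ of $\Omega$ with $\tau_{x+y}=\tau_x\circ\tau_y$, $f(x,\tau_y\omega)=f(x+y,\omega)$, $B(\cdot,\tau_y\omega)=B(\cdot,\omega)$,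 $\mathbf P\circ\tau_x=\mathbf P$ for all $x,y\in\mathbb R^d$ and $\omega\in\Omega$, and such that if $A\in\sigma(f)$ satisfies $\tau_xA=A$ for all $x\in\mathbb R^d$, then $\mathbf P(A)\in\{0,1\}$. Moreover, for some $\kappa\in(0,1)$ and $M_0>0$, with probability one $f(\cdot,\omega)\in C^{1,\kappa}(\mathbb R^d,\mathbb R^m)$ and $\|f\|_\infty+\|Df\|_\infty+[Df]_\kappa\le M_0$, where $[\cdot]_\kappa$ is the $\kappa$-Hölder semi-norm. Effective Hamiltonian. For $x,y\in\mathbb R^d$ and $0\le s<t$, let $$L(x,y,s,t,\omega)=\inf\left\{\int_s^tH^*(\dot\gamma_r)\,dr+\int_s^tf(\gamma_r,\omega)\cdot dB_r(\omega):\gamma\in W^{1,\infty}([s,t],\mathbb R^d),\ \gamma_s=x,\ \gamma_t=y\right\},$$ where, for each $\omega$, the second integral is defined by integration by parts: $\int_s^tf(\gamma_r)\cdot dB_r=f(y)\cdot B_t-f(x)\cdot B_s-\int_s^t(Df(\gamma_r)\dot\gamma_r)\cdot B_r\,dr$. The effective Lagrangian is the deterministic function $\overline L(v)=\lim_{T\to\infty}\frac1TL(0,Tv,0,T,\cdot)$ (the limit exists with probability one and is a finite convex function on $\mathbb R^d$; also $\overline L(v)=\lim_{T\to\infty}\frac1T\mathbf E L(0,Tv,0,T,\cdot)$), and $\overline H(p)=\overline L^*(p)=\sup_{v\in\mathbb R^d}(p\cdot v-\overline L(v))$. This $\overline H$ is the Hamiltonian of the limiting equation $\overline u_t+\overline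 H(D\overline u)=0$ obtained as $\varepsilon\to0$ from $u^\varepsilon_t+H(Du^\varepsilon)=f(x/\varepsilon,\omega)\cdot\dot B(t/\varepsilon,\omega)$. *)

theory Defs
  imports "HOL-Probability.Probability"
begin

section \<open>Hamiltonians\<close>

text \<open>
  The supremum is taken in the reals and is therefore only meaningful where
  \<open>p \<bullet> v - F p\<close> is bounded above in \<open>p\<close>. Both functions it is applied to below, the Hamiltonian
  and the effective Lagrangian, grow superlinearly.
\<close>

definition convex_conjugate :: "(real ^ 'n \<Rightarrow> real) \<Rightarrow> real ^ 'n \<Rightarrow> real" where
  "convex_conjugate F v = (SUP p. p \<bullet> v - F p)"

definition admissible_hamiltonian :: "(real ^ 'n \<Rightarrow> real) \<Rightarrow> bool" where
  "admissible_hamiltonian H \<longleftrightarrow>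
     convex_on UNIV H \<and>
     (\<exists>C q. C > 1 \<and> q > 1 \<and>
        (\<forall>p. norm p powr q / C - C \<le> H p \<and> H p \<le> C * (norm p powr q + 1)) \<and>
        (\<exists>K>0. let q' = q / (q - 1) in
           \<forall>p\<^sub>1 p\<^sub>2. \<bar>convex_conjugate H p\<^sub>1 - convex_conjugate H p\<^sub>2\<bar>
             \<le> K * (1 + norm p\<^sub>1 powr (q' - 1) + norm p\<^sub>2 powr (q' - 1)) * norm (p\<^sub>1 - p\<^sub>2)))"


section \<open>Function spaces\<close>

text \<open>The derivative as a bounded linear map, so that \<open>norm (total_deriv g x)\<close> is the operator norm.\<close>

definition total_deriv :: "(real ^ 'n \<Rightarrow> real ^ 'm) \<Rightarrow> real ^ 'n \<Rightarrow> (real ^ 'n) \<Rightarrow>\<^sub>L (real ^ 'm)" where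
  "total_deriv g x = Blinfun (frechet_derivative g (at x))"

definition C1b :: "(real ^ 'n \<Rightarrow> real ^ 'm) \<Rightarrow> bool" where
  "C1b g \<longleftrightarrow>
     (\<forall>x. g differentiable (at x)) \<and> continuous_on UNIV (total_deriv g) \<and>
     bounded (range g) \<and> bounded (range (total_deriv g))"

definition holder_quotients ::
    "real \<Rightarrow> (real ^ 'n \<Rightarrow> 'b :: real_normed_vector) \<Rightarrow> real set" where
  "holder_quotients \<kappa> h = {norm (h x - h y) / norm (x - y) powr \<kappa> | x y. x \<noteq> y}"

definition holder_seminorm :: "real \<Rightarrow> (real ^ 'n \<Rightarrow> 'b :: real_normed_vector) \<Rightarrow> real" where
  "holder_seminorm \<kappa> h = Sup (holder_quotients \<kappa> h)"

definition sup_norm :: "(real ^ 'n \<Rightarrow> 'b :: real_normed_vector) \<Rightarrow> real" where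
  "sup_norm h = (SUP x. norm (h x))"

definition C1_holder :: "real \<Rightarrow> (real ^ 'n \<Rightarrow> real ^ 'm) \<Rightarrow> bool" where
  "C1_holder \<kappa> g \<longleftrightarrow> C1b g \<and> bdd_above (holder_quotients \<kappa> (total_deriv g))"


section \<open>Random forcing\<close>

context prob_space
begin

definition generated_sigma :: "'i set \<Rightarrow> ('i \<Rightarrow> 'a \<Rightarrow> 'b :: topological_space) \<Rightarrow> 'a set set" where
  "generated_sigma I X = sigma_sets (space M) {X i -` A \<inter> space M | i A. i \<in> I \<and> A \<in> sets borel}"

text \<open>Only the times \<open>t \<ge> 0\<close> are relevant; the values \<open>B t\<close> for \<open>t < 0\<close> are not constrained.\<close>

definition standard_brownian_motion :: "(real \<Rightarrow> 'a \<Rightarrow> real ^ 'm) \<Rightarrow> bool" where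
  "standard_brownian_motion B \<longleftrightarrow>
     (\<forall>t\<ge>0. random_variable borel (B t)) \<and>
     (AE \<omega> in M. B 0 \<omega> = 0) \<and>
     (AE \<omega> in M. continuous_on {0..} (\<lambda>t. B t \<omega>)) \<and>
     (\<forall>s t. 0 \<le> s \<and> s < t \<longrightarrow>
        distributed M lborel (\<lambda>\<omega>. B t \<omega> - B s \<omega>)
          (\<lambda>z. ennreal (\<Prod>i\<in>UNIV. normal_density 0 (sqrt (t - s)) (z $ i)))) \<and>
     (\<forall>(t :: nat \<Rightarrow> real) n. 0 \<le> t 0 \<and> mono t \<longrightarrow>
        indep_vars (\<lambda>_. borel) (\<lambda>k \<omega>. B (t (Suc k)) \<omega> - B (t k) \<omega>) {..<n})"

end

locale random_forcing = prob_space P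
  for P :: "'w measure" +
  fixes \<tau> :: "real ^ 'd \<Rightarrow> 'w \<Rightarrow> 'w"
    and f :: "real ^ 'd \<Rightarrow> 'w \<Rightarrow> real ^ 'm"
    and B :: "real \<Rightarrow> 'w \<Rightarrow> real ^ 'm"
    and \<kappa> M\<^sub>0 :: real
  assumes brownian: "standard_brownian_motion B"
    and field_measurable: "\<And>x. random_variable borel (f x)"
    and field_C1b: "AE \<omega> in P. C1b (\<lambda>x. f x \<omega>)"
    and independent: "indep_set (generated_sigma UNIV f) (generated_sigma {0..} B)"
    and shift_zero: "\<And>\<omega>. \<omega> \<in> space P \<Longrightarrow> \<tau> 0 \<omega> = \<omega>"
    and shift_add: "\<And>x y \<omega>. \<omega> \<in> space P \<Longrightarrow> \<tau> (x + y) \<omega> = \<tau> x (\<tau> y \<omega>)"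
    and shift_measurable: "\<And>x. \<tau> x \<in> P \<rightarrow>\<^sub>M P"
    and shift_preserves: "\<And>x. distr P P (\<tau> x) = P"
    and field_stationary: "\<And>x y \<omega>. \<omega> \<in> space P \<Longrightarrow> f x (\<tau> y \<omega>) = f (x + y) \<omega>"
    and brownian_invariant: "\<And>t y \<omega>. t \<ge> 0 \<Longrightarrow> \<omega> \<in> space P \<Longrightarrow> B t (\<tau> y \<omega>) = B t \<omega>"
    and ergodic: "\<And>A. A \<in> generated_sigma UNIV f \<Longrightarrow> (\<And>x. \<tau> x ` A = A) \<Longrightarrow> prob A \<in> {0, 1}"
    and \<kappa>: "0 < \<kappa>" "\<kappa> < 1"
    and M\<^sub>0: "M\<^sub>0 > 0"
    and field_holder: "AE \<omega> in P. C1_holder \<kappa> (\<lambda>x. f x \<omega>) \<and>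
      sup_norm (\<lambda>x. f x \<omega>) + sup_norm (total_deriv (\<lambda>x. f x \<omega>)) + holder_seminorm \<kappa> (total_deriv (\<lambda>x. f x \<omega>)) \<le> M\<^sub>0"


section \<open>Effective Lagrangian\<close>

text \<open>
  \<open>W1inf s t \<gamma> \<gamma>'\<close>: the curve \<open>\<gamma>\<close> (its continuous representative) belongs to the Sobolev space of
  exponents 1 and infinity on \<open>[s, t]\<close>, and \<open>\<gamma>'\<close> is a Borel representative of its derivative,
  which is determined almost everywhere.
\<close>

definition W1inf :: "real \<Rightarrow> real \<Rightarrow> (real \<Rightarrow> real ^ 'n) \<Rightarrow> (real \<Rightarrow> real ^ 'n) \<Rightarrow> bool" where
  "W1inf s t \<gamma> \<gamma>' \<longleftrightarrow>
     set_borel_measurable lborel {s..t} \<gamma>' \<and>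
     (\<exists>K. AE r in lborel. r \<in> {s..t} \<longrightarrow> norm (\<gamma>' r) \<le> K) \<and>
     (\<forall>r\<in>{s..t}. \<gamma> r = \<gamma> s + (LBINT u:{s..r}. \<gamma>' u))"

text \<open>
  \<open>b\<close> and \<open>g\<close> are a path of the Brownian motion and a realization of the random field. The
  stochastic integral of \<open>g\<close> along \<open>\<gamma>\<close> is defined pathwise, through integration by parts.
\<close>

definition path_integral ::
    "(real ^ 'n \<Rightarrow> real ^ 'm) \<Rightarrow> (real \<Rightarrow> real ^ 'm) \<Rightarrow> real \<Rightarrow> real \<Rightarrow>
      (real \<Rightarrow> real ^ 'n) \<Rightarrow> (real \<Rightarrow> real ^ 'n) \<Rightarrow> real" where
  "path_integral g b s t \<gamma> \<gamma>' =
     g (\<gamma> t) \<bullet> b t - g (\<gamma> s) \<bullet> b s - (LBINT r:{s..t}. blinfun_apply (total_deriv g (\<gamma> r)) (\<gamma>' r) \<bullet> b r)"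

definition lagrangian_distance ::
    "(real ^ 'n \<Rightarrow> real) \<Rightarrow> (real ^ 'n \<Rightarrow> 'w \<Rightarrow> real ^ 'm) \<Rightarrow> (real \<Rightarrow> 'w \<Rightarrow> real ^ 'm) \<Rightarrow>
      real ^ 'n \<Rightarrow> real ^ 'n \<Rightarrow> real \<Rightarrow> real \<Rightarrow> 'w \<Rightarrow> real" where
  "lagrangian_distance H f B x y s t \<omega> =
     Inf {(LBINT r:{s..t}. convex_conjugate H (\<gamma>' r)) +
            path_integral (\<lambda>z. f z \<omega>) (\<lambda>r. B r \<omega>) s t \<gamma> \<gamma>' | \<gamma> \<gamma>'.
          W1inf s t \<gamma> \<gamma>' \<and> \<gamma> s = x \<and> \<gamma> t = y}"

text \<open>
  That the limit exists almost surely and is deterministic is a theorem about the forcing; \<open>Lbar\<close>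
  is determined uniquely by this relation.
\<close>

definition is_effective_lagrangian ::
    "'w measure \<Rightarrow> (real ^ 'n \<Rightarrow> real) \<Rightarrow> (real ^ 'n \<Rightarrow> 'w \<Rightarrow> real ^ 'm) \<Rightarrow>
      (real \<Rightarrow> 'w \<Rightarrow> real ^ 'm) \<Rightarrow> (real ^ 'n \<Rightarrow> real) \<Rightarrow> bool" where
  "is_effective_lagrangian P H f B Lbar \<longleftrightarrow>
     (\<forall>v. AE \<omega> in P.
        ((\<lambda>T. lagrangian_distance H f B 0 (T *\<^sub>R v) 0 T \<omega> / T) \<longlongrightarrow> Lbar v) at_top)"

end

theory Submission
  imports Defs
begin

text \<open>
  Write \<open>H\<^sup>*\<close> for the conjugate of \<open>H\<close>. Given \<open>p\<close>, let \<open>v\<close> be a subgradient of \<open>H\<close> at \<open>p\<close>, so that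
  \<open>H p = p \<bullet> v - H\<^sup>* v\<close>. Since \<open>Hbar p \<ge> p \<bullet> v - Lbar v\<close>, the theorem follows from \<open>Lbar v < H\<^sup>* v\<close>, provided that the
  supremum defining \<open>Hbar p\<close> is finite.

  Both estimates on \<open>Lbar\<close> cut time into blocks of unit length. For the finiteness (\<open>effective_lagrangian_lower\<close>), the chain
  rule along Lipschitz curves shows that only the noise increments within a block matter, and the Fenchel-Young
  inequality at a momentum shifted by the noise bounds the action of every curve from below
  by \<open>p \<bullet> v\<close> per unit of time, up to an error that depends on the noise alone (\<open>action_lower_bound\<close>). The error of a
  block has bounded expectation.

  For the strict inequality (\<open>effective_lagrangian_strict_upper\<close>), compare in each block the straight segment with a detour that has
  the same endpoints. The segment costs \<open>H\<^sup>* v\<close> plus a stochastic integral, the detour costs at most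
  \<open>H\<^sup>* v + c\<close> plus another one. Conditionally on the field, the difference of the two integrals is a
  centred Gaussian variable, whose variance is positive with positive probability because the field is not constant. As a Gaussian variable
  is not bounded above, the detour is cheaper by more than any fixed \<open>c\<close> with positive probability. Choosing the cheaper path
  in every block hence lowers the mean cost by a fixed amount (\<open>block_gain\<close>).

  Two devices keep the probability elementary. All expectations are exponential moments of finite sums over
  Gaussian increments, which are computed exactly by freezing the field (\<open>laplace_of_ito_sum\<close>); the gain is
  expressed through them by the pointwise inequality \<open>exp_min_le\<close>. The passage to the limit uses
  Jensen's inequality for the exponential and Fatou's lemma (\<open>averaged_fatou\<close>): as the limit that defines \<open>Lbar\<close> is
  deterministic, it can be bounded through expectations.
\<close>

section \<open>Convex duality\<close>

text \<open>
  Separate the point \<open>(p, H p)\<close> from the strict epigraph of \<open>H\<close>, which is convex. The separating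
  functional cannot be horizontal, because \<open>H\<close> is finite everywhere; its slope is the subgradient.
\<close>

lemma subgradient_exists:
  fixes H :: "'a :: euclidean_space \<Rightarrow> real"
  assumes "convex_on UNIV H"
  obtains v where "\<And>w. H w \<ge> H p + v \<bullet> (w - p)"
proof -
  define T where "T = {z :: 'a \<times> real. H (fst z) < snd z}"
  have "convex T"
  proof (rule convexI)
    fix x y :: "'a \<times> real" and u w :: real
    assume *: "x \<in> T" "y \<in> T" "0 \<le> u" "0 \<le> w" "u + w = 1"
    have "H (u *\<^sub>R fst x + w *\<^sub>R fst y) \<le> u * H (fst x) + w * H (fst y)"
      using assms * unfolding convex_on_def by auto
    also have "\<dots> < u * snd x + w * snd y"
    proof (cases "u = 0")
      case True
      then show ?thesis using * by (auto simp: T_def)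
    next
      case False
      then have "u * H (fst x) < u * snd x" "w * H (fst y) \<le> w * snd y"
        using * by (auto simp: T_def mult_left_mono)
      then show ?thesis by linarith
    qed
    finally show "u *\<^sub>R x + w *\<^sub>R y \<in> T"
      by (simp add: T_def)
  qed
  moreover have "(p, H p + 1) \<in> T" "(p, H p) \<notin> T"
    by (auto simp: T_def)
  ultimately have "\<exists>a b. a \<noteq> 0 \<and> (\<forall>z\<in>{(p, H p)}. a \<bullet> z \<le> b) \<and> (\<forall>z\<in>T. a \<bullet> z \<ge> b)"
    by (intro separating_hyperplane_sets) auto
  then obtain a b where ab: "a \<noteq> 0" "a \<bullet> (p, H p) \<le> b" "\<And>z. z \<in> T \<Longrightarrow> a \<bullet> z \<ge> b"
    by blast
  obtain c d where a: "a = (c, d)" by (cases a)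
  have above: "c \<bullet> p + d * H p \<le> c \<bullet> w + d * y" if "y > H w" for w y
    using ab(2) ab(3)[of "(w, y)"] that by (simp add: a T_def inner_Pair)
  have "d \<ge> 0"
    using above[of p "H p + 1"] by (simp add: algebra_simps)
  moreover have "d \<noteq> 0"
  proof
    assume "d = 0"
    then have "c \<bullet> p \<le> c \<bullet> (p - c)"
      using above[of "p - c" "H (p - c) + 1"] by simp
    then have "c = 0"
      by (simp add: inner_diff_right) (metis inner_gt_zero_iff not_less)
    then show False using ab(1) a \<open>d = 0\<close> by (simp add: zero_prod_def)
  qed
  ultimately have d: "d > 0" by simp
  have "H w \<ge> H p + (- (1 / d) *\<^sub>R c) \<bullet> (w - p)" for w
  proof (rule field_le_epsilon)
    fix e :: real assume "e > 0"
    then have "c \<bullet> p + d * H p \<le> c \<bullet> w + d * (H w + e)"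
      by (intro above) simp
    then have "d * H p - c \<bullet> (w - p) \<le> d * (H w + e)"
      by (simp add: inner_diff_right)
    then have "H p - (c \<bullet> (w - p)) / d \<le> H w + e"
      using d by (simp add: field_simps)
    then show "H p + (- (1 / d) *\<^sub>R c) \<bullet> (w - p) \<le> H w + e"
      by (simp add: divide_inverse mult.commute)
  qed
  then show ?thesis by (rule that)
qed

text \<open>
  The linear term \<open>norm p * norm v\<close> is dominated by \<open>norm p powr q / C\<close> as soon as
  \<open>norm p powr (q - 1) \<ge> C * norm v\<close>, and is at most a constant otherwise.
\<close>

lemma superlinear_conjugate_bdd_above:
  fixes H :: "real ^ 'n \<Rightarrow> real"
  assumes "C > 0" "q > 1" "\<And>p. norm p powr q / C - C \<le> H p"
  shows "bdd_above (range (\<lambda>p. p \<bullet> v - H p))"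
proof (rule bdd_aboveI2)
  fix p :: "real ^ 'n"
  define R where "R = (C * norm v) powr (1 / (q - 1))"
  have "norm p * norm v \<le> norm p powr q / C + R * norm v"
  proof (cases "norm p \<le> R")
    case True
    then have "norm p * norm v \<le> R * norm v"
      by (rule mult_right_mono) simp
    moreover have "norm p powr q / C \<ge> 0"
      using assms(1) by simp
    ultimately show ?thesis by linarith
  next
    case False
    have "R \<ge> 0" by (simp add: R_def)
    then have p: "norm p > 0" using False by linarith
    have "C * norm v = R powr (q - 1)"
      using assms by (simp add: R_def powr_powr)
    also have "\<dots> \<le> norm p powr (q - 1)"
      using False \<open>R \<ge> 0\<close> assms by (intro powr_mono2) auto
    finally have "C * norm v * norm p \<le> norm p powr (q - 1) * norm p"
      using p by simp
    also have "\<dots> = norm p powr q"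
      using p by (metis add.commute diff_add_cancel less_eq_real_def powr_mult_base mult.commute)
    finally have "norm p * norm v \<le> norm p powr q / C"
      using assms(1) by (simp add: field_simps)
    moreover have "R * norm v \<ge> 0" using \<open>R \<ge> 0\<close> by simp
    ultimately show ?thesis by linarith
  qed
  then show "p \<bullet> v - H p \<le> R * norm v + C"
    using assms(3)[of p] norm_cauchy_schwarz[of p v] by linarith
qed

lemma
  fixes H :: "real ^ 'n \<Rightarrow> real"
  assumes "admissible_hamiltonian H"
  shows admissible_bdd_above: "bdd_above (range (\<lambda>p. p \<bullet> v - H p))"
    and admissible_convex: "convex_on UNIV H"
    and admissible_growth: "\<exists>C q. C > 0 \<and> q > 0 \<and> (\<forall>p. H p \<le> C * (norm p powr q + 1))"
proof -
  obtain C q where C: "C > 1" "q > 1" "\<forall>p. norm p powr q / C - C \<le> H p \<and> H p \<le> C * (norm p powr q + 1)"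
    using assms unfolding admissible_hamiltonian_def by blast
  show "bdd_above (range (\<lambda>p. p \<bullet> v - H p))"
    using C by (intro superlinear_conjugate_bdd_above[of C q]) auto
  show "convex_on UNIV H"
    using assms unfolding admissible_hamiltonian_def by blast
  have "C > 0" "q > 0" using C by auto
  then show "\<exists>C q. C > 0 \<and> q > 0 \<and> (\<forall>p. H p \<le> C * (norm p powr q + 1))"
    using C(3) by blast
qed

lemma fenchel_young:
  fixes H :: "real ^ 'n \<Rightarrow> real"
  assumes "admissible_hamiltonian H"
  shows "p \<bullet> v - H p \<le> convex_conjugate H v"
  using cSUP_upper[of p UNIV "\<lambda>p. p \<bullet> v - H p"] admissible_bdd_above[OF assms]
  by (simp add: convex_conjugate_def)

text \<open>
  A subgradient at \<open>p\<close> is a velocity at which the Fenchel-Young inequality for \<open>p\<close> is an equality. This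
  is the velocity at which the effective Lagrangian will be compared with the conjugate of \<open>H\<close>.
\<close>

lemma conjugate_attained:
  fixes H :: "real ^ 'n \<Rightarrow> real"
  assumes "admissible_hamiltonian H"
  obtains v where "convex_conjugate H v = p \<bullet> v - H p"
proof -
  obtain v where v: "\<And>w. H w \<ge> H p + v \<bullet> (w - p)"
    using subgradient_exists[OF admissible_convex[OF assms]] by blast
  have "convex_conjugate H v \<le> p \<bullet> v - H p"
    unfolding convex_conjugate_def
  proof (rule cSUP_least)
    show "w \<bullet> v - H w \<le> p \<bullet> v - H p" for w
      using v[of w] by (simp add: inner_diff_right inner_commute)
  qed simp
  then show ?thesis
    using fenchel_young[OF assms, of p v] that by fastforce
qed

lemma conjugate_continuous:
  fixes H :: "real ^ 'n \<Rightarrow> real"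
  assumes "admissible_hamiltonian H"
  shows "continuous_on A (convex_conjugate H)"
proof (rule continuous_on_subset[of UNIV])
  obtain q' K where K: "K > 0" "\<And>p\<^sub>1 p\<^sub>2. \<bar>convex_conjugate H p\<^sub>1 - convex_conjugate H p\<^sub>2\<bar>
      \<le> K * (1 + norm p\<^sub>1 powr (q' - 1) + norm p\<^sub>2 powr (q' - 1)) * norm (p\<^sub>1 - p\<^sub>2)" and q': "q' > 1"
  proof -
    obtain q K where "q > 1" "K > 0" "\<forall>p\<^sub>1 p\<^sub>2. \<bar>convex_conjugate H p\<^sub>1 - convex_conjugate H p\<^sub>2\<bar>
        \<le> K * (1 + norm p\<^sub>1 powr (q / (q - 1) - 1) + norm p\<^sub>2 powr (q / (q - 1) - 1)) * norm (p\<^sub>1 - p\<^sub>2)"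
      using assms unfolding admissible_hamiltonian_def Let_def by blast
    moreover from this have "q / (q - 1) > 1" by simp
    ultimately show ?thesis using that by blast
  qed
  show "continuous_on UNIV (convex_conjugate H)"
    unfolding continuous_on_def
  proof
    fix x :: "real ^ 'n"
    have "((\<lambda>y. K * (1 + norm y powr (q' - 1) + norm x powr (q' - 1)) * norm (y - x)) \<longlongrightarrow>
        K * (1 + norm x powr (q' - 1) + norm x powr (q' - 1)) * norm (x - x)) (at x)"
      using q' by (intro tendsto_intros tendsto_powr') auto
    then have lim: "((\<lambda>y. K * (1 + norm y powr (q' - 1) + norm x powr (q' - 1)) * norm (y - x)) \<longlongrightarrow> 0) (at x)"
      by simp
    have "((\<lambda>y. convex_conjugate H y - convex_conjugate H x) \<longlongrightarrow> 0) (at x)"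
      using K(2) by (intro Lim_null_comparison[OF _ lim] always_eventually) simp
    then show "(convex_conjugate H \<longlongrightarrow> convex_conjugate H x) (at x within UNIV)"
      by (rule LIM_zero_cancel)
  qed
qed simp

section \<open>Lipschitz curves\<close>

lemma set_integral_split:
  fixes \<phi> :: "real \<Rightarrow> 'b :: euclidean_space"
  assumes "set_integrable lborel {a..c} \<phi>" "a \<le> b" "b \<le> c"
  shows "(LBINT r:{a..c}. \<phi> r) = (LBINT r:{a..b}. \<phi> r) + (LBINT r:{b..c}. \<phi> r)"
proof -
  have "set_integrable lborel {a..b} \<phi>" "set_integrable lborel {b..c} \<phi>"
    by (rule set_integrable_subset[OF assms(1)]; use assms in auto)+
  then show ?thesis
    using Henstock_Kurzweil_Integration.integral_combine[of a b c \<phi>] assms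
    by (simp add: set_borel_integral_eq_integral)
qed

lemma set_integrable_of_bounded:
  fixes \<phi> :: "real \<Rightarrow> 'b :: euclidean_space"
  assumes "set_borel_measurable lborel {a..b} \<phi>"
    and "AE r in lborel. r \<in> {a..b} \<longrightarrow> norm (\<phi> r) \<le> K"
  shows "set_integrable lborel {a..b} \<phi>"
  unfolding set_integrable_def
proof (rule integrableI_bounded_set[where A = "{a..b}" and B = K])
  show "AE x\<in>{a..b} in lborel. norm (indicat_real {a..b} x *\<^sub>R \<phi> x) \<le> K"
    using assms(2) by eventually_elim (auto simp: indicator_def)
  show "emeasure lborel {a..b} < \<infinity>"
    by (cases "a \<le> b") auto
qed (use assms in \<open>auto simp: set_borel_measurable_def indicator_def\<close>)

lemma set_integral_bound:
  fixes \<phi> :: "real \<Rightarrow> 'b :: euclidean_space"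
  assumes "set_integrable lborel {a..b} \<phi>" "a \<le> b"
    and "AE r in lborel. r \<in> {a..b} \<longrightarrow> norm (\<phi> r) \<le> K"
  shows "norm (LBINT r:{a..b}. \<phi> r) \<le> K * (b - a)"
proof -
  have "norm (LBINT r:{a..b}. \<phi> r) \<le> (LBINT r:{a..b}. norm (\<phi> r))"
    by (rule set_integral_norm_bound[OF assms(1)])
  also have "\<dots> \<le> (LBINT r:{a..b}. K)"
  proof (rule set_integral_mono_AE)
    show "set_integrable lborel {a..b} (\<lambda>r. norm (\<phi> r))"
      by (rule set_integrable_norm[OF assms(1)])
    show "set_integrable lborel {a..b} (\<lambda>r. K)"
      by (rule borel_integrable_atLeastAtMost') (rule continuous_on_const)
    show "AE r \<in> {a..b} in lborel. norm (\<phi> r) \<le> K" by (rule assms(3))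
  qed
  also have "\<dots> = K * (b - a)"
    using assms(2) by (simp add: set_lebesgue_integral_def)
  finally show ?thesis .
qed

lemma set_integral_singleton: "(LBINT r:{a..a :: real}. \<phi> r) = (0 :: 'b :: euclidean_space)"
  unfolding set_lebesgue_integral_def
proof (rule integral_eq_zero_AE)
  show "AE r in lborel. indicat_real {a..a} r *\<^sub>R \<phi> r = 0"
    using AE_lborel_singleton[of a] by eventually_elim (simp add: indicator_def)
qed

lemma
  fixes \<gamma> :: "real \<Rightarrow> real ^ 'n"
  assumes "W1inf s t \<gamma> \<gamma>'"
  shows W1inf_measurable: "set_borel_measurable lborel {s..t} \<gamma>'"
    and W1inf_set_integrable: "set_integrable lborel {s..t} \<gamma>'"
    and W1inf_bound: "\<exists>K\<ge>0. AE r in lborel. r \<in> {s..t} \<longrightarrow> norm (\<gamma>' r) \<le> K"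
proof -
  obtain K where K: "AE r in lborel. r \<in> {s..t} \<longrightarrow> norm (\<gamma>' r) \<le> K"
    using assms unfolding W1inf_def by blast
  then have "AE r in lborel. r \<in> {s..t} \<longrightarrow> norm (\<gamma>' r) \<le> max K 0"
    by eventually_elim auto
  then show "\<exists>K\<ge>0. AE r in lborel. r \<in> {s..t} \<longrightarrow> norm (\<gamma>' r) \<le> K"
    by (intro exI[of _ "max K 0"]) auto
  show *: "set_borel_measurable lborel {s..t} \<gamma>'"
    using assms by (simp add: W1inf_def)
  show "set_integrable lborel {s..t} \<gamma>'"
    by (rule set_integrable_of_bounded[OF * K])
qed

lemma W1inf_increment:
  fixes \<gamma> :: "real \<Rightarrow> real ^ 'n"
  assumes "W1inf s t \<gamma> \<gamma>'" "s \<le> a" "a \<le> b" "b \<le> t"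
  shows "\<gamma> b - \<gamma> a = (LBINT u:{a..b}. \<gamma>' u)"
proof -
  have "set_integrable lborel {s..b} \<gamma>'"
    by (rule set_integrable_subset[OF W1inf_set_integrable[OF assms(1)]]) (use assms in auto)
  then have split: "(LBINT u:{s..b}. \<gamma>' u) = (LBINT u:{s..a}. \<gamma>' u) + (LBINT u:{a..b}. \<gamma>' u)"
    by (rule set_integral_split) (use assms in auto)
  have repr: "\<gamma> r = \<gamma> s + (LBINT u:{s..r}. \<gamma>' u)" if "r \<in> {s..t}" for r
    using assms(1) that unfolding W1inf_def by blast
  have "b \<in> {s..t}" "a \<in> {s..t}" using assms by auto
  from this[THEN repr] split show ?thesis by (metis add_diff_cancel_left add_diff_cancel_left')
qed

lemma W1inf_subinterval:
  fixes \<gamma> :: "real \<Rightarrow> real ^ 'n"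
  assumes "W1inf s t \<gamma> \<gamma>'" "s \<le> a" "a \<le> b" "b \<le> t"
  shows "W1inf a b \<gamma> \<gamma>'"
  unfolding W1inf_def
proof (intro conjI ballI)
  show "set_borel_measurable lborel {a..b} \<gamma>'"
    using assms by (intro set_borel_measurable_subset[OF W1inf_measurable[OF assms(1)]]) auto
  obtain K where "K \<ge> 0" "AE r in lborel. r \<in> {s..t} \<longrightarrow> norm (\<gamma>' r) \<le> K"
    using W1inf_bound[OF assms(1)] by blast
  from this(2) have "AE r in lborel. r \<in> {a..b} \<longrightarrow> norm (\<gamma>' r) \<le> K"
    by eventually_elim (use assms in auto)
  then show "\<exists>K. AE r in lborel. r \<in> {a..b} \<longrightarrow> norm (\<gamma>' r) \<le> K" ..
  show "\<gamma> r = \<gamma> a + (LBINT u:{a..r}. \<gamma>' u)" if "r \<in> {a..b}" for r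
    using W1inf_increment[OF assms(1), of a r] assms that by (simp add: algebra_simps)
qed

lemma W1inf_lipschitz:
  fixes \<gamma> :: "real \<Rightarrow> real ^ 'n"
  assumes "W1inf s t \<gamma> \<gamma>'" "AE r in lborel. r \<in> {s..t} \<longrightarrow> norm (\<gamma>' r) \<le> K"
    and "a \<in> {s..t}" "b \<in> {s..t}"
  shows "norm (\<gamma> b - \<gamma> a) \<le> K * \<bar>b - a\<bar>"
proof -
  have ordered: "norm (\<gamma> d - \<gamma> c) \<le> K * (d - c)" if "s \<le> c" "c \<le> d" "d \<le> t" for c d
  proof -
    have W: "W1inf c d \<gamma> \<gamma>'"
      by (rule W1inf_subinterval[OF assms(1) that])
    have "AE r in lborel. r \<in> {c..d} \<longrightarrow> norm (\<gamma>' r) \<le> K"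
      using assms(2) by eventually_elim (use that in auto)
    then have "norm (LBINT u:{c..d}. \<gamma>' u) \<le> K * (d - c)"
      by (rule set_integral_bound[OF W1inf_set_integrable[OF W] that(2)])
    then show ?thesis
      using W1inf_increment[OF assms(1) that] by simp
  qed
  show ?thesis
  proof (cases "a \<le> b")
    case True
    then show ?thesis using ordered[of a b] assms(3,4) by simp
  next
    case False
    then have "norm (\<gamma> a - \<gamma> b) \<le> K * (a - b)" using ordered[of b a] assms(3,4) by simp
    then show ?thesis using False by (simp add: norm_minus_commute)
  qed
qed

lemma W1inf_continuous:
  fixes \<gamma> :: "real \<Rightarrow> real ^ 'n"
  assumes "W1inf s t \<gamma> \<gamma>'"
  shows "continuous_on {s..t} \<gamma>"
proof -
  obtain K where K: "K \<ge> 0" "AE r in lborel. r \<in> {s..t} \<longrightarrow> norm (\<gamma>' r) \<le> K"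
    using W1inf_bound[OF assms] by blast
  have "K-lipschitz_on {s..t} \<gamma>"
    using W1inf_lipschitz[OF assms K(2)] K(1)
    by (auto intro!: lipschitz_onI simp: dist_norm)
  then show ?thesis by (rule lipschitz_on_continuous_on)
qed

lemma W1inf_integrable_continuous:
  fixes \<gamma> :: "real \<Rightarrow> real ^ 'n" and \<phi> :: "real ^ 'n \<Rightarrow> real"
  assumes "W1inf s t \<gamma> \<gamma>'" "continuous_on UNIV \<phi>"
  shows "set_integrable lborel {s..t} (\<lambda>r. \<phi> (\<gamma>' r))"
proof -
  obtain K where K: "K \<ge> 0" "AE r in lborel. r \<in> {s..t} \<longrightarrow> norm (\<gamma>' r) \<le> K"
    using W1inf_bound[OF assms(1)] by blast
  have "bounded (\<phi> ` cball 0 K)"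
    by (rule compact_imp_bounded[OF compact_continuous_image[OF continuous_on_subset[OF assms(2)] compact_cball]]) simp
  then obtain C where C: "\<And>z. norm z \<le> K \<Longrightarrow> norm (\<phi> z) \<le> C"
    unfolding bounded_iff by (metis imageI mem_cball_0)
  have [measurable]: "(\<lambda>r. indicat_real {s..t} r *\<^sub>R \<gamma>' r) \<in> borel_measurable lborel"
    using W1inf_measurable[OF assms(1)] by (simp add: set_borel_measurable_def)
  have [measurable]: "\<phi> \<in> borel_measurable borel"
    by (rule borel_measurable_continuous_onI[OF assms(2)])
  have meas: "(\<lambda>r. indicat_real {s..t} r *\<^sub>R \<phi> (indicat_real {s..t} r *\<^sub>R \<gamma>' r)) \<in> borel_measurable lborel"
    by measurable
  have eq: "(\<lambda>r. indicat_real {s..t} r *\<^sub>R \<phi> (indicat_real {s..t} r *\<^sub>R \<gamma>' r))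
      = (\<lambda>r. indicat_real {s..t} r *\<^sub>R \<phi> (\<gamma>' r))"
    by (auto simp: indicator_def)
  have "set_borel_measurable lborel {s..t} (\<lambda>r. \<phi> (\<gamma>' r))"
    using meas unfolding set_borel_measurable_def eq .
  moreover have "AE r in lborel. r \<in> {s..t} \<longrightarrow> norm (\<phi> (\<gamma>' r)) \<le> C"
    using K(2) by eventually_elim (use C in auto)
  ultimately show ?thesis by (rule set_integrable_of_bounded)
qed

lemma W1inf_integrable_inner:
  fixes \<gamma> :: "real \<Rightarrow> real ^ 'n"
  assumes "W1inf s t \<gamma> \<gamma>'" "continuous_on {s..t} W"
  shows "set_integrable lborel {s..t} (\<lambda>r. \<gamma>' r \<bullet> W r)"
proof -
  obtain K where K: "K \<ge> 0" "AE r in lborel. r \<in> {s..t} \<longrightarrow> norm (\<gamma>' r) \<le> K"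
    using W1inf_bound[OF assms(1)] by blast
  obtain C where C: "C \<ge> 0" "\<And>r. r \<in> {s..t} \<Longrightarrow> norm (W r) \<le> C"
  proof -
    have "bounded (W ` {s..t})"
      by (rule compact_imp_bounded[OF compact_continuous_image[OF assms(2) compact_Icc]])
    then obtain C where "\<And>r. r \<in> {s..t} \<Longrightarrow> norm (W r) \<le> C"
      unfolding bounded_iff by blast
    then show ?thesis using that[of "max C 0"] by fastforce
  qed
  have [measurable]: "(\<lambda>r. indicat_real {s..t} r *\<^sub>R \<gamma>' r) \<in> borel_measurable lborel"
    using W1inf_measurable[OF assms(1)] by (simp add: set_borel_measurable_def)
  have [measurable]: "(\<lambda>r. indicat_real {s..t} r *\<^sub>R W r) \<in> borel_measurable lborel"
    using borel_measurable_continuous_on_indicator[OF _ assms(2)] by simp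
  have meas: "(\<lambda>r. (indicat_real {s..t} r *\<^sub>R \<gamma>' r) \<bullet> (indicat_real {s..t} r *\<^sub>R W r)) \<in> borel_measurable lborel"
    by measurable
  have eq: "(\<lambda>r. (indicat_real {s..t} r *\<^sub>R \<gamma>' r) \<bullet> (indicat_real {s..t} r *\<^sub>R W r))
      = (\<lambda>r. indicat_real {s..t} r *\<^sub>R (\<gamma>' r \<bullet> W r))"
    by (auto simp: indicator_def)
  have "set_borel_measurable lborel {s..t} (\<lambda>r. \<gamma>' r \<bullet> W r)"
    using meas unfolding set_borel_measurable_def eq .
  moreover have "AE r in lborel. r \<in> {s..t} \<longrightarrow> norm (\<gamma>' r \<bullet> W r) \<le> K * C"
    using K(2)
  proof eventually_elim
    fix r assume r: "r \<in> {s..t} \<longrightarrow> norm (\<gamma>' r) \<le> K"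
    have "norm (\<gamma>' r \<bullet> W r) \<le> norm (\<gamma>' r) * norm (W r)"
      by (simp add: Cauchy_Schwarz_ineq2)
    also have "norm (\<gamma>' r) * norm (W r) \<le> K * C" if "r \<in> {s..t}"
      using r C K that by (intro mult_mono) auto
    finally show "r \<in> {s..t} \<longrightarrow> norm (\<gamma>' r \<bullet> W r) \<le> K * C" by blast
  qed
  ultimately show ?thesis by (rule set_integrable_of_bounded)
qed

text \<open>
  The curve need not be differentiable at any given time, so the usual chain rule does not apply. Instead
  compare \<open>G\<close> along the curve with the primitive of the claimed derivative: over a short interval
  near \<open>r\<close> both are \<open>(\<gamma> u - \<gamma> r) \<bullet> grad (\<gamma> r)\<close> up to \<open>o(u - r)\<close>. Their difference therefore has derivative
  zero at every time and is constant.
\<close>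

lemma W1inf_chain_rule:
  fixes \<gamma> :: "real \<Rightarrow> real ^ 'n"
  assumes W: "W1inf s t \<gamma> \<gamma>'" and "s \<le> t"
    and deriv: "\<And>x. (G has_derivative (\<lambda>h. h \<bullet> grad x)) (at x)"
    and cont: "continuous_on UNIV grad"
  shows "(LBINT r:{s..t}. \<gamma>' r \<bullet> grad (\<gamma> r)) = G (\<gamma> t) - G (\<gamma> s)"
proof -
  obtain K where K: "K \<ge> 0" "AE r in lborel. r \<in> {s..t} \<longrightarrow> norm (\<gamma>' r) \<le> K"
    using W1inf_bound[OF W] by blast
  have cgrad: "continuous_on {s..t} (\<lambda>r. grad (\<gamma> r))"
    by (rule continuous_on_compose2[OF cont W1inf_continuous[OF W]]) auto
  have int: "set_integrable lborel {s..t} (\<lambda>r. \<gamma>' r \<bullet> grad (\<gamma> r))"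
    by (rule W1inf_integrable_inner[OF W cgrad])
  define I where "I a b = (LBINT r:{a..b}. \<gamma>' r \<bullet> grad (\<gamma> r))" for a b
  define \<Phi> where "\<Phi> r = G (\<gamma> r) - I s r" for r
  \<comment> \<open>The increment of the primitive, compared with its value for a gradient frozen at \<open>c\<close>.\<close>
  have incr: "norm ((I s b - I s a) - (\<gamma> b - \<gamma> a) \<bullet> c) \<le> K * e * (b - a)"
    if ab: "s \<le> a" "a \<le> b" "b \<le> t" and e: "\<And>r. r \<in> {a..b} \<Longrightarrow> norm (grad (\<gamma> r) - c) \<le> e" for a b c e
  proof -
    have Wab: "W1inf a b \<gamma> \<gamma>'" by (rule W1inf_subinterval[OF W ab])
    have int': "set_integrable lborel {s..b} (\<lambda>r. \<gamma>' r \<bullet> grad (\<gamma> r))"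
      by (rule set_integrable_subset[OF int]) (use ab in auto)
    have "I s b - I s a = I a b"
      unfolding I_def using set_integral_split[OF int', of a] ab by simp
    moreover have "(\<gamma> b - \<gamma> a) \<bullet> c = (LBINT r:{a..b}. \<gamma>' r \<bullet> c)"
      using W1inf_increment[OF W ab] W1inf_set_integrable[OF Wab]
      by (simp add: set_lebesgue_integral_def set_integrable_def flip: integral_inner_left)
    moreover have "(LBINT r:{a..b}. \<gamma>' r \<bullet> grad (\<gamma> r)) - (LBINT r:{a..b}. \<gamma>' r \<bullet> c)
        = (LBINT r:{a..b}. \<gamma>' r \<bullet> (grad (\<gamma> r) - c))"
      unfolding inner_diff_right
      by (intro set_integral_diff(2)[symmetric] W1inf_integrable_inner[OF Wab] continuous_on_const
          continuous_on_subset[OF cgrad]) (use ab in auto)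
    moreover have "norm (LBINT r:{a..b}. \<gamma>' r \<bullet> (grad (\<gamma> r) - c)) \<le> (K * e) * (b - a)"
    proof (rule set_integral_bound)
      show "set_integrable lborel {a..b} (\<lambda>r. \<gamma>' r \<bullet> (grad (\<gamma> r) - c))"
        by (intro W1inf_integrable_inner[OF Wab] continuous_intros continuous_on_subset[OF cgrad]) (use ab in auto)
      show "AE r in lborel. r \<in> {a..b} \<longrightarrow> norm (\<gamma>' r \<bullet> (grad (\<gamma> r) - c)) \<le> K * e"
        using K(2)
      proof eventually_elim
        fix r assume r: "r \<in> {s..t} \<longrightarrow> norm (\<gamma>' r) \<le> K"
        have "norm (\<gamma>' r \<bullet> (grad (\<gamma> r) - c)) \<le> norm (\<gamma>' r) * norm (grad (\<gamma> r) - c)"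
          by (simp add: Cauchy_Schwarz_ineq2)
        also have "norm (\<gamma>' r) * norm (grad (\<gamma> r) - c) \<le> K * e" if "r \<in> {a..b}"
          using r e[OF that] K(1) ab that by (intro mult_mono) auto
        finally show "r \<in> {a..b} \<longrightarrow> norm (\<gamma>' r \<bullet> (grad (\<gamma> r) - c)) \<le> K * e" by blast
      qed
    qed fact
    ultimately show ?thesis by (simp add: I_def)
  qed
  have "(\<Phi> has_derivative (\<lambda>h. 0)) (at r within {s..t})" if r: "r \<in> {s..t}" for r
    unfolding has_derivative_within_alt
  proof (intro conjI allI impI)
    fix e' :: real assume "e' > 0"
    \<comment> \<open>Half of \<open>e'\<close> goes to each of the two expansions; \<open>K + 1\<close> avoids a division by zero.\<close>
    define e where "e = e' / (2 * (K + 1))"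
    have e: "e > 0" using \<open>e' > 0\<close> K by (simp add: e_def)
    have Ke: "2 * (K * e) \<le> e'"
      using \<open>e' > 0\<close> K by (simp add: e_def field_simps)
    obtain d1 where d1: "d1 > 0" "\<And>u. u \<in> {s..t} \<Longrightarrow> \<bar>u - r\<bar> < d1 \<Longrightarrow> norm (grad (\<gamma> u) - grad (\<gamma> r)) \<le> e"
      using cgrad r e unfolding continuous_on_iff dist_norm by (metis less_eq_real_def real_norm_def)
    obtain d2 where d2: "d2 > 0" "\<And>y. norm (y - \<gamma> r) < d2 \<Longrightarrow>
        norm (G y - G (\<gamma> r) - (y - \<gamma> r) \<bullet> grad (\<gamma> r)) \<le> e * norm (y - \<gamma> r)"
      using deriv[of "\<gamma> r"] e unfolding has_derivative_at_alt by blast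
    show "\<exists>d>0. \<forall>u\<in>{s..t}. norm (u - r) < d \<longrightarrow> norm (\<Phi> u - \<Phi> r - 0) \<le> e' * norm (u - r)"
    proof (intro exI[of _ "min d1 (d2 / (K + 1))"] conjI ballI impI)
      show "0 < min d1 (d2 / (K + 1))" using d1 d2 K by auto
      fix u assume u: "u \<in> {s..t}" "norm (u - r) < min d1 (d2 / (K + 1))"
      have lip: "norm (\<gamma> u - \<gamma> r) \<le> K * \<bar>u - r\<bar>"
        using W1inf_lipschitz[OF W K(2) r u(1)] .
      also have "\<dots> \<le> (K + 1) * \<bar>u - r\<bar>" by (simp add: mult_right_mono)
      also have "\<dots> < d2" using u(2) K by (simp add: field_simps)
      finally have "norm (G (\<gamma> u) - G (\<gamma> r) - (\<gamma> u - \<gamma> r) \<bullet> grad (\<gamma> r)) \<le> e * norm (\<gamma> u - \<gamma> r)"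
        by (rule d2(2))
      also have "\<dots> \<le> K * e * \<bar>u - r\<bar>"
        using mult_left_mono[OF lip, of e] e by (simp add: algebra_simps)
      finally have 1: "norm (G (\<gamma> u) - G (\<gamma> r) - (\<gamma> u - \<gamma> r) \<bullet> grad (\<gamma> r)) \<le> K * e * \<bar>u - r\<bar>" .
      have 2: "norm ((I s u - I s r) - (\<gamma> u - \<gamma> r) \<bullet> grad (\<gamma> r)) \<le> K * e * \<bar>u - r\<bar>"
      proof (cases "r \<le> u")
        case True
        then show ?thesis
          using incr[of r u "grad (\<gamma> r)" e] u r d1(2) by auto
      next
        case False
        then have "norm ((I s r - I s u) - (\<gamma> r - \<gamma> u) \<bullet> grad (\<gamma> r)) \<le> K * e * \<bar>u - r\<bar>"
          using incr[of u r "grad (\<gamma> r)" e] u r d1(2) by auto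
        moreover have "(I s r - I s u) - (\<gamma> r - \<gamma> u) \<bullet> grad (\<gamma> r)
            = - ((I s u - I s r) - (\<gamma> u - \<gamma> r) \<bullet> grad (\<gamma> r))"
          by (simp add: inner_diff_left)
        ultimately show ?thesis by (metis norm_minus_cancel)
      qed
      have "norm (\<Phi> u - \<Phi> r - 0) \<le> 2 * (K * e) * \<bar>u - r\<bar>"
        using 1 2 by (simp add: \<Phi>_def)
      also have "\<dots> \<le> e' * \<bar>u - r\<bar>" using Ke by (rule mult_right_mono) simp
      finally show "norm (\<Phi> u - \<Phi> r - 0) \<le> e' * norm (u - r)" by simp
    qed
  qed simp
  then obtain c where "\<And>r. r \<in> {s..t} \<Longrightarrow> \<Phi> r = c"
    using has_derivative_zero_constant[of "{s..t}" \<Phi>] by auto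
  then have "\<Phi> t = \<Phi> s" using \<open>s \<le> t\<close> by simp
  moreover have "I s s = 0" unfolding I_def by (rule set_integral_singleton)
  ultimately show ?thesis by (simp add: \<Phi>_def I_def)
qed

lemma W1inf_C1:
  fixes \<gamma> :: "real \<Rightarrow> real ^ 'n"
  assumes deriv: "\<And>r. (\<gamma> has_vector_derivative \<gamma>' r) (at r)" and cont: "continuous_on UNIV \<gamma>'"
  shows "W1inf s t \<gamma> \<gamma>'"
  unfolding W1inf_def
proof (intro conjI ballI)
  have cont': "continuous_on {a..b} \<gamma>'" for a b
    by (rule continuous_on_subset[OF cont]) simp
  show "set_borel_measurable lborel {s..t} \<gamma>'"
    using borel_measurable_continuous_on_indicator[OF _ cont'] by (simp add: set_borel_measurable_def)
  have "bounded (\<gamma>' ` {s..t})"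
    by (rule compact_imp_bounded[OF compact_continuous_image[OF cont' compact_Icc]])
  then obtain K where "\<And>r. r \<in> {s..t} \<Longrightarrow> norm (\<gamma>' r) \<le> K"
    unfolding bounded_iff by blast
  then show "\<exists>K. AE r in lborel. r \<in> {s..t} \<longrightarrow> norm (\<gamma>' r) \<le> K"
    by (intro exI[of _ K]) simp
  fix r assume r: "r \<in> {s..t}"
  have "(\<gamma>' has_integral (\<gamma> r - \<gamma> s)) {s..r}"
    by (rule fundamental_theorem_of_calculus)
      (use r deriv in \<open>auto intro: has_vector_derivative_at_within\<close>)
  then have "integral {s..r} \<gamma>' = \<gamma> r - \<gamma> s" by (rule integral_unique)
  moreover have "(LBINT u:{s..r}. \<gamma>' u) = integral {s..r} \<gamma>'"
    by (rule set_borel_integral_eq_integral(2)[OF borel_integrable_atLeastAtMost'[OF cont']])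
  ultimately show "\<gamma> r = \<gamma> s + (LBINT u:{s..r}. \<gamma>' u)" by simp
qed

lemma W1inf_concat:
  fixes \<gamma>\<^sub>1 \<gamma>\<^sub>2 :: "real \<Rightarrow> real ^ 'n"
  assumes W: "W1inf s u \<gamma>\<^sub>1 \<gamma>\<^sub>1'" "W1inf u t \<gamma>\<^sub>2 \<gamma>\<^sub>2'" and u: "s \<le> u" "u \<le> t" and "\<gamma>\<^sub>1 u = \<gamma>\<^sub>2 u"
  shows "W1inf s t (\<lambda>r. if r \<le> u then \<gamma>\<^sub>1 r else \<gamma>\<^sub>2 r) (\<lambda>r. if r \<le> u then \<gamma>\<^sub>1' r else \<gamma>\<^sub>2' r)"
    (is "W1inf s t ?\<gamma> ?\<gamma>'")
proof -
  have eq1: "(LBINT r:{s..v}. ?\<gamma>' r) = (LBINT r:{s..v}. \<gamma>\<^sub>1' r)" if "v \<le> u" for v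
    by (rule set_lebesgue_integral_cong) (use that in auto)
  have eq2: "(LBINT r:{u..v}. ?\<gamma>' r) = (LBINT r:{u..v}. \<gamma>\<^sub>2' r)" for v
    unfolding set_lebesgue_integral_def
    by (rule integral_discrete_difference[of "{u}"]) (auto simp: indicator_def)
  have [measurable]: "(\<lambda>r. indicat_real {s..u} r *\<^sub>R \<gamma>\<^sub>1' r) \<in> borel_measurable borel"
      "(\<lambda>r. indicat_real {u..t} r *\<^sub>R \<gamma>\<^sub>2' r) \<in> borel_measurable borel"
    using W1inf_measurable[OF W(1)] W1inf_measurable[OF W(2)] by (simp_all add: set_borel_measurable_def)
  have meas: "(\<lambda>r. if r \<le> u then indicat_real {s..u} r *\<^sub>R \<gamma>\<^sub>1' r else indicat_real {u..t} r *\<^sub>R \<gamma>\<^sub>2' r)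
      \<in> borel_measurable borel"
    by measurable
  have eq: "(\<lambda>r. if r \<le> u then indicat_real {s..u} r *\<^sub>R \<gamma>\<^sub>1' r else indicat_real {u..t} r *\<^sub>R \<gamma>\<^sub>2' r)
      = (\<lambda>r. indicat_real {s..t} r *\<^sub>R ?\<gamma>' r)"
    using u by (auto simp: indicator_def)
  have m: "set_borel_measurable lborel {s..t} ?\<gamma>'"
    using meas unfolding set_borel_measurable_def eq by simp
  obtain K\<^sub>1 K\<^sub>2 where "AE r in lborel. r \<in> {s..u} \<longrightarrow> norm (\<gamma>\<^sub>1' r) \<le> K\<^sub>1"
      "AE r in lborel. r \<in> {u..t} \<longrightarrow> norm (\<gamma>\<^sub>2' r) \<le> K\<^sub>2"
    using W unfolding W1inf_def by blast
  then have bd: "AE r in lborel. r \<in> {s..t} \<longrightarrow> norm (?\<gamma>' r) \<le> max K\<^sub>1 K\<^sub>2"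
    by eventually_elim auto
  have int: "set_integrable lborel {s..t} ?\<gamma>'"
    by (rule set_integrable_of_bounded[OF m bd])
  have "?\<gamma> r = ?\<gamma> s + (LBINT u:{s..r}. ?\<gamma>' u)" if r: "r \<in> {s..t}" for r
  proof (cases "r \<le> u")
    case True
    have "\<gamma>\<^sub>1 r - \<gamma>\<^sub>1 s = (LBINT u:{s..r}. \<gamma>\<^sub>1' u)"
      by (rule W1inf_increment[OF W(1)]) (use True r in auto)
    then show ?thesis using True u r by (simp add: eq1 algebra_simps)
  next
    case False
    have 1: "\<gamma>\<^sub>1 u - \<gamma>\<^sub>1 s = (LBINT u:{s..u}. ?\<gamma>' u)"
      using W1inf_increment[OF W(1), of s u] u by (simp add: eq1)
    have 2: "\<gamma>\<^sub>2 r - \<gamma>\<^sub>2 u = (LBINT u:{u..r}. ?\<gamma>' u)"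
      using W1inf_increment[OF W(2), of u r] u False r by (simp add: eq2)
    have "set_integrable lborel {s..r} ?\<gamma>'"
      by (rule set_integrable_subset[OF int]) (use r in auto)
    then have "(LBINT u:{s..r}. ?\<gamma>' u) = (LBINT u:{s..u}. ?\<gamma>' u) + (LBINT u:{u..r}. ?\<gamma>' u)"
      by (rule set_integral_split) (use u False in auto)
    also have "\<dots> = (\<gamma>\<^sub>1 u - \<gamma>\<^sub>1 s) + (\<gamma>\<^sub>2 r - \<gamma>\<^sub>2 u)" by (simp only: 1 2)
    also have "\<dots> = \<gamma>\<^sub>2 r - \<gamma>\<^sub>1 s" using \<open>\<gamma>\<^sub>1 u = \<gamma>\<^sub>2 u\<close> by simp
    finally show ?thesis using u False by simp
  qed
  then show ?thesis unfolding W1inf_def using m bd by blast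
qed

section \<open>The action of a curve for a fixed realization\<close>

text \<open>
  The transpose of \<open>A\<close> applied to \<open>\<beta>\<close>. It moves the velocity of a curve out of the derivative of the field,
  so that the integrand of the pathwise stochastic integral becomes a scalar product of the velocity
  with a continuous function of time.
\<close>

definition blinfun_pullback :: "((real ^ 'n) \<Rightarrow>\<^sub>L (real ^ 'm)) \<Rightarrow> real ^ 'm \<Rightarrow> real ^ 'n" where
  "blinfun_pullback A \<beta> = (\<chi> j. blinfun_apply A (axis j 1) \<bullet> \<beta>)"

lemma blinfun_pullback_inner: "u \<bullet> blinfun_pullback A \<beta> = blinfun_apply A u \<bullet> \<beta>"
proof -
  have "blinfun_apply A u = (\<Sum>j\<in>UNIV. (u $ j) *\<^sub>R blinfun_apply A (axis j 1))"
    by (subst basis_expansion[of u, symmetric])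
      (simp add: blinfun.sum_right blinfun.scaleR_right scalar_mult_eq_scaleR)
  then show ?thesis
    by (simp add: blinfun_pullback_def inner_vec_def[of u] inner_sum_left)
qed

lemma norm_blinfun_pullback_le: "norm (blinfun_pullback A \<beta>) \<le> norm A * norm \<beta>"
proof (cases "blinfun_pullback A \<beta> = 0")
  case False
  define w where "w = blinfun_pullback A \<beta>"
  have "norm w * norm w = blinfun_apply A w \<bullet> \<beta>"
    using blinfun_pullback_inner[of w A \<beta>] by (simp add: w_def power2_norm_eq_inner flip: power2_eq_square)
  also have "\<dots> \<le> norm (blinfun_apply A w) * norm \<beta>" by (rule norm_cauchy_schwarz)
  also have "\<dots> \<le> (norm A * norm w) * norm \<beta>" by (intro mult_right_mono norm_blinfun) simp
  finally have "norm w * norm w \<le> (norm A * norm \<beta>) * norm w" by (simp add: algebra_simps)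
  then show ?thesis using False by (simp add: w_def)
qed simp

lemma blinfun_pullback_diff: "blinfun_pullback A (\<beta> - \<beta>') = blinfun_pullback A \<beta> - blinfun_pullback A \<beta>'"
  by (simp add: blinfun_pullback_def inner_diff_right vec_eq_iff)

lemma continuous_on_blinfun_pullback:
  assumes "continuous_on S A" "continuous_on S \<beta>"
  shows "continuous_on S (\<lambda>r. blinfun_pullback (A r) (\<beta> r))"
  unfolding blinfun_pullback_def
  by (intro continuous_on_vec_lambda continuous_intros assms)

lemma total_deriv_has_derivative:
  assumes "C1b g"
  shows "(g has_derivative blinfun_apply (total_deriv g x)) (at x)"
proof -
  have "g differentiable (at x)" using assms by (simp add: C1b_def)
  then have "(g has_derivative frechet_derivative g (at x)) (at x)"
    by (simp add: frechet_derivative_works)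
  moreover from this have "bounded_linear (frechet_derivative g (at x))"
    by (rule has_derivative_bounded_linear)
  ultimately show ?thesis
    by (simp add: total_deriv_def bounded_linear_Blinfun_apply)
qed

definition action ::
    "(real ^ 'n \<Rightarrow> real) \<Rightarrow> (real ^ 'n \<Rightarrow> real ^ 'm) \<Rightarrow> (real \<Rightarrow> real ^ 'm) \<Rightarrow> real \<Rightarrow> real \<Rightarrow>
      (real \<Rightarrow> real ^ 'n) \<Rightarrow> (real \<Rightarrow> real ^ 'n) \<Rightarrow> real" where
  "action H g b s t \<gamma> \<gamma>' = (LBINT r:{s..t}. convex_conjugate H (\<gamma>' r)) + path_integral g b s t \<gamma> \<gamma>'"

lemma path_integral_pullback:
  "path_integral g b s t \<gamma> \<gamma>' = g (\<gamma> t) \<bullet> b t - g (\<gamma> s) \<bullet> b s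
     - (LBINT r:{s..t}. \<gamma>' r \<bullet> blinfun_pullback (total_deriv g (\<gamma> r)) (b r))"
  by (simp add: path_integral_def blinfun_pullback_inner)

lemma continuous_on_pullback_along:
  assumes "W1inf s t \<gamma> \<gamma>'" "C1b g" "continuous_on {s..t} b"
  shows "continuous_on {s..t} (\<lambda>r. blinfun_pullback (total_deriv g (\<gamma> r)) (b r))"
proof (rule continuous_on_blinfun_pullback[OF _ assms(3)])
  have "continuous_on UNIV (total_deriv g)" using assms(2) by (simp add: C1b_def)
  then show "continuous_on {s..t} (\<lambda>r. total_deriv g (\<gamma> r))"
    by (rule continuous_on_compose2[OF _ W1inf_continuous[OF assms(1)]]) simp
qed

lemma action_split:
  assumes H: "admissible_hamiltonian H" and g: "C1b g" and W: "W1inf s t \<gamma> \<gamma>'"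
    and b: "continuous_on {s..t} b" and u: "s \<le> u" "u \<le> t"
  shows "action H g b s t \<gamma> \<gamma>' = action H g b s u \<gamma> \<gamma>' + action H g b u t \<gamma> \<gamma>'"
  unfolding action_def path_integral_pullback
  using set_integral_split[OF W1inf_integrable_continuous[OF W conjugate_continuous[OF H]] u]
    set_integral_split[OF W1inf_integrable_inner[OF W continuous_on_pullback_along[OF W g b]] u]
  by simp

text \<open>
  By the chain rule, replacing the noise \<open>b\<close> by its increment \<open>b - b s\<close> does not change the integral. Only
  increments over one time block then enter the estimates, and these do not grow with time.
\<close>

lemma stochastic_integral_by_increments:
  assumes g: "C1b g" and W: "W1inf s t \<gamma> \<gamma>'" and b: "continuous_on {s..t} b" and "s \<le> t"
  shows "path_integral g b s t \<gamma> \<gamma>' = g (\<gamma> t) \<bullet> (b t - b s)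
    - (LBINT r:{s..t}. \<gamma>' r \<bullet> blinfun_pullback (total_deriv g (\<gamma> r)) (b r - b s))"
proof -
  have cont: "continuous_on UNIV (\<lambda>x. blinfun_pullback (total_deriv g x) (b s))"
    using g by (intro continuous_on_blinfun_pullback continuous_on_const) (simp add: C1b_def)
  have "((\<lambda>x. g x \<bullet> b s) has_derivative (\<lambda>h. h \<bullet> blinfun_pullback (total_deriv g x) (b s))) (at x)" for x
    unfolding blinfun_pullback_inner
    by (rule has_derivative_inner_left[OF total_deriv_has_derivative[OF g]])
  from W1inf_chain_rule[OF W \<open>s \<le> t\<close> this cont]
  have chain: "(LBINT r:{s..t}. \<gamma>' r \<bullet> blinfun_pullback (total_deriv g (\<gamma> r)) (b s))
      = g (\<gamma> t) \<bullet> b s - g (\<gamma> s) \<bullet> b s" .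
  have "(LBINT r:{s..t}. \<gamma>' r \<bullet> blinfun_pullback (total_deriv g (\<gamma> r)) (b r - b s))
      = (LBINT r:{s..t}. \<gamma>' r \<bullet> blinfun_pullback (total_deriv g (\<gamma> r)) (b r))
      - (LBINT r:{s..t}. \<gamma>' r \<bullet> blinfun_pullback (total_deriv g (\<gamma> r)) (b s))"
    unfolding blinfun_pullback_diff inner_diff_right
    by (intro set_integral_diff(2) W1inf_integrable_inner[OF W] continuous_on_pullback_along[OF W g]
        b continuous_on_const)
  then show ?thesis
    unfolding path_integral_pullback chain by (simp add: inner_diff_right)
qed

text \<open>
  The growth bound for \<open>H\<close>, evaluated at a momentum of norm \<open>R\<close> that has been perturbed by at most
  \<open>M * norm z\<close>.
\<close>

definition fluctuation_cost :: "real \<Rightarrow> real \<Rightarrow> real \<Rightarrow> real \<Rightarrow> real ^ 'm \<Rightarrow> real" where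
  "fluctuation_cost C q R M z = C * ((R + M * norm z) powr q + 1)"

lemma continuous_on_fluctuation_cost:
  fixes b :: "real \<Rightarrow> real ^ 'm"
  assumes "q > 0" "continuous_on S b" "R \<ge> 0" "M \<ge> 0"
  shows "continuous_on S (\<lambda>r. fluctuation_cost C q R M (b r))"
  unfolding fluctuation_cost_def
  using assms by (intro continuous_intros continuous_on_powr') auto

text \<open>
  Write the noise term as \<open>- \<gamma>' r \<bullet> w r\<close>, where \<open>w r\<close> is the derivative of the field transposed and applied to
  the noise increment. Fenchel-Young at the momentum \<open>p + w r\<close> bounds the integrand below by
  \<open>p \<bullet> \<gamma>' r - H (p + w r)\<close>: the velocity disappears, apart from a term that integrates to
  \<open>p \<bullet> (\<gamma> t - \<gamma> s)\<close>, and the remaining error depends on the noise only.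
\<close>

lemma action_lower_bound:
  fixes H :: "real ^ 'n \<Rightarrow> real" and g :: "real ^ 'n \<Rightarrow> real ^ 'm"
  assumes H: "admissible_hamiltonian H" and growth: "C > 0" "q > 0" "\<And>p. H p \<le> C * (norm p powr q + 1)"
    and g: "C1b g" "\<And>x. norm (g x) \<le> M" "\<And>x. norm (total_deriv g x) \<le> M"
    and W: "W1inf s t \<gamma> \<gamma>'" and b: "continuous_on {s..t} b" and "s \<le> t"
  shows "p \<bullet> (\<gamma> t - \<gamma> s) - (M * norm (b t - b s)
      + integral {s..t} (\<lambda>r. fluctuation_cost C q (norm p) M (b r - b s))) \<le> action H g b s t \<gamma> \<gamma>'"
proof -
  define w where "w r = blinfun_pullback (total_deriv g (\<gamma> r)) (b r - b s)" for r
  define \<psi> where "\<psi> r = fluctuation_cost C q (norm p) M (b r - b s)" for r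
  have M: "M \<ge> 0" using g(2)[of 0] norm_ge_zero order_trans by blast
  have cb: "continuous_on {s..t} (\<lambda>r. b r - b s)" by (intro continuous_intros b)
  have c\<psi>: "continuous_on {s..t} \<psi>"
    unfolding \<psi>_def by (intro continuous_on_fluctuation_cost cb growth M) simp
  have i\<psi>: "set_integrable lborel {s..t} \<psi>"
    by (rule borel_integrable_atLeastAtMost'[OF c\<psi>])
  have iw: "set_integrable lborel {s..t} (\<lambda>r. \<gamma>' r \<bullet> w r)"
    unfolding w_def by (rule W1inf_integrable_inner[OF W continuous_on_pullback_along[OF W g(1) cb]])
  have ip: "set_integrable lborel {s..t} (\<lambda>r. \<gamma>' r \<bullet> p)"
    by (rule W1inf_integrable_inner[OF W continuous_on_const])
  have iH: "set_integrable lborel {s..t} (\<lambda>r. convex_conjugate H (\<gamma>' r))"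
    by (rule W1inf_integrable_continuous[OF W conjugate_continuous[OF H]])
  have pointwise: "\<gamma>' r \<bullet> p - \<psi> r \<le> convex_conjugate H (\<gamma>' r) - \<gamma>' r \<bullet> w r" for r
  proof -
    have "norm (w r) \<le> M * norm (b r - b s)"
      unfolding w_def using norm_blinfun_pullback_le mult_right_mono[OF g(3)] norm_ge_zero order_trans by blast
    then have "norm (p + w r) \<le> norm p + M * norm (b r - b s)"
      using norm_triangle_ineq[of p "w r"] by linarith
    then have "norm (p + w r) powr q \<le> (norm p + M * norm (b r - b s)) powr q"
      using growth by (intro powr_mono2) auto
    then have "H (p + w r) \<le> \<psi> r"
      using growth(3)[of "p + w r"] growth(1) unfolding \<psi>_def fluctuation_cost_def
      by (smt (verit) mult_left_mono)
    moreover have "(p + w r) \<bullet> \<gamma>' r - H (p + w r) \<le> convex_conjugate H (\<gamma>' r)"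
      by (rule fenchel_young[OF H])
    moreover have "(p + w r) \<bullet> \<gamma>' r = \<gamma>' r \<bullet> p + \<gamma>' r \<bullet> w r"
      unfolding inner_commute[of _ "\<gamma>' r"] by (rule inner_add_right)
    ultimately show ?thesis by linarith
  qed
  have "(LBINT r:{s..t}. \<gamma>' r \<bullet> p) - (LBINT r:{s..t}. \<psi> r)
      = (LBINT r:{s..t}. \<gamma>' r \<bullet> p - \<psi> r)"
    by (rule set_integral_diff(2)[OF ip i\<psi>, symmetric])
  also have "\<dots> \<le> (LBINT r:{s..t}. convex_conjugate H (\<gamma>' r) - \<gamma>' r \<bullet> w r)"
    by (rule set_integral_mono[OF set_integral_diff(1)[OF ip i\<psi>] set_integral_diff(1)[OF iH iw] pointwise])
  also have "\<dots> = (LBINT r:{s..t}. convex_conjugate H (\<gamma>' r)) - (LBINT r:{s..t}. \<gamma>' r \<bullet> w r)"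
    by (rule set_integral_diff(2)[OF iH iw])
  finally have bulk: "(LBINT r:{s..t}. \<gamma>' r \<bullet> p) - (LBINT r:{s..t}. \<psi> r)
      \<le> (LBINT r:{s..t}. convex_conjugate H (\<gamma>' r)) - (LBINT r:{s..t}. \<gamma>' r \<bullet> w r)" .
  have "(LBINT r:{s..t}. \<gamma>' r \<bullet> p) = p \<bullet> (\<gamma> t - \<gamma> s)"
    using W1inf_increment[OF W order_refl \<open>s \<le> t\<close> order_refl] W1inf_set_integrable[OF W]
    by (simp add: set_lebesgue_integral_def set_integrable_def inner_commute[of p] flip: integral_inner_left)
  moreover have "(LBINT r:{s..t}. \<psi> r) = integral {s..t} \<psi>"
    by (rule set_borel_integral_eq_integral(2)[OF i\<psi>])
  moreover have "- (M * norm (b t - b s)) \<le> g (\<gamma> t) \<bullet> (b t - b s)"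
    using Cauchy_Schwarz_ineq2[of "g (\<gamma> t)" "b t - b s"] mult_right_mono[OF g(2)[of "\<gamma> t"], of "norm (b t - b s)"]
    by simp
  ultimately show ?thesis
    using bulk unfolding action_def stochastic_integral_by_increments[OF g(1) W b \<open>s \<le> t\<close>] \<psi>_def w_def
    by linarith
qed

lemma action_lower_bound_blocks:
  fixes H :: "real ^ 'n \<Rightarrow> real" and g :: "real ^ 'n \<Rightarrow> real ^ 'm"
  assumes H: "admissible_hamiltonian H" and growth: "C > 0" "q > 0" "\<And>p. H p \<le> C * (norm p powr q + 1)"
    and g: "C1b g" "\<And>x. norm (g x) \<le> M" "\<And>x. norm (total_deriv g x) \<le> M"
    and W: "W1inf 0 (real N) \<gamma> \<gamma>'" and b: "continuous_on {0..} b"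
  shows "p \<bullet> (\<gamma> (real N) - \<gamma> 0) - (\<Sum>k<N. M * norm (b (real k + 1) - b (real k))
      + integral {real k..real k + 1} (\<lambda>r. fluctuation_cost C q (norm p) M (b r - b (real k))))
      \<le> action H g b 0 (real N) \<gamma> \<gamma>'"
  using W
proof (induction N)
  case 0
  then show ?case
    by (simp add: action_def path_integral_def set_integral_singleton del: atLeastAtMost_singleton)
next
  case (Suc N)
  have W: "W1inf 0 (real N) \<gamma> \<gamma>'" "W1inf (real N) (real N + 1) \<gamma> \<gamma>'"
    using W1inf_subinterval[OF Suc.prems, of 0 "real N"]
      W1inf_subinterval[OF Suc.prems, of "real N" "real N + 1"] by auto
  have cont: "continuous_on {s..t} b" if "s \<ge> 0" for s t
    by (rule continuous_on_subset[OF b]) (use that in auto)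
  have "action H g b 0 (real (Suc N)) \<gamma> \<gamma>'
      = action H g b 0 (real N) \<gamma> \<gamma>' + action H g b (real N) (real N + 1) \<gamma> \<gamma>'"
    using action_split[OF H g(1) Suc.prems cont, of "real N"] by (simp add: add.commute)
  moreover note Suc.IH[OF W(1)]
  moreover note action_lower_bound[OF H growth g W(2) cont, of p]
  ultimately show ?case by (simp add: inner_diff_right add.commute)
qed

text \<open>
  Velocities matter only almost everywhere; the exceptional time \<open>u\<close> is the junction of two curves.
\<close>

lemma action_cong:
  assumes "\<And>r. r \<in> {s..t} \<Longrightarrow> \<gamma>\<^sub>1 r = \<gamma>\<^sub>2 r" "\<And>r. r \<in> {s..t} \<Longrightarrow> r \<noteq> u \<Longrightarrow> \<gamma>\<^sub>1' r = \<gamma>\<^sub>2' r" "s \<le> t"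
  shows "action H g b s t \<gamma>\<^sub>1 \<gamma>\<^sub>1' = action H g b s t \<gamma>\<^sub>2 \<gamma>\<^sub>2'"
proof -
  have "(LBINT r:{s..t}. convex_conjugate H (\<gamma>\<^sub>1' r)) = (LBINT r:{s..t}. convex_conjugate H (\<gamma>\<^sub>2' r))"
    unfolding set_lebesgue_integral_def
    by (rule integral_discrete_difference[of "{u}"]) (auto simp: indicator_def assms)
  moreover have "(LBINT r:{s..t}. \<gamma>\<^sub>1' r \<bullet> blinfun_pullback (total_deriv g (\<gamma>\<^sub>1 r)) (b r))
      = (LBINT r:{s..t}. \<gamma>\<^sub>2' r \<bullet> blinfun_pullback (total_deriv g (\<gamma>\<^sub>2 r)) (b r))"
    unfolding set_lebesgue_integral_def
    by (rule integral_discrete_difference[of "{u}"]) (auto simp: indicator_def assms)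
  moreover have "\<gamma>\<^sub>1 s = \<gamma>\<^sub>2 s" "\<gamma>\<^sub>1 t = \<gamma>\<^sub>2 t" using assms by auto
  ultimately show ?thesis by (simp only: action_def path_integral_pullback)
qed

text \<open>
  The minimal action is subadditive in time. The statement is about one realization, so in each block the
  cheaper of several competing curves may be chosen after the noise is known.
\<close>

lemma concatenate_blocks:
  fixes H :: "real ^ 'n \<Rightarrow> real" and g :: "real ^ 'n \<Rightarrow> real ^ 'm" and x :: "nat \<Rightarrow> real ^ 'n"
  assumes H: "admissible_hamiltonian H" and g: "C1b g" and b: "continuous_on {0..} b"
    and blocks: "\<And>k. \<exists>\<gamma> \<gamma>'. W1inf (real k) (real k + 1) \<gamma> \<gamma>' \<and> \<gamma> (real k) = x k \<and>
      \<gamma> (real k + 1) = x (Suc k) \<and> action H g b (real k) (real k + 1) \<gamma> \<gamma>' \<le> A k"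
  shows "\<exists>\<gamma> \<gamma>'. W1inf 0 (real N) \<gamma> \<gamma>' \<and> \<gamma> 0 = x 0 \<and> \<gamma> (real N) = x N \<and>
    action H g b 0 (real N) \<gamma> \<gamma>' \<le> (\<Sum>k<N. A k)"
proof (induction N)
  case 0
  have "W1inf 0 0 (\<lambda>r. x 0) (\<lambda>r. 0)"
    by (auto simp: W1inf_def set_borel_measurable_def set_lebesgue_integral_def)
  moreover have "action H g b 0 0 (\<lambda>r. x 0) (\<lambda>r. 0) = 0"
    by (simp only: action_def path_integral_def set_integral_singleton)
  ultimately show ?case
    by (intro exI[of _ "\<lambda>r. x 0"] exI[of _ "\<lambda>r. 0"]) simp
next
  case (Suc N)
  obtain \<gamma>\<^sub>1 \<gamma>\<^sub>1' where 1: "W1inf 0 (real N) \<gamma>\<^sub>1 \<gamma>\<^sub>1'" "\<gamma>\<^sub>1 0 = x 0" "\<gamma>\<^sub>1 (real N) = x N"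
      "action H g b 0 (real N) \<gamma>\<^sub>1 \<gamma>\<^sub>1' \<le> (\<Sum>k<N. A k)"
    using Suc.IH by blast
  obtain \<gamma>\<^sub>2 \<gamma>\<^sub>2' where 2: "W1inf (real N) (real N + 1) \<gamma>\<^sub>2 \<gamma>\<^sub>2'" "\<gamma>\<^sub>2 (real N) = x N"
      "\<gamma>\<^sub>2 (real N + 1) = x (Suc N)" "action H g b (real N) (real N + 1) \<gamma>\<^sub>2 \<gamma>\<^sub>2' \<le> A N"
    using blocks[of N] by blast
  define \<gamma> where "\<gamma> r = (if r \<le> real N then \<gamma>\<^sub>1 r else \<gamma>\<^sub>2 r)" for r
  define \<gamma>' where "\<gamma>' r = (if r \<le> real N then \<gamma>\<^sub>1' r else \<gamma>\<^sub>2' r)" for r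
  have W: "W1inf 0 (real N + 1) \<gamma> \<gamma>'"
    unfolding \<gamma>_def \<gamma>'_def by (rule W1inf_concat[OF 1(1) 2(1)]) (use 1 2 in auto)
  have cont: "continuous_on {0..real N + 1} b"
    by (rule continuous_on_subset[OF b]) auto
  have "action H g b 0 (real N + 1) \<gamma> \<gamma>' = action H g b 0 (real N) \<gamma> \<gamma>' + action H g b (real N) (real N + 1) \<gamma> \<gamma>'"
    by (rule action_split[OF H g W cont]) auto
  also have "action H g b 0 (real N) \<gamma> \<gamma>' = action H g b 0 (real N) \<gamma>\<^sub>1 \<gamma>\<^sub>1'"
    by (rule action_cong) (auto simp: \<gamma>_def \<gamma>'_def)
  also have "action H g b (real N) (real N + 1) \<gamma> \<gamma>' = action H g b (real N) (real N + 1) \<gamma>\<^sub>2 \<gamma>\<^sub>2'"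
    by (rule action_cong[where u = "real N"]) (use 1 2 in \<open>auto simp: \<gamma>_def \<gamma>'_def\<close>)
  finally have "action H g b 0 (real N + 1) \<gamma> \<gamma>' \<le> (\<Sum>k<N. A k) + A N"
    using 1 2 by linarith
  moreover have "\<gamma> 0 = x 0" "\<gamma> (real N + 1) = x (Suc N)"
    using 1 2 by (simp_all add: \<gamma>_def)
  ultimately show ?case
    using W by (intro exI[of _ \<gamma>] exI[of _ \<gamma>']) (simp add: add.commute)
qed

section \<open>Riemann-Stieltjes sums\<close>

text \<open>
  Each increment of \<open>G\<close> is the integral of its derivative, so the error in a cell is controlled by
  the modulus of continuity of \<open>b\<close>.
\<close>

lemma riemann_stieltjes_sums:
  fixes G :: "real \<Rightarrow> 'a :: euclidean_space"
  assumes deriv: "\<And>r. r \<in> {s..s + 1} \<Longrightarrow> (G has_vector_derivative G' r) (at r within {s..s + 1})"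
    and G': "continuous_on {s..s + 1} G'" and b: "continuous_on {s..s + 1} b"
    and tags: "\<And>n i. i < n \<Longrightarrow> c n i \<in> {s + real i / real n..s + real (Suc i) / real n}"
  shows "(\<lambda>n. \<Sum>i<n. (G (s + real (Suc i) / real n) - G (s + real i / real n)) \<bullet> b (c n i))
    \<longlonglongrightarrow> integral {s..s + 1} (\<lambda>r. G' r \<bullet> b r)"
proof (rule LIMSEQ_I)
  fix e :: real assume e: "e > 0"
  have "bounded (G' ` {s..s + 1})"
    by (rule compact_imp_bounded[OF compact_continuous_image[OF G' compact_Icc]])
  then obtain K where K: "K > 0" "\<And>r. r \<in> {s..s + 1} \<Longrightarrow> norm (G' r) \<le> K"
    unfolding bounded_pos by blast
  define \<eta> where "\<eta> = e / (2 * K)"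
  have \<eta>: "\<eta> > 0" using e K by (simp add: \<eta>_def)
  have "uniformly_continuous_on {s..s + 1} b"
    by (rule compact_uniformly_continuous[OF b compact_Icc])
  then obtain d where d: "d > 0" "\<And>r r'. r \<in> {s..s + 1} \<Longrightarrow> r' \<in> {s..s + 1} \<Longrightarrow> dist r' r < d \<Longrightarrow> dist (b r') (b r) < \<eta>"
    using \<eta> unfolding uniformly_continuous_on_def by meson
  obtain n0 :: nat where n0: "real n0 > 1 / d" using reals_Archimedean2 by blast
  show "\<exists>n0. \<forall>n\<ge>n0. norm ((\<Sum>i<n. (G (s + real (Suc i) / real n) - G (s + real i / real n)) \<bullet> b (c n i))
      - integral {s..s + 1} (\<lambda>r. G' r \<bullet> b r)) < e"
  proof (intro exI[of _ n0] allI impI)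
    fix n assume n: "n \<ge> n0"
    have "1 / d > 0" using d by simp
    then have n_pos: "n > 0" using n0 n by (metis gr0I le_zero_eq not_less_iff_gr_or_eq of_nat_0)
    have mesh: "1 / real n < d"
      using n0 n d n_pos by (smt (verit) divide_less_eq mult.commute of_nat_0_less_iff of_nat_mono pos_divide_less_eq)
    define x where "x i = s + real i / real n" for i
    have x_mono: "x i \<le> x (Suc i)" for i by (simp add: x_def divide_right_mono)
    have x_step: "x (Suc i) - x i = 1 / real n" for i by (simp add: x_def add_divide_distrib)
    have x_range: "s \<le> x i" "x i \<le> s + 1" if "i \<le> n" for i
      using that n_pos by (simp_all add: x_def)
    have int: "(\<lambda>r. G' r \<bullet> b r) integrable_on {s..s + 1}"
      by (intro integrable_continuous_real continuous_intros G' b)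
    have split: "integral {s..x k} (\<lambda>r. G' r \<bullet> b r) = (\<Sum>i<k. integral {x i..x (Suc i)} (\<lambda>r. G' r \<bullet> b r))" if "k \<le> n" for k
      using that
    proof (induction k)
      case 0
      then show ?case by (simp add: x_def)
    next
      case (Suc k)
      have "(\<lambda>r. G' r \<bullet> b r) integrable_on {s..x (Suc k)}"
        by (rule integrable_on_subinterval[OF int]) (use x_range[of "Suc k"] Suc.prems in auto)
      then have "integral {s..x (Suc k)} (\<lambda>r. G' r \<bullet> b r)
          = integral {s..x k} (\<lambda>r. G' r \<bullet> b r) + integral {x k..x (Suc k)} (\<lambda>r. G' r \<bullet> b r)"
        using x_range(1)[of k] x_mono[of k] Suc.prems
        by (intro Henstock_Kurzweil_Integration.integral_combine[symmetric]) auto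
      then show ?case using Suc by simp
    qed
    have piece: "norm ((G (x (Suc i)) - G (x i)) \<bullet> b (c n i) - integral {x i..x (Suc i)} (\<lambda>r. G' r \<bullet> b r))
        \<le> K * \<eta> * (1 / real n)" if "i < n" for i
    proof -
      have sub: "{x i..x (Suc i)} \<subseteq> {s..s + 1}"
        using x_range(1)[of i] x_range(2)[of "Suc i"] that by auto
      have "(G' has_integral (G (x (Suc i)) - G (x i))) {x i..x (Suc i)}"
        by (rule fundamental_theorem_of_calculus[OF x_mono])
          (use sub in \<open>auto intro: has_vector_derivative_within_subset[OF deriv]\<close>)
      then have "((\<lambda>r. G' r \<bullet> b (c n i)) has_integral (G (x (Suc i)) - G (x i)) \<bullet> b (c n i)) {x i..x (Suc i)}"
        by (rule has_integral_linear[OF _ bounded_linear_inner_left, unfolded o_def])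
      moreover have "((\<lambda>r. G' r \<bullet> b r) has_integral integral {x i..x (Suc i)} (\<lambda>r. G' r \<bullet> b r)) {x i..x (Suc i)}"
        by (rule integrable_integral[OF integrable_on_subinterval[OF int sub]])
      ultimately have "((\<lambda>r. G' r \<bullet> b (c n i) - G' r \<bullet> b r) has_integral
          (G (x (Suc i)) - G (x i)) \<bullet> b (c n i) - integral {x i..x (Suc i)} (\<lambda>r. G' r \<bullet> b r)) (cbox (x i) (x (Suc i)))"
        unfolding interval_cbox by (rule has_integral_diff)
      then have "norm ((G (x (Suc i)) - G (x i)) \<bullet> b (c n i) - integral {x i..x (Suc i)} (\<lambda>r. G' r \<bullet> b r))
          \<le> K * \<eta> * measure lborel (cbox (x i) (x (Suc i)))"
      proof (rule has_integral_bound[rotated])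
        fix r assume "r \<in> cbox (x i) (x (Suc i))"
        then have r: "r \<in> {x i..x (Suc i)}" by simp
        have ci: "c n i \<in> {x i..x (Suc i)}" using tags[OF that] by (simp add: x_def)
        have "\<bar>c n i - r\<bar> \<le> 1 / real n" using r ci x_step[of i] by auto
        then have "norm (b (c n i) - b r) \<le> \<eta>"
          using d(2)[of r "c n i"] r ci sub mesh by (force simp: dist_norm)
        moreover have "norm (G' r) \<le> K" using K r sub by blast
        ultimately have "norm (G' r) * norm (b (c n i) - b r) \<le> K * \<eta>"
          using K by (intro mult_mono) auto
        moreover have "norm (G' r \<bullet> b (c n i) - G' r \<bullet> b r) \<le> norm (G' r) * norm (b (c n i) - b r)"
          by (metis Cauchy_Schwarz_ineq2 inner_diff_right real_norm_def)
        ultimately show "norm (G' r \<bullet> b (c n i) - G' r \<bullet> b r) \<le> K * \<eta>" by linarith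
      qed (use K \<eta> in simp)
      then show ?thesis using x_mono[of i] x_step[of i] by simp
    qed
    have "norm ((\<Sum>i<n. (G (x (Suc i)) - G (x i)) \<bullet> b (c n i)) - integral {s..s + 1} (\<lambda>r. G' r \<bullet> b r))
        = norm (\<Sum>i<n. (G (x (Suc i)) - G (x i)) \<bullet> b (c n i) - integral {x i..x (Suc i)} (\<lambda>r. G' r \<bullet> b r))"
      using split[of n] n_pos by (simp add: x_def sum_subtractf)
    also have "\<dots> \<le> (\<Sum>i<n. K * \<eta> * (1 / real n))"
      by (rule sum_norm_le) (use piece in auto)
    also have "\<dots> = e / 2" using n_pos K by (simp add: \<eta>_def)
    also have "\<dots> < e" using e by simp
    finally show "norm ((\<Sum>i<n. (G (s + real (Suc i) / real n) - G (s + real i / real n)) \<bullet> b (c n i))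
      - integral {s..s + 1} (\<lambda>r. G' r \<bullet> b r)) < e" by (simp add: x_def)
  qed
qed

lemma riemann_sums:
  fixes \<phi> :: "real \<Rightarrow> real"
  assumes "continuous_on {s..s + 1} \<phi>"
    and "\<And>n i. i < n \<Longrightarrow> c n i \<in> {s + real i / real n..s + real (Suc i) / real n}"
  shows "(\<lambda>n. (\<Sum>i<n. \<phi> (c n i)) / real n) \<longlonglongrightarrow> integral {s..s + 1} \<phi>"
proof -
  have "(\<lambda>n. \<Sum>i<n. ((s + real (Suc i) / real n) - (s + real i / real n)) \<bullet> \<phi> (c n i))
      \<longlonglongrightarrow> integral {s..s + 1} (\<lambda>r. 1 \<bullet> \<phi> r)"
    by (rule riemann_stieltjes_sums[OF _ _ assms, where G' = "\<lambda>r. 1"])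
      (auto simp: has_vector_derivative_id)
  moreover have "(\<Sum>i<n. ((s + real (Suc i) / real n) - (s + real i / real n)) \<bullet> \<phi> (c n i)) = (\<Sum>i<n. \<phi> (c n i)) / real n" for n
    by (simp add: add_divide_distrib sum_divide_distrib)
  ultimately show ?thesis by simp
qed

text \<open>
  Summation by parts turns the sums with left endpoints into the previous ones; their limit is
  the integral by parts. In the application \<open>G\<close> comes from the field and \<open>b\<close> from the
  noise: the sums are linear in the noise increments, so their Laplace transform is computable once the field is frozen.
\<close>

lemma ito_sums:
  fixes G :: "real \<Rightarrow> 'a :: euclidean_space"
  assumes deriv: "\<And>r. r \<in> {s..s + 1} \<Longrightarrow> (G has_vector_derivative G' r) (at r within {s..s + 1})"
    and G': "continuous_on {s..s + 1} G'" and b: "continuous_on {s..s + 1} b"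
  shows "(\<lambda>n. \<Sum>i<n. G (s + real i / real n) \<bullet> (b (s + real (Suc i) / real n) - b (s + real i / real n)))
    \<longlonglongrightarrow> G (s + 1) \<bullet> b (s + 1) - G s \<bullet> b s - integral {s..s + 1} (\<lambda>r. G' r \<bullet> b r)"
proof -
  have parts: "(\<Sum>i<n. G (s + real i / real n) \<bullet> (b (s + real (Suc i) / real n) - b (s + real i / real n)))
      = G (s + 1) \<bullet> b (s + 1) - G s \<bullet> b s
      - (\<Sum>i<n. (G (s + real (Suc i) / real n) - G (s + real i / real n)) \<bullet> b (s + real (Suc i) / real n))"
    if "n > 0" for n
  proof -
    have "(\<Sum>i<k. G (s + real i / real n) \<bullet> (b (s + real (Suc i) / real n) - b (s + real i / real n)))
      = G (s + real k / real n) \<bullet> b (s + real k / real n) - G s \<bullet> b s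
      - (\<Sum>i<k. (G (s + real (Suc i) / real n) - G (s + real i / real n)) \<bullet> b (s + real (Suc i) / real n))" for k
      by (induction k) (simp_all add: inner_diff_left inner_diff_right del: of_nat_Suc)
    from this[of n] show ?thesis using that by simp
  qed
  have "(\<lambda>n. G (s + 1) \<bullet> b (s + 1) - G s \<bullet> b s
      - (\<Sum>i<n. (G (s + real (Suc i) / real n) - G (s + real i / real n)) \<bullet> b (s + real (Suc i) / real n)))
    \<longlonglongrightarrow> G (s + 1) \<bullet> b (s + 1) - G s \<bullet> b s - integral {s..s + 1} (\<lambda>r. G' r \<bullet> b r)"
    by (intro tendsto_intros riemann_stieltjes_sums[OF deriv G' b]) (auto simp: divide_right_mono)
  then show ?thesis
    by (rule Lim_transform_eventually) (use eventually_gt_at_top[of 0] in \<open>eventually_elim, simp only: parts\<close>)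
qed

section \<open>Laplace transforms of stochastic sums\<close>

text \<open>
  Complete the square: multiplying the Gaussian density by \<open>exp (a \<bullet> z)\<close> translates it by \<open>(t - s) *\<^sub>R a\<close>,
  up to the asserted constant, and Lebesgue measure is invariant under translations.
\<close>

lemma (in prob_space) brownian_laplace:
  fixes B :: "real \<Rightarrow> 'a \<Rightarrow> real ^ 'm"
  assumes "standard_brownian_motion B" "0 \<le> s" "s < t"
  shows "(\<integral>\<^sup>+\<omega>. exp (a \<bullet> (B t \<omega> - B s \<omega>)) \<partial>M) = ennreal (exp ((t - s) * (norm a)\<^sup>2 / 2))"
proof -
  define h where "h z = (\<Prod>i\<in>UNIV. normal_density 0 (sqrt (t - s)) (z $ i))" for z :: "real ^ 'm"
  define X where "X = (\<lambda>\<omega>. B t \<omega> - B s \<omega>)"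
  define c where "c = (t - s) *\<^sub>R a"
  have D: "distributed M lborel X (\<lambda>z. ennreal (h z))"
    using assms unfolding standard_brownian_motion_def h_def X_def by blast
  have [measurable]: "h \<in> borel_measurable borel" unfolding h_def by measurable
  have mass: "(\<integral>\<^sup>+z. ennreal (h z) \<partial>lborel) = 1"
    using distributed_nn_integral[OF D, of "\<lambda>_. 1"] by (simp add: emeasure_space_1)
  have tilt: "h z * exp (a \<bullet> z) = exp ((t - s) * (norm a)\<^sup>2 / 2) * h (- c + z)" for z
  proof -
    have one: "normal_density 0 (sqrt (t - s)) x * exp (u * x)
        = exp ((t - s) * u\<^sup>2 / 2) * normal_density 0 (sqrt (t - s)) (- ((t - s) * u) + x)" for x u
    proof -
      have "- (x\<^sup>2 / (2 * (t - s))) + u * x = (t - s) * u\<^sup>2 / 2 - ((- ((t - s) * u) + x)\<^sup>2 / (2 * (t - s)))"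
        using assms(3) by (simp add: field_simps power2_eq_square)
      then have "exp (- (x\<^sup>2 / (2 * (t - s)))) * exp (u * x)
          = exp ((t - s) * u\<^sup>2 / 2) * exp (- ((- ((t - s) * u) + x)\<^sup>2 / (2 * (t - s))))"
        by (simp flip: exp_add)
      then show ?thesis using assms(3) by (simp add: normal_density_def)
    qed
    have "exp (a \<bullet> z) = (\<Prod>i\<in>UNIV. exp (a $ i * z $ i))"
      by (simp add: inner_vec_def exp_sum)
    moreover have "(norm a)\<^sup>2 = (\<Sum>i\<in>UNIV. (a $ i)\<^sup>2)"
      unfolding power2_norm_eq_inner by (simp add: inner_vec_def power2_eq_square)
    then have "exp ((t - s) * (norm a)\<^sup>2 / 2) = (\<Prod>i\<in>UNIV. exp ((t - s) * (a $ i)\<^sup>2 / 2))"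
      by (simp add: sum_distrib_left sum_divide_distrib exp_sum)
    ultimately show ?thesis
      by (simp add: h_def c_def one flip: prod.distrib)
  qed
  have "(\<integral>\<^sup>+\<omega>. exp (a \<bullet> X \<omega>) \<partial>M) = (\<integral>\<^sup>+z. ennreal (h z) * ennreal (exp (a \<bullet> z)) \<partial>lborel)"
    by (rule distributed_nn_integral[OF D, symmetric]) measurable
  also have "\<dots> = (\<integral>\<^sup>+z. ennreal (exp ((t - s) * (norm a)\<^sup>2 / 2)) * ennreal (h (- c + z)) \<partial>lborel)"
  proof (rule nn_integral_cong)
    fix z
    have "h z \<ge> 0" "h (- c + z) \<ge> 0" by (auto simp: h_def intro: prod_nonneg)
    then show "ennreal (h z) * ennreal (exp (a \<bullet> z))
        = ennreal (exp ((t - s) * (norm a)\<^sup>2 / 2)) * ennreal (h (- c + z))"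
      using tilt[of z] by (simp flip: ennreal_mult)
  qed
  also have "\<dots> = ennreal (exp ((t - s) * (norm a)\<^sup>2 / 2)) * (\<integral>\<^sup>+z. ennreal (h (- c + z)) \<partial>lborel)"
    by (rule nn_integral_cmult) measurable
  also have "(\<integral>\<^sup>+z. ennreal (h (- c + z)) \<partial>lborel) = (\<integral>\<^sup>+z. ennreal (h z) \<partial>distr lborel borel ((+) (- c)))"
    by (rule nn_integral_distr[symmetric]) measurable
  also have "\<dots> = 1" by (simp add: lborel_distr_plus mass)
  finally show ?thesis by (simp add: X_def)
qed

context random_forcing
begin

text \<open>
  The sigma-algebras of the field and of the noise, as measures on the sample space: they serve as
  target spaces of the identity map, so that independence of the field and the noise becomes
  independence of two random variables.
\<close>

definition field_algebra :: "'w measure" where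
  "field_algebra = sigma (space P) {f x -` A \<inter> space P | x A. x \<in> UNIV \<and> A \<in> sets borel}"

definition noise_algebra :: "'w measure" where
  "noise_algebra = sigma (space P) {B t -` A \<inter> space P | t A. t \<in> {0..} \<and> A \<in> sets borel}"

lemma space_field_algebra [simp]: "space field_algebra = space P"
  unfolding field_algebra_def by (rule space_measure_of) auto

lemma space_noise_algebra [simp]: "space noise_algebra = space P"
  unfolding noise_algebra_def by (rule space_measure_of) auto

lemma sets_field_algebra: "sets field_algebra = generated_sigma UNIV f"
  unfolding field_algebra_def generated_sigma_def by (rule sets_measure_of) auto

lemma sets_noise_algebra: "sets noise_algebra = generated_sigma {0..} B"
  unfolding noise_algebra_def generated_sigma_def by (rule sets_measure_of) auto

lemma noise_measurable: "t \<ge> 0 \<Longrightarrow> B t \<in> borel_measurable P"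
  using brownian by (simp add: standard_brownian_motion_def)

lemma field_in_field_algebra [measurable]: "f x \<in> borel_measurable field_algebra"
proof (rule measurableI)
  show "f x -` A \<inter> space field_algebra \<in> sets field_algebra" if "A \<in> sets borel" for A
    unfolding sets_field_algebra generated_sigma_def space_field_algebra
    by (rule sigma_sets.Basic) (use that in blast)
qed simp

lemma noise_in_noise_algebra: "t \<ge> 0 \<Longrightarrow> B t \<in> borel_measurable noise_algebra"
proof (rule measurableI)
  show "B t -` A \<inter> space noise_algebra \<in> sets noise_algebra" if "t \<ge> 0" "A \<in> sets borel" for A
    unfolding sets_noise_algebra generated_sigma_def space_noise_algebra
    by (rule sigma_sets.Basic) (use that in auto)
qed simp

lemma id_field_algebra: "(\<lambda>\<omega>. \<omega>) \<in> P \<rightarrow>\<^sub>M field_algebra"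
  unfolding field_algebra_def
  by (rule measurable_measure_of) (use measurable_sets[OF field_measurable] in auto)

lemma id_noise_algebra: "(\<lambda>\<omega>. \<omega>) \<in> P \<rightarrow>\<^sub>M noise_algebra"
  unfolding noise_algebra_def
  by (rule measurable_measure_of) (use measurable_sets[OF noise_measurable] in auto)

lemma algebras_independent: "indep_var field_algebra (\<lambda>\<omega>. \<omega>) noise_algebra (\<lambda>\<omega>. \<omega>)"
proof -
  have trivial: "sigma_sets (space P) {(\<lambda>\<omega>. \<omega>) -` A \<inter> space P | A. A \<in> sets N} = sets N"
    if "space N = space P" for N :: "'w measure"
  proof -
    have "{(\<lambda>\<omega>. \<omega>) -` A \<inter> space P | A. A \<in> sets N} = sets N"
      using sets.sets_into_space[of _ N] that by (auto simp: Int_absorb2)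
    then show ?thesis using sets.sigma_sets_eq[of N] that by simp
  qed
  show ?thesis
    unfolding indep_var_eq trivial[OF space_field_algebra] trivial[OF space_noise_algebra]
    using independent id_field_algebra id_noise_algebra by (simp add: sets_field_algebra sets_noise_algebra)
qed

text \<open>
  The joint law of the two identity maps is a product, so this is Tonelli's theorem: expectations may be
  computed with the field frozen.
\<close>

lemma freeze_field:
  assumes [measurable]: "\<Phi> \<in> borel_measurable (field_algebra \<Otimes>\<^sub>M noise_algebra)"
  shows "(\<integral>\<^sup>+\<omega>. \<Phi> (\<omega>, \<omega>) \<partial>P) = (\<integral>\<^sup>+\<omega>'. (\<integral>\<^sup>+\<omega>. \<Phi> (\<omega>', \<omega>) \<partial>P) \<partial>P)"
proof -
  note [measurable] = id_field_algebra id_noise_algebra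
  define F where "F = distr P field_algebra (\<lambda>\<omega>. \<omega>)"
  define N where "N = distr P noise_algebra (\<lambda>\<omega>. \<omega>)"
  interpret N: prob_space N unfolding N_def by (rule prob_space_distr) measurable
  have joint: "F \<Otimes>\<^sub>M N = distr P (field_algebra \<Otimes>\<^sub>M noise_algebra) (\<lambda>\<omega>. (\<omega>, \<omega>))"
    using algebras_independent unfolding indep_var_distribution_eq F_def N_def by simp
  have "(\<integral>\<^sup>+\<omega>. \<Phi> (\<omega>, \<omega>) \<partial>P) = (\<integral>\<^sup>+z. \<Phi> z \<partial>(F \<Otimes>\<^sub>M N))"
    unfolding joint by (rule nn_integral_distr[symmetric]) measurable
  also have "\<dots> = (\<integral>\<^sup>+\<omega>'. (\<integral>\<^sup>+\<omega>. \<Phi> (\<omega>', \<omega>) \<partial>N) \<partial>F)"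
    by (rule N.nn_integral_fst[symmetric])
      (simp add: F_def N_def cong: measurable_cong_sets sets_pair_measure_cong)
  also have "\<dots> = (\<integral>\<^sup>+\<omega>'. (\<integral>\<^sup>+\<omega>. \<Phi> (\<omega>', \<omega>) \<partial>N) \<partial>P)"
  proof -
    have "\<Phi> \<in> borel_measurable (field_algebra \<Otimes>\<^sub>M N)"
      by (simp add: N_def cong: measurable_cong_sets sets_pair_measure_cong)
    then have "(\<lambda>\<omega>'. \<integral>\<^sup>+\<omega>. \<Phi> (\<omega>', \<omega>) \<partial>N) \<in> borel_measurable field_algebra"
      by (rule N.borel_measurable_nn_integral_fst)
    then show ?thesis
      unfolding F_def by (intro nn_integral_distr id_field_algebra) simp
  qed
  also have "\<dots> = (\<integral>\<^sup>+\<omega>'. (\<integral>\<^sup>+\<omega>. \<Phi> (\<omega>', \<omega>) \<partial>P) \<partial>P)"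
  proof (rule nn_integral_cong)
    fix \<omega>' assume "\<omega>' \<in> space P"
    then have "\<omega>' \<in> space field_algebra" by simp
    then have "(\<lambda>\<omega>. \<Phi> (\<omega>', \<omega>)) \<in> borel_measurable noise_algebra" by measurable
    then show "(\<integral>\<^sup>+\<omega>. \<Phi> (\<omega>', \<omega>) \<partial>N) = (\<integral>\<^sup>+\<omega>. \<Phi> (\<omega>', \<omega>) \<partial>P)"
      unfolding N_def by (intro nn_integral_distr id_noise_algebra) simp
  qed
  finally show ?thesis .
qed

text \<open>
  With the field frozen, the sum is a linear combination of independent Gaussian increments.
\<close>

lemma laplace_of_ito_sum:
  fixes a :: "nat \<Rightarrow> 'w \<Rightarrow> real ^ 'm" and t :: "nat \<Rightarrow> real"
  assumes a [measurable]: "\<And>i. a i \<in> borel_measurable field_algebra"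
    and t: "strict_mono t" "t 0 \<ge> 0"
  shows "(\<integral>\<^sup>+\<omega>. exp (\<Sum>i<n. a i \<omega> \<bullet> (B (t (Suc i)) \<omega> - B (t i) \<omega>)) \<partial>P)
    = (\<integral>\<^sup>+\<omega>. exp (\<Sum>i<n. (t (Suc i) - t i) * (norm (a i \<omega>))\<^sup>2 / 2) \<partial>P)"
proof -
  have t_nonneg: "t i \<ge> 0" for i
    using t strict_mono_less_eq[OF t(1), of 0 i] by simp
  have [measurable]: "B (t i) \<in> borel_measurable noise_algebra" for i
    by (rule noise_in_noise_algebra[OF t_nonneg])
  have [measurable]: "B (t i) \<in> borel_measurable P" for i
    by (rule noise_measurable[OF t_nonneg])
  define \<Delta> where "\<Delta> i \<omega> = B (t (Suc i)) \<omega> - B (t i) \<omega>" for i \<omega>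
  have indep: "indep_vars (\<lambda>_. borel) \<Delta> {..<n}"
    using brownian t strict_mono_mono[OF t(1)] unfolding standard_brownian_motion_def \<Delta>_def by blast
  define \<Phi> where "\<Phi> = (\<lambda>z. ennreal (exp (\<Sum>i<n. a i (fst z) \<bullet> \<Delta> i (snd z))))"
  have meas: "\<Phi> \<in> borel_measurable (field_algebra \<Otimes>\<^sub>M noise_algebra)"
    unfolding \<Phi>_def \<Delta>_def by measurable
  have "(\<integral>\<^sup>+\<omega>. exp (\<Sum>i<n. a i \<omega> \<bullet> \<Delta> i \<omega>) \<partial>P) = (\<integral>\<^sup>+\<omega>'. (\<integral>\<^sup>+\<omega>. exp (\<Sum>i<n. a i \<omega>' \<bullet> \<Delta> i \<omega>) \<partial>P) \<partial>P)"
    using freeze_field[OF meas] by (simp add: \<Phi>_def)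
  also have "\<dots> = (\<integral>\<^sup>+\<omega>. exp (\<Sum>i<n. (t (Suc i) - t i) * (norm (a i \<omega>))\<^sup>2 / 2) \<partial>P)"
  proof (rule nn_integral_cong)
    fix \<omega>'
    have "(\<integral>\<^sup>+\<omega>. exp (\<Sum>i<n. a i \<omega>' \<bullet> \<Delta> i \<omega>) \<partial>P) = (\<integral>\<^sup>+\<omega>. (\<Prod>i<n. ennreal (exp (a i \<omega>' \<bullet> \<Delta> i \<omega>))) \<partial>P)"
      by (simp add: exp_sum prod_ennreal)
    also have "\<dots> = (\<Prod>i<n. \<integral>\<^sup>+\<omega>. ennreal (exp (a i \<omega>' \<bullet> \<Delta> i \<omega>)) \<partial>P)"
    proof (rule indep_vars_nn_integral)
      show "indep_vars (\<lambda>_. borel) (\<lambda>i \<omega>. ennreal (exp (a i \<omega>' \<bullet> \<Delta> i \<omega>))) {..<n}"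
        by (rule indep_vars_compose2[OF indep]) measurable
    qed auto
    also have "\<dots> = (\<Prod>i<n. ennreal (exp ((t (Suc i) - t i) * (norm (a i \<omega>'))\<^sup>2 / 2)))"
      unfolding \<Delta>_def
      by (intro prod.cong refl brownian_laplace[OF brownian t_nonneg]) (simp add: strict_monoD[OF t(1)])
    also have "\<dots> = ennreal (exp (\<Sum>i<n. (t (Suc i) - t i) * (norm (a i \<omega>'))\<^sup>2 / 2))"
      by (simp add: exp_sum prod_ennreal)
    finally show "(\<integral>\<^sup>+\<omega>. exp (\<Sum>i<n. a i \<omega>' \<bullet> \<Delta> i \<omega>) \<partial>P)
        = ennreal (exp (\<Sum>i<n. (t (Suc i) - t i) * (norm (a i \<omega>'))\<^sup>2 / 2))" .
  qed
  finally show ?thesis by (simp add: \<Delta>_def)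
qed

end

section \<open>Regular realizations\<close>

lemma sup_norm_upper:
  assumes "bounded (range h)"
  shows "norm (h x) \<le> sup_norm h"
proof -
  obtain c where "\<And>y. norm (h y) \<le> c" using assms by (auto simp: bounded_iff)
  then have "bdd_above (range (\<lambda>y. norm (h y)))" by (rule bdd_aboveI2)
  then show ?thesis unfolding sup_norm_def by (rule cSUP_upper[OF UNIV_I])
qed

lemma holder_seminorm_nonneg:
  fixes h :: "real ^ 'n \<Rightarrow> 'b :: real_normed_vector"
  assumes "bdd_above (holder_quotients \<kappa> h)"
  shows "holder_seminorm \<kappa> h \<ge> 0"
proof -
  obtain j :: 'n where True by blast
  have "(0 :: real ^ 'n) \<noteq> axis j 1" by (metis axis_eq_0_iff zero_neq_one)
  then have "norm (h 0 - h (axis j 1)) / norm (0 - axis j 1 :: real ^ 'n) powr \<kappa> \<in> holder_quotients \<kappa> h"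
    unfolding holder_quotients_def by blast
  then show ?thesis
    unfolding holder_seminorm_def by (rule cSup_upper2[OF _ _ assms]) simp
qed

lemma C1_holder_bounds:
  assumes "C1_holder \<kappa> g" "sup_norm g + sup_norm (total_deriv g) + holder_seminorm \<kappa> (total_deriv g) \<le> M"
  shows "norm (g x) \<le> M" "norm (total_deriv g x) \<le> M"
proof -
  have "norm (g x) \<le> sup_norm g" "norm (total_deriv g x) \<le> sup_norm (total_deriv g)"
    using assms(1) by (auto simp: C1_holder_def C1b_def intro: sup_norm_upper)
  moreover have "holder_seminorm \<kappa> (total_deriv g) \<ge> 0"
    using assms(1) by (auto simp: C1_holder_def intro: holder_seminorm_nonneg)
  moreover note norm_ge_zero[of "g x"] norm_ge_zero[of "total_deriv g x"] assms(2)
  ultimately show "norm (g x) \<le> M" "norm (total_deriv g x) \<le> M"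
    by linarith+
qed

context random_forcing
begin

text \<open>
  The pathwise estimates are carried out for these realizations, which have full probability.
\<close>

definition regular :: "'w \<Rightarrow> bool" where
  "regular \<omega> \<longleftrightarrow> C1b (\<lambda>x. f x \<omega>) \<and> (\<forall>x. norm (f x \<omega>) \<le> M\<^sub>0) \<and>
    (\<forall>x. norm (total_deriv (\<lambda>x. f x \<omega>) x) \<le> M\<^sub>0) \<and> continuous_on {0..} (\<lambda>t. B t \<omega>)"

lemma AE_regular: "AE \<omega> in P. regular \<omega>"
proof -
  have "AE \<omega> in P. continuous_on {0..} (\<lambda>t. B t \<omega>)"
    using brownian by (simp add: standard_brownian_motion_def)
  then show ?thesis
    using field_holder
  proof eventually_elim
    case (elim \<omega>)
    then show ?case
      unfolding regular_def using C1_holder_bounds[of \<kappa> "\<lambda>x. f x \<omega>" M\<^sub>0] by (auto simp: C1_holder_def)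
  qed
qed

lemma regular_continuous: "regular \<omega> \<Longrightarrow> continuous_on S (\<lambda>x. f x \<omega>)"
  unfolding regular_def C1b_def
  by (meson continuous_at_imp_continuous_on differentiable_imp_continuous_within)

lemma AE_shift: "(AE \<omega> in P. Q (\<tau> y \<omega>)) \<longleftrightarrow> (AE \<omega> in P. Q \<omega>)" if [measurable]: "Measurable.pred P Q"
proof -
  have "(AE \<omega> in P. Q \<omega>) \<longleftrightarrow> (AE \<omega> in distr P P (\<tau> y). Q \<omega>)" by (simp only: shift_preserves)
  also have "\<dots> \<longleftrightarrow> (AE \<omega> in P. Q (\<tau> y \<omega>))"
    by (rule AE_distr_iff[OF shift_measurable]) measurable
  finally show ?thesis by simp
qed

text \<open>
  If \<open>f h = f 0\<close> almost surely for every \<open>h\<close>, then almost surely this holds for all \<open>h\<close> in a countable dense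
  set, hence for all \<open>h\<close> by continuity, and the field is constant.
\<close>

lemma field_difference_nontrivial:
  assumes "\<not> (AE \<omega> in P. (\<lambda>x. f x \<omega>) constant_on UNIV)"
  obtains h where "\<not> (AE \<omega> in P. f 0 \<omega> = f h \<omega>)"
proof (rule ccontr)
  assume contra: "\<not> thesis"
  obtain D :: "(real ^ 'd) set" where D: "countable D" "\<And>U. open U \<Longrightarrow> U \<noteq> {} \<Longrightarrow> \<exists>x\<in>D. x \<in> U"
    using countable_dense_exists by (metis (no_types))
  have "AE \<omega> in P. \<forall>x\<in>D. f 0 \<omega> = f x \<omega>"
    using contra that D(1) by (subst AE_ball_countable) auto
  then have "AE \<omega> in P. (\<lambda>x. f x \<omega>) constant_on UNIV"
    using AE_regular
  proof eventually_elim
    case (elim \<omega>)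
    have "f x \<omega> = f 0 \<omega>" for x
    proof (rule ccontr)
      assume "f x \<omega> \<noteq> f 0 \<omega>"
      moreover have "open {y. f y \<omega> \<noteq> f 0 \<omega>}"
        by (intro open_Collect_neq regular_continuous elim continuous_on_const)
      ultimately show False using D(2)[of "{y. f y \<omega> \<noteq> f 0 \<omega>}"] elim(1) by auto
    qed
    then show ?case by (auto simp: constant_on_def)
  qed
  then show False using assms by simp
qed

end

section \<open>The variance gained by a detour\<close>

context random_forcing
begin

definition increment :: "nat \<Rightarrow> nat \<Rightarrow> nat \<Rightarrow> 'w \<Rightarrow> real ^ 'm" where
  "increment k n i \<omega> = B (real k + real (Suc i) / real n) \<omega> - B (real k + real i / real n) \<omega>"

lemma increment_measurable [measurable]: "increment k n i \<in> borel_measurable P"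
  using noise_measurable unfolding increment_def by measurable

lemma laplace_of_block_sum:
  fixes a :: "nat \<Rightarrow> 'w \<Rightarrow> real ^ 'm"
  assumes "\<And>i. a i \<in> borel_measurable field_algebra" "n > 0"
  shows "(\<integral>\<^sup>+\<omega>. exp (\<Sum>i<n. a i \<omega> \<bullet> increment k n i \<omega>) \<partial>P)
    = (\<integral>\<^sup>+\<omega>. exp ((\<Sum>i<n. (norm (a i \<omega>))\<^sup>2) / real n / 2) \<partial>P)"
proof -
  define t where "t i = real k + real i / real n" for i
  have "strict_mono t" "t 0 \<ge> 0"
    using assms(2) by (auto simp: t_def strict_mono_def divide_strict_right_mono)
  note laplace_of_ito_sum[where a = a and n = n, OF assms(1) this]
  moreover have "t (Suc i) - t i = 1 / real n" for i by (simp add: t_def add_divide_distrib)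
  moreover have "increment k n i \<omega> = B (t (Suc i)) \<omega> - B (t i) \<omega>" for i \<omega>
    by (simp only: increment_def t_def)
  ultimately show ?thesis by (simp add: sum_divide_distrib mult.commute)
qed

lemma laplace_of_block_sum_le:
  fixes a :: "nat \<Rightarrow> 'w \<Rightarrow> real ^ 'm"
  assumes "\<And>i. a i \<in> borel_measurable field_algebra" "n > 0"
    and "AE \<omega> in P. \<forall>i. norm (a i \<omega>) \<le> A"
  shows "(\<integral>\<^sup>+\<omega>. exp (\<Sum>i<n. a i \<omega> \<bullet> increment k n i \<omega>) \<partial>P) \<le> ennreal (exp (A\<^sup>2 / 2))"
proof -
  have "(\<integral>\<^sup>+\<omega>. exp ((\<Sum>i<n. (norm (a i \<omega>))\<^sup>2) / real n / 2) \<partial>P) \<le> (\<integral>\<^sup>+\<omega>. ennreal (exp (A\<^sup>2 / 2)) \<partial>P)"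
  proof (rule nn_integral_mono_AE, use assms(3) in eventually_elim)
    case (elim \<omega>)
    have "(\<Sum>i<n. (norm (a i \<omega>))\<^sup>2) \<le> (\<Sum>i<n. A\<^sup>2)"
      using elim by (intro sum_mono power_mono) auto
    then show ?case
      using assms(2) by (intro ennreal_leI) (simp add: field_simps)
  qed
  also have "\<dots> = ennreal (exp (A\<^sup>2 / 2))" by (simp add: emeasure_space_1)
  finally show ?thesis by (simp add: laplace_of_block_sum[OF assms(1,2)])
qed

text \<open>
  The approximation with \<open>n\<close> cells to the stochastic integral along \<open>x\<close> over block \<open>k\<close>.
\<close>

definition ito_sum :: "(real \<Rightarrow> real ^ 'd) \<Rightarrow> nat \<Rightarrow> nat \<Rightarrow> 'w \<Rightarrow> real" where
  "ito_sum x k n \<omega> = (\<Sum>i<n. f (x (real k + real i / real n)) \<omega> \<bullet> increment k n i \<omega>)"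

lemma ito_sum_measurable [measurable]: "ito_sum x k n \<in> borel_measurable P"
  using field_measurable unfolding ito_sum_def by measurable

text \<open>
  The bound is uniform in the block, in the number of cells and in the path, since the field is bounded by
  \<open>M\<^sub>0\<close>.
\<close>

lemma ito_sum_laplace_le:
  assumes "n > 0"
  shows "(\<integral>\<^sup>+\<omega>. exp (c * ito_sum x k n \<omega>) \<partial>P) \<le> ennreal (exp (c\<^sup>2 * M\<^sub>0\<^sup>2 / 2))"
proof -
  have "AE \<omega> in P. \<forall>i. norm (c *\<^sub>R f (x (real k + real i / real n)) \<omega>) \<le> \<bar>c\<bar> * M\<^sub>0"
    using AE_regular by eventually_elim (auto simp: regular_def intro: mult_left_mono)
  from laplace_of_block_sum_le[OF _ assms this, of k] show ?thesis
    by (simp add: ito_sum_def sum_distrib_left power_mult_distrib)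
qed

lemma ito_sum_difference_laplace_le:
  assumes "n > 0"
  shows "(\<integral>\<^sup>+\<omega>. exp (c * (ito_sum x k n \<omega> - ito_sum y k n \<omega>)) \<partial>P) \<le> ennreal (exp (c\<^sup>2 * (2 * M\<^sub>0)\<^sup>2 / 2))"
proof -
  have "AE \<omega> in P. \<forall>i. norm (c *\<^sub>R (f (x (real k + real i / real n)) \<omega> - f (y (real k + real i / real n)) \<omega>)) \<le> \<bar>c\<bar> * (2 * M\<^sub>0)"
    using AE_regular
  proof eventually_elim
    case (elim \<omega>)
    have "norm (f u \<omega> - f w \<omega>) \<le> 2 * M\<^sub>0" for u w
      using elim norm_triangle_ineq4[of "f u \<omega>" "f w \<omega>"] unfolding regular_def by (smt (verit))
    then show ?case by (auto intro: mult_left_mono)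
  qed
  from laplace_of_block_sum_le[OF _ assms this, of k] show ?thesis
    by (simp add: ito_sum_def sum_distrib_left power_mult_distrib inner_diff_left sum_subtractf right_diff_distrib)
qed

text \<open>
  The straight line with velocity \<open>v\<close>, plus an excursion in the direction \<open>h\<close> that vanishes at both ends of
  the block \<open>k\<close> and equals \<open>(1 / 4) *\<^sub>R h\<close> at its midpoint. For \<open>h = 0\<close> it is the straight line itself.
\<close>

definition detour :: "real ^ 'd \<Rightarrow> real ^ 'd \<Rightarrow> nat \<Rightarrow> real \<Rightarrow> real ^ 'd" where
  "detour v h k r = r *\<^sub>R v + ((r - real k) * (real k + 1 - r)) *\<^sub>R h"

text \<open>
  Conditionally on the field, the variance of the difference of the two stochastic sums over a block.
\<close>

definition detour_variance :: "real ^ 'd \<Rightarrow> real ^ 'd \<Rightarrow> nat \<Rightarrow> nat \<Rightarrow> 'w \<Rightarrow> real" where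
  "detour_variance v h k n \<omega> = (\<Sum>i<n. (norm (f (detour v 0 k (real k + real i / real n)) \<omega>
     - f (detour v h k (real k + real i / real n)) \<omega>))\<^sup>2) / real n"

lemma detour_variance_measurable [measurable]: "detour_variance v h k n \<in> borel_measurable P"
  using field_measurable unfolding detour_variance_def by measurable

text \<open>
  The right-hand side does not depend on the block \<open>k\<close>: the increments of the noise have the same law in every
  block, and stationarity of the field removes the translation by \<open>real k *\<^sub>R v\<close>.
\<close>

lemma detour_laplace:
  assumes "n > 0"
  shows "(\<integral>\<^sup>+\<omega>. exp (c * (ito_sum (detour v 0 k) k n \<omega> - ito_sum (detour v h k) k n \<omega>)) \<partial>P)
    = (\<integral>\<^sup>+\<omega>. exp (c\<^sup>2 * detour_variance v h 0 n \<omega> / 2) \<partial>P)"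
proof -
  define x where "x i = real k + real i / real n" for i
  have "(\<integral>\<^sup>+\<omega>. exp (c * (ito_sum (detour v 0 k) k n \<omega> - ito_sum (detour v h k) k n \<omega>)) \<partial>P)
      = (\<integral>\<^sup>+\<omega>. exp (\<Sum>i<n. (c *\<^sub>R (f (detour v 0 k (x i)) \<omega> - f (detour v h k (x i)) \<omega>)) \<bullet> increment k n i \<omega>) \<partial>P)"
    by (simp add: ito_sum_def x_def sum_distrib_left inner_diff_left sum_subtractf right_diff_distrib)
  also have "\<dots> = (\<integral>\<^sup>+\<omega>. exp ((\<Sum>i<n. (norm (c *\<^sub>R (f (detour v 0 k (x i)) \<omega> - f (detour v h k (x i)) \<omega>)))\<^sup>2) / real n / 2) \<partial>P)"
    by (rule laplace_of_block_sum[OF _ assms]) measurable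
  also have "\<dots> = (\<integral>\<^sup>+\<omega>. exp (c\<^sup>2 * detour_variance v h k n \<omega> / 2) \<partial>P)"
    by (simp add: detour_variance_def x_def power_mult_distrib flip: sum_distrib_left)
  also have "\<dots> = (\<integral>\<^sup>+\<omega>. exp (c\<^sup>2 * detour_variance v h 0 n (\<tau> (real k *\<^sub>R v) \<omega>) / 2) \<partial>P)"
  proof (rule nn_integral_cong)
    fix \<omega> assume \<omega>: "\<omega> \<in> space P"
    have "detour v h' 0 r + real k *\<^sub>R v = detour v h' k (real k + r)" for h' r
      by (simp add: detour_def algebra_simps)
    then show "ennreal (exp (c\<^sup>2 * detour_variance v h k n \<omega> / 2))
        = ennreal (exp (c\<^sup>2 * detour_variance v h 0 n (\<tau> (real k *\<^sub>R v) \<omega>) / 2))"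
      by (simp add: detour_variance_def field_stationary[OF \<omega>])
  qed
  also have "\<dots> = (\<integral>\<^sup>+\<omega>. exp (c\<^sup>2 * detour_variance v h 0 n \<omega> / 2) \<partial>distr P P (\<tau> (real k *\<^sub>R v)))"
    by (rule nn_integral_distr[symmetric, OF shift_measurable]) measurable
  finally show ?thesis by (simp only: shift_preserves)
qed

text \<open>
  With positive probability the field differs at the midpoints of the two paths, and then the variance
  converges to a positive limit \<open>S\<close>. There \<open>m\<^sup>2 * S / 2\<close> eventually beats \<open>m * c\<close>, whatever the fixed cost
  \<open>c\<close> of the detour is. Two applications of Fatou's lemma transfer the divergence to the expectations.
  This is where the Gaussian tails enter: the gain of a detour is unbounded, so it exceeds the
  cost with positive probability even if the conjugate of \<open>H\<close> has a kink at \<open>v\<close>.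
\<close>

lemma detour_laplace_unbounded:
  assumes "\<not> (AE \<omega> in P. f 0 \<omega> = f ((1 / 4) *\<^sub>R h) \<omega>)"
  shows "\<exists>m :: nat. m > 0 \<and> (\<forall>\<^sub>F n in sequentially.
    (\<integral>\<^sup>+\<omega>. exp ((real m)\<^sup>2 * detour_variance v h 0 n \<omega> / 2 - real m * c) \<partial>P) > 4)"
proof -
  define \<phi> where "\<phi> m n \<omega> = ennreal (exp ((real m)\<^sup>2 * detour_variance v h 0 n \<omega> / 2 - real m * c))" for m n :: nat and \<omega>
  have [measurable]: "\<phi> m n \<in> borel_measurable P" for m n unfolding \<phi>_def by measurable
  note [measurable] = field_measurable
  define z where "z = (1 / 2) *\<^sub>R v"
  define E where "E = {\<omega> \<in> space P. f z \<omega> \<noteq> f (z + (1 / 4) *\<^sub>R h) \<omega>}"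
  have E [measurable]: "E \<in> sets P" unfolding E_def by measurable
  have "\<not> (AE \<omega> in P. f z \<omega> = f (z + (1 / 4) *\<^sub>R h) \<omega>)"
  proof -
    have "(AE \<omega> in P. f z \<omega> = f (z + (1 / 4) *\<^sub>R h) \<omega>)
        \<longleftrightarrow> (AE \<omega> in P. f 0 (\<tau> z \<omega>) = f ((1 / 4) *\<^sub>R h) (\<tau> z \<omega>))"
      by (intro AE_cong) (simp add: field_stationary add.commute)
    also have "\<dots> \<longleftrightarrow> (AE \<omega> in P. f 0 \<omega> = f ((1 / 4) *\<^sub>R h) \<omega>)"
      by (rule AE_shift) measurable
    finally show ?thesis using assms by simp
  qed
  then have "emeasure P E \<noteq> 0"
    unfolding E_def by (subst (asm) AE_iff_measurable[OF _ refl]) auto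
  then have "\<infinity> = (\<integral>\<^sup>+\<omega>. \<infinity> * indicator E \<omega> \<partial>P)"
    by (subst nn_integral_cmult_indicator) (auto simp: ennreal_top_mult)
  also have "\<dots> \<le> (\<integral>\<^sup>+\<omega>. liminf (\<lambda>m. liminf (\<lambda>n. \<phi> m n \<omega>)) \<partial>P)"
  proof (rule nn_integral_mono_AE, use AE_regular in eventually_elim)
    case (elim \<omega>)
    show ?case
    proof (cases "\<omega> \<in> E")
      case True
      define d where "d r = (norm (f (detour v 0 0 r) \<omega> - f (detour v h 0 r) \<omega>))\<^sup>2" for r
      have cont: "continuous_on {0..0 + 1} d"
        unfolding d_def detour_def
        by (intro continuous_intros continuous_on_compose2[OF regular_continuous[OF elim(1), of UNIV]]) auto
      have var: "(\<lambda>n. detour_variance v h 0 n \<omega>) \<longlonglongrightarrow> integral {0..0 + 1} d"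
        using riemann_sums[OF cont, of "\<lambda>n i. real i / real n"]
        by (simp add: detour_variance_def d_def divide_right_mono)
      define S where "S = integral {0..1} d"
      have "d (1 / 2) \<noteq> 0"
        using True by (simp add: d_def E_def detour_def z_def)
      then have "S \<noteq> 0"
        using integral_eq_0_iff[of 0 1 d] cont by (auto simp: S_def d_def)
      moreover have "S \<ge> 0"
        unfolding S_def by (rule integral_nonneg[OF integrable_continuous_real]) (use cont in \<open>auto simp: d_def\<close>)
      ultimately have S: "S > 0" by simp
      have inner: "liminf (\<lambda>n. \<phi> m n \<omega>) = ennreal (exp ((real m)\<^sup>2 * S / 2 - real m * c))" for m
        unfolding \<phi>_def S_def using var
        by (intro lim_imp_Liminf tendsto_ennrealI tendsto_intros) auto
      have "filterlim (\<lambda>m. real m * (- c + S / 2 * real m)) at_top sequentially"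
        using S by (intro filterlim_at_top_mult_at_top filterlim_real_sequentially
            filterlim_tendsto_add_at_top[OF tendsto_const] filterlim_tendsto_pos_mult_at_top[OF tendsto_const]) auto
      then have "filterlim (\<lambda>m. (real m)\<^sup>2 * S / 2 - real m * c) at_top sequentially"
        by (simp add: algebra_simps power2_eq_square)
      then have "(\<lambda>m. ennreal (exp ((real m)\<^sup>2 * S / 2 - real m * c))) \<longlonglongrightarrow> \<infinity>"
        unfolding infinity_ennreal_def ennreal_tendsto_top_eq_at_top by (rule filterlim_compose[OF exp_at_top])
      then have "liminf (\<lambda>m. liminf (\<lambda>n. \<phi> m n \<omega>)) = \<infinity>"
        unfolding inner by (intro lim_imp_Liminf) auto
      then show ?thesis by simp
    qed simp
  qed
  also have "\<dots> \<le> liminf (\<lambda>m. \<integral>\<^sup>+\<omega>. liminf (\<lambda>n. \<phi> m n \<omega>) \<partial>P)"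
    by (rule nn_integral_liminf) measurable
  finally have "4 < liminf (\<lambda>m. \<integral>\<^sup>+\<omega>. liminf (\<lambda>n. \<phi> m n \<omega>) \<partial>P)"
    by (simp add: top_unique)
  then have "\<forall>\<^sub>F m in sequentially. 4 < (\<integral>\<^sup>+\<omega>. liminf (\<lambda>n. \<phi> m n \<omega>) \<partial>P)"
    by (rule less_LiminfD)
  then have "\<forall>\<^sub>F m in sequentially. m > 0 \<and> 4 < (\<integral>\<^sup>+\<omega>. liminf (\<lambda>n. \<phi> m n \<omega>) \<partial>P)"
    using eventually_gt_at_top[of 0] by eventually_elim simp
  from eventually_happens'[OF sequentially_bot this]
  obtain m where m: "m > 0" "4 < (\<integral>\<^sup>+\<omega>. liminf (\<lambda>n. \<phi> m n \<omega>) \<partial>P)"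
    by blast
  note m(2)
  also have "(\<integral>\<^sup>+\<omega>. liminf (\<lambda>n. \<phi> m n \<omega>) \<partial>P) \<le> liminf (\<lambda>n. \<integral>\<^sup>+\<omega>. \<phi> m n \<omega> \<partial>P)"
    by (rule nn_integral_liminf) measurable
  finally have "\<forall>\<^sub>F n in sequentially. 4 < (\<integral>\<^sup>+\<omega>. \<phi> m n \<omega> \<partial>P)"
    by (rule less_LiminfD)
  then show ?thesis using m(1) unfolding \<phi>_def by blast
qed

end

section \<open>The expected gain in one block\<close>

text \<open>
  The quadratic Taylor bound, with the remainder expressed by exponentials of \<open>u\<close> because their
  expectations are the ones that can be computed.
\<close>

lemma exp_le_quadratic:
  fixes u \<theta> :: real
  assumes "0 \<le> \<theta>" "\<theta> \<le> 1"
  shows "exp (\<theta> * u) \<le> 1 + \<theta> * u + \<theta>\<^sup>2 * (exp (2 * u) + exp (- 2 * u))"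
proof -
  have taylor: "exp t \<le> 1 + t + t\<^sup>2 / 2 * exp \<bar>t\<bar>" for t :: real
  proof (cases "t = 0")
    case False
    obtain s where s: "\<bar>s\<bar> \<le> \<bar>t\<bar>" "exp t = (\<Sum>m<2. t ^ m / fact m) + exp s / fact 2 * t ^ 2"
      using Maclaurin_exp_le[of t 2] by blast
    have "exp s \<le> exp \<bar>t\<bar>" using s(1) by simp
    then have "exp s * t\<^sup>2 \<le> exp \<bar>t\<bar> * t\<^sup>2" by (rule mult_right_mono) simp
    then show ?thesis using s(2) by (simp add: eval_nat_numeral field_simps)
  qed simp
  have "\<bar>u\<bar> ^ 2 / fact 2 \<le> exp \<bar>u\<bar>"
    using exp_lower_Taylor_quadratic[of "\<bar>u\<bar>"] by (simp add: eval_nat_numeral)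
  then have sq: "u\<^sup>2 / 2 \<le> exp \<bar>u\<bar>" by simp
  have "(\<theta> * u)\<^sup>2 / 2 * exp \<bar>\<theta> * u\<bar> \<le> \<theta>\<^sup>2 * (exp (2 * u) + exp (- 2 * u))"
  proof -
    have "\<bar>\<theta> * u\<bar> \<le> \<bar>u\<bar>"
      using assms by (simp add: abs_mult mult_left_le_one_le)
    then have "u\<^sup>2 / 2 * exp \<bar>\<theta> * u\<bar> \<le> exp \<bar>u\<bar> * exp \<bar>u\<bar>"
      using sq by (intro mult_mono) auto
    also have "\<dots> = exp (2 * \<bar>u\<bar>)" by (simp flip: exp_add)
    also have "\<dots> \<le> exp (2 * u) + exp (- 2 * u)" by (cases "u \<ge> 0") auto
    finally have "\<theta>\<^sup>2 * (u\<^sup>2 / 2 * exp \<bar>\<theta> * u\<bar>) \<le> \<theta>\<^sup>2 * (exp (2 * u) + exp (- 2 * u))"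
      by (rule mult_left_mono) simp
    then show ?thesis by (simp add: power_mult_distrib)
  qed
  then show ?thesis using taylor[of "\<theta> * u"] by linarith
qed

text \<open>
  The role of this inequality: the minimum of two competing costs falls below \<open>a\<close> by the positive part of
  \<open>x = a - b\<close>, and the positive part is bounded below by the multiple \<open>\<epsilon> / lam\<close> of
  \<open>exp (lam * x) - \<epsilon> * exp (2 * lam * x) - 1\<close>, which is at most zero for \<open>x \<le> 0\<close>. So the gain, with
  its correction, is of first order in \<open>\<theta>\<close> and measured by exponential moments, whereas the Taylor
  remainder is of second order.
\<close>

lemma exp_min_le:
  fixes a b lam \<epsilon> \<theta> :: real
  assumes "lam > 0" "\<epsilon> > 0" "0 \<le> \<theta>" "\<theta> \<le> 1"
  defines "x \<equiv> a - b" and "\<delta> \<equiv> \<theta> * \<epsilon> / lam"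
  shows "exp (\<theta> * min a b) + \<delta> * exp (lam * x) \<le>
    exp (\<theta> * a) + \<delta> * (\<epsilon> * exp (2 * lam * x) + 1)
      + \<theta>\<^sup>2 * (exp (2 * a) + exp (- 2 * a) + exp (- 2 * b))"
proof -
  define y where "y = exp (lam * x)"
  have yy: "exp (2 * lam * x) = y * y" by (simp add: y_def flip: exp_add)
  \<comment> \<open>Let \<open>x \<ge> 0\<close>. For \<open>y \<ge> 1 / \<epsilon>\<close> the left-hand side is not positive; below this threshold it is at most \<open>lam * x * y\<close>.\<close>
  have gain: "y - \<epsilon> * (y * y) - 1 \<le> lam / \<epsilon> * max x 0"
  proof (cases "x \<ge> 0 \<and> y < 1 / \<epsilon>")
    case True
    have "1 - lam * x \<le> exp (- (lam * x))" using exp_ge_add_one_self[of "- (lam * x)"] by simp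
    then have "(1 - lam * x) * y \<le> exp (- (lam * x)) * y" by (intro mult_right_mono) (auto simp: y_def)
    then have "y - 1 \<le> lam * x * y" by (simp add: y_def algebra_simps flip: exp_add)
    also have "\<dots> \<le> lam * x * (1 / \<epsilon>)" using True assms by (intro mult_left_mono) auto
    moreover have "\<epsilon> * (y * y) \<ge> 0" using assms by simp
    ultimately show ?thesis using True by simp
  next
    case False
    have "lam / \<epsilon> * max x 0 \<ge> 0" using assms by simp
    moreover have "y - \<epsilon> * (y * y) - 1 \<le> 0"
    proof (cases "x \<ge> 0")
      case True
      then have "1 \<le> \<epsilon> * y" using False assms by (simp add: field_simps)
      then have "1 * y \<le> \<epsilon> * y * y" by (intro mult_right_mono) (auto simp: y_def)
      then show ?thesis by (simp add: mult.assoc)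
    next
      case False
      then have "y \<le> 1" using assms by (simp add: y_def mult_nonneg_nonpos)
      moreover have "\<epsilon> * (y * y) \<ge> 0" using assms by simp
      ultimately show ?thesis by linarith
    qed
    ultimately show ?thesis by linarith
  qed
  define u where "u = min a b"
  have u: "u = a - max x 0" by (auto simp: u_def x_def)
  have "\<delta> * (y - \<epsilon> * (y * y) - 1) \<le> \<delta> * (lam / \<epsilon> * max x 0)"
    using gain assms by (intro mult_left_mono) auto
  also have "\<dots> = \<theta> * max x 0"
    using assms by (simp add: \<delta>_def)
  finally have "\<theta> * u + \<delta> * (y - \<epsilon> * (y * y) - 1) \<le> \<theta> * a"
    by (simp add: u algebra_simps)
  moreover have "1 + \<theta> * a \<le> exp (\<theta> * a)" by (rule exp_ge_add_one_self)
  moreover have "exp (2 * u) + exp (- 2 * u) \<le> exp (2 * a) + exp (- 2 * a) + exp (- 2 * b)"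
    by (cases "a \<le> b") (auto simp: u_def add_nonneg_nonneg add_increasing2 add_increasing intro: add_mono)
  then have "\<theta>\<^sup>2 * (exp (2 * u) + exp (- 2 * u)) \<le> \<theta>\<^sup>2 * (exp (2 * a) + exp (- 2 * a) + exp (- 2 * b))"
    by (rule mult_left_mono) simp
  moreover have "exp (\<theta> * u) \<le> 1 + \<theta> * u + \<theta>\<^sup>2 * (exp (2 * u) + exp (- 2 * u))"
    by (rule exp_le_quadratic) fact+
  ultimately have "exp (\<theta> * u) + \<delta> * (y - \<epsilon> * (y * y) - 1) \<le> exp (\<theta> * a)
      + \<theta>\<^sup>2 * (exp (2 * a) + exp (- 2 * a) + exp (- 2 * b))"
    by linarith
  then show ?thesis by (simp add: u_def yy flip: y_def) (simp add: algebra_simps)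
qed

lemma (in prob_space) expectation_le_of_nn_integral_le:
  fixes X :: "'a \<Rightarrow> real"
  assumes "X \<in> borel_measurable M" "\<And>\<omega>. X \<omega> \<ge> 0" "(\<integral>\<^sup>+\<omega>. X \<omega> \<partial>M) \<le> ennreal c" "c \<ge> 0"
  shows "integrable M X" "expectation X \<le> c"
proof -
  show int: "integrable M X"
    using assms by (intro integrableI_nonneg) (auto simp: order_le_less_trans)
  then have "ennreal (expectation X) \<le> ennreal c"
    using nn_integral_eq_integral[OF int] assms by auto
  then show "expectation X \<le> c" using assms(4) by (simp add: ennreal_le_iff)
qed

context random_forcing
begin

text \<open>
  Integrate \<open>exp_min_le\<close>. A large moment \<open>lam\<close> makes the expected gain from a choice between the straight line and the
  detour positive; it is of first order in \<open>\<theta>\<close>, so a small \<open>\<theta>\<close> makes it exceed the remainders. All moment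
  bounds hold uniformly in the block, hence so does the result.
\<close>

lemma block_gain:
  assumes nontrivial: "\<not> (AE \<omega> in P. f 0 \<omega> = f ((1 / 4) *\<^sub>R h) \<omega>)" and c: "c \<ge> 0"
  shows "\<exists>\<theta> \<rho>. 0 < \<theta> \<and> 0 \<le> \<rho> \<and> \<rho> < 1 \<and> (\<forall>k. \<forall>\<^sub>F n in sequentially.
    (\<integral>\<^sup>+\<omega>. exp (\<theta> * min (ito_sum (detour v 0 k) k n \<omega>) (c + ito_sum (detour v h k) k n \<omega>)) \<partial>P) \<le> ennreal \<rho>)"
proof -
  obtain m :: nat where m: "m > 0" and large: "\<forall>\<^sub>F n in sequentially.
      (\<integral>\<^sup>+\<omega>. exp ((real m)\<^sup>2 * detour_variance v h 0 n \<omega> / 2 - real m * c) \<partial>P) > 4"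
    using detour_laplace_unbounded[OF nontrivial, of v c] by blast
  define lam where "lam = real m"
  have lam: "lam \<ge> 1" using m by (simp add: lam_def)
  \<comment> \<open>\<open>Q\<close> bounds the moment of order \<open>2 * lam\<close>, so with \<open>\<epsilon> = 1 / Q\<close> the correction to the gain has expectation at most 1.\<close>
  define Q where "Q = exp ((2 * lam)\<^sup>2 * (2 * M\<^sub>0)\<^sup>2 / 2)"
  have Q: "Q \<ge> 1" by (simp add: Q_def)
  define \<epsilon> where "\<epsilon> = 1 / Q"
  have \<epsilon>: "\<epsilon> > 0" "\<epsilon> \<le> 1" using Q by (simp_all add: \<epsilon>_def)
  define A where "A = M\<^sub>0\<^sup>2"
  define D where "D = A / 2 * exp (A / 2) + 3 * exp (2 * A)"
  have A: "A \<ge> 0" by (simp add: A_def)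
  have D: "D > 0" using A by (simp add: D_def add_nonneg_pos)
  define \<sigma> where "\<sigma> = \<epsilon> / lam"
  have \<sigma>: "0 < \<sigma>" "\<sigma> \<le> 1" using \<epsilon> lam by (simp_all add: \<sigma>_def)
  \<comment> \<open>Small enough for the second-order errors, collected in \<open>D\<close>, to be absorbed by half of the first-order gain \<open>2 * \<theta> * \<sigma>\<close>.\<close>
  define \<theta> where "\<theta> = min 1 (\<sigma> / D)"
  have \<theta>: "0 < \<theta>" "\<theta> \<le> 1" "\<theta> * D \<le> \<sigma>"
    using \<sigma> D by (auto simp: \<theta>_def min_def field_simps)
  define \<delta> where "\<delta> = \<theta> * \<epsilon> / lam"
  have \<delta>: "\<delta> = \<theta> * \<sigma>" "\<delta> \<ge> 0"
    using \<theta>(1) \<epsilon>(1) lam by (simp_all add: \<delta>_def \<sigma>_def)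
  define \<rho> where "\<rho> = 1 - \<theta> * \<sigma>"
  have \<rho>: "0 \<le> \<rho>" "\<rho> < 1" using \<theta> \<sigma> by (simp_all add: \<rho>_def mult_le_one)
  have step: "(\<integral>\<^sup>+\<omega>. exp (\<theta> * min (ito_sum (detour v 0 k) k n \<omega>) (c + ito_sum (detour v h k) k n \<omega>)) \<partial>P) \<le> ennreal \<rho>"
    if n: "n > 0" and big: "(\<integral>\<^sup>+\<omega>. exp ((real m)\<^sup>2 * detour_variance v h 0 n \<omega> / 2 - real m * c) \<partial>P) > 4" for k n
  proof -
    define a where "a \<omega> = ito_sum (detour v 0 k) k n \<omega>" for \<omega>
    define y where "y \<omega> = ito_sum (detour v h k) k n \<omega>" for \<omega>
    have [measurable]: "a \<in> borel_measurable P" "y \<in> borel_measurable P"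
      unfolding a_def y_def by measurable
    have single: "integrable P (\<lambda>\<omega>. exp (s * ito_sum x k n \<omega>))"
        "expectation (\<lambda>\<omega>. exp (s * ito_sum x k n \<omega>)) \<le> exp (s\<^sup>2 * A / 2)" for s x
      using expectation_le_of_nn_integral_le[OF _ _ ito_sum_laplace_le[OF n, of s x k]]
      by (auto simp: A_def)
    have diff: "integrable P (\<lambda>\<omega>. exp (s * (a \<omega> - y \<omega>)))"
        "expectation (\<lambda>\<omega>. exp (s * (a \<omega> - y \<omega>))) \<le> exp (s\<^sup>2 * (2 * M\<^sub>0)\<^sup>2 / 2)" for s
      unfolding a_def y_def
      using expectation_le_of_nn_integral_le[OF _ _ ito_sum_difference_laplace_le[OF n, of s "detour v 0 k" k "detour v h k"]]
      by auto
    have shift: "exp (s * (a \<omega> - (c + y \<omega>))) = exp (- (s * c)) * exp (s * (a \<omega> - y \<omega>))" for s \<omega>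
      by (simp add: algebra_simps flip: exp_add)
    have idiff: "integrable P (\<lambda>\<omega>. exp (s * (a \<omega> - (c + y \<omega>))))" for s
      unfolding shift by (intro integrable_mult_right diff)
    have lower: "4 \<le> expectation (\<lambda>\<omega>. exp (lam * (a \<omega> - (c + y \<omega>))))"
    proof -
      have "(\<integral>\<^sup>+\<omega>. exp (lam * (a \<omega> - (c + y \<omega>))) \<partial>P)
          = ennreal (exp (- (lam * c))) * (\<integral>\<^sup>+\<omega>. exp (lam * (a \<omega> - y \<omega>)) \<partial>P)"
        unfolding shift by (simp add: ennreal_mult nn_integral_cmult)
      also have "\<dots> = ennreal (exp (- (lam * c))) * (\<integral>\<^sup>+\<omega>. exp (lam\<^sup>2 * detour_variance v h 0 n \<omega> / 2) \<partial>P)"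
        unfolding a_def y_def detour_laplace[OF n] ..
      also have "\<dots> = (\<integral>\<^sup>+\<omega>. ennreal (exp (- (lam * c))) * ennreal (exp (lam\<^sup>2 * detour_variance v h 0 n \<omega> / 2)) \<partial>P)"
        by (rule nn_integral_cmult[symmetric]) measurable
      also have "\<dots> = (\<integral>\<^sup>+\<omega>. exp ((real m)\<^sup>2 * detour_variance v h 0 n \<omega> / 2 - real m * c) \<partial>P)"
        by (rule nn_integral_cong) (simp add: lam_def flip: ennreal_mult exp_add)
      finally have "ennreal 4 < ennreal (expectation (\<lambda>\<omega>. exp (lam * (a \<omega> - (c + y \<omega>)))))"
        using big nn_integral_eq_integral[OF idiff[of lam]] by simp
      then show ?thesis by (simp add: ennreal_less_iff)
    qed
    have upper: "expectation (\<lambda>\<omega>. exp (2 * lam * (a \<omega> - (c + y \<omega>)))) \<le> Q"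
    proof -
      have "expectation (\<lambda>\<omega>. exp (2 * lam * (a \<omega> - (c + y \<omega>)))) \<le> expectation (\<lambda>\<omega>. exp (2 * lam * (a \<omega> - y \<omega>)))"
        by (intro integral_mono idiff diff) (use c lam in \<open>auto intro: mult_left_mono\<close>)
      also have "\<dots> \<le> Q" unfolding Q_def by (rule diff)
      finally show ?thesis .
    qed
    have iy: "integrable P (\<lambda>\<omega>. exp (- 2 * (c + y \<omega>)))"
        "expectation (\<lambda>\<omega>. exp (- 2 * (c + y \<omega>))) \<le> exp (2 * A)"
    proof -
      have eq: "exp (- 2 * (c + y \<omega>)) = exp (- 2 * c) * exp (- 2 * y \<omega>)" for \<omega>
        by (simp flip: exp_add)
      show int: "integrable P (\<lambda>\<omega>. exp (- 2 * (c + y \<omega>)))"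
        unfolding eq unfolding y_def by (intro integrable_mult_right single)
      have "expectation (\<lambda>\<omega>. exp (- 2 * (c + y \<omega>))) \<le> expectation (\<lambda>\<omega>. exp (- 2 * y \<omega>))"
        by (intro integral_mono int) (use c single[of "- 2"] in \<open>auto simp: y_def\<close>)
      also have "\<dots> \<le> exp (2 * A)" using single(2)[of "- 2"] by (simp add: y_def)
      finally show "expectation (\<lambda>\<omega>. exp (- 2 * (c + y \<omega>))) \<le> exp (2 * A)" .
    qed
    have ia: "integrable P (\<lambda>\<omega>. exp (s * a \<omega>))" "expectation (\<lambda>\<omega>. exp (s * a \<omega>)) \<le> exp (s\<^sup>2 * A / 2)" for s
      unfolding a_def by (rule single)+
    have iu: "integrable P (\<lambda>\<omega>. exp (\<theta> * min (a \<omega>) (c + y \<omega>)))"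
    proof (rule Bochner_Integration.integrable_bound[OF ia(1)[of \<theta>]])
      show "AE \<omega> in P. norm (exp (\<theta> * min (a \<omega>) (c + y \<omega>))) \<le> norm (exp (\<theta> * a \<omega>))"
        using \<theta> by simp
    qed measurable
    have "expectation (\<lambda>\<omega>. exp (\<theta> * min (a \<omega>) (c + y \<omega>))) + \<delta> * expectation (\<lambda>\<omega>. exp (lam * (a \<omega> - (c + y \<omega>))))
        = expectation (\<lambda>\<omega>. exp (\<theta> * min (a \<omega>) (c + y \<omega>)) + \<delta> * exp (lam * (a \<omega> - (c + y \<omega>))))"
      using iu idiff[of lam] by simp
    also have "\<dots> \<le> expectation (\<lambda>\<omega>. exp (\<theta> * a \<omega>) + \<delta> * (\<epsilon> * exp (2 * lam * (a \<omega> - (c + y \<omega>))) + 1)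
        + \<theta>\<^sup>2 * (exp (2 * a \<omega>) + exp (- 2 * a \<omega>) + exp (- 2 * (c + y \<omega>))))"
    proof (rule integral_mono)
      show "exp (\<theta> * min (a \<omega>) (c + y \<omega>)) + \<delta> * exp (lam * (a \<omega> - (c + y \<omega>)))
          \<le> exp (\<theta> * a \<omega>) + \<delta> * (\<epsilon> * exp (2 * lam * (a \<omega> - (c + y \<omega>))) + 1)
            + \<theta>\<^sup>2 * (exp (2 * a \<omega>) + exp (- 2 * a \<omega>) + exp (- 2 * (c + y \<omega>)))" for \<omega>
        unfolding \<delta>_def by (rule exp_min_le) (use lam \<epsilon> \<theta> in auto)
    qed (intro Bochner_Integration.integrable_add integrable_mult_right iu idiff ia iy integrable_const)+
    also have "\<dots> = expectation (\<lambda>\<omega>. exp (\<theta> * a \<omega>))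
        + \<delta> * (\<epsilon> * expectation (\<lambda>\<omega>. exp (2 * lam * (a \<omega> - (c + y \<omega>)))) + 1)
        + \<theta>\<^sup>2 * (expectation (\<lambda>\<omega>. exp (2 * a \<omega>)) + expectation (\<lambda>\<omega>. exp (- 2 * a \<omega>)) + expectation (\<lambda>\<omega>. exp (- 2 * (c + y \<omega>))))"
      using ia(1)[of \<theta>] ia(1)[of 2] ia(1)[of "- 2"] iy(1) idiff[of "2 * lam"] by (simp add: prob_space)
    also have "\<dots> \<le> exp (\<theta>\<^sup>2 * A / 2) + \<delta> * (\<epsilon> * Q + 1) + \<theta>\<^sup>2 * (exp (2 * A) + exp (2 * A) + exp (2 * A))"
      using ia(2)[of \<theta>] ia(2)[of 2] ia(2)[of "- 2"] iy(2) upper \<delta>(2) \<epsilon>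
      by (intro add_mono mult_left_mono) auto
    finally have "expectation (\<lambda>\<omega>. exp (\<theta> * min (a \<omega>) (c + y \<omega>))) + \<delta> * expectation (\<lambda>\<omega>. exp (lam * (a \<omega> - (c + y \<omega>))))
        \<le> exp (\<theta>\<^sup>2 * A / 2) + 2 * \<delta> + \<theta>\<^sup>2 * (3 * exp (2 * A))"
      using Q by (simp add: \<epsilon>_def)
    moreover have "\<delta> * 4 \<le> \<delta> * expectation (\<lambda>\<omega>. exp (lam * (a \<omega> - (c + y \<omega>))))"
      by (rule mult_left_mono[OF lower \<delta>(2)])
    moreover have "exp (\<theta>\<^sup>2 * A / 2) \<le> 1 + \<theta>\<^sup>2 * (A / 2 * exp (A / 2))"
    proof -
      define z where "z = \<theta>\<^sup>2 * A / 2"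
      have z: "0 \<le> z" "z \<le> A / 2"
        using A \<theta> by (auto simp: z_def power_le_one intro: mult_left_le_one_le)
      have "(1 - z) * exp z \<le> exp (- z) * exp z"
        using exp_ge_add_one_self[of "- z"] by (intro mult_right_mono) auto
      then have "exp z \<le> 1 + z * exp z" by (simp add: algebra_simps flip: exp_add)
      also have "\<dots> \<le> 1 + z * exp (A / 2)" using z by (intro add_left_mono mult_left_mono) auto
      finally show ?thesis by (simp add: z_def algebra_simps)
    qed
    moreover have "\<theta>\<^sup>2 * D \<le> \<delta>"
      using mult_left_mono[OF \<theta>(3), of \<theta>] \<theta>(1) by (simp add: \<delta>(1) power2_eq_square mult.assoc)
    ultimately have "expectation (\<lambda>\<omega>. exp (\<theta> * min (a \<omega>) (c + y \<omega>))) \<le> \<rho>"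
      unfolding \<rho>_def D_def by (simp add: \<delta>(1) distrib_left)
    then show ?thesis
      using nn_integral_eq_integral[OF iu] by (simp add: a_def y_def ennreal_leI)
  qed
  have "\<forall>\<^sub>F n in sequentially.
    (\<integral>\<^sup>+\<omega>. exp (\<theta> * min (ito_sum (detour v 0 k) k n \<omega>) (c + ito_sum (detour v h k) k n \<omega>)) \<partial>P) \<le> ennreal \<rho>" for k
    using large eventually_gt_at_top[of 0] by eventually_elim (rule step)
  then show ?thesis using \<theta> \<rho> by blast
qed

end

section \<open>Averages over many blocks\<close>

text \<open>
  This replaces a law of large numbers: a deterministic limit that is dominated by averages over blocks is
  bounded by their expectations. The block quantities are known only as almost sure limits in \<open>n\<close> of measurable approximations with bounded
  expectations; Fatou's lemma is applied in \<open>n\<close> and again in the number \<open>N\<close> of blocks. The sequence \<open>c\<close> and the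
  limits are chosen separately for each realization, because in the applications \<open>c\<close> comes from an infimum
  over uncountably many curves, whose measurability is not clear.
\<close>

lemma (in prob_space) averaged_fatou:
  fixes F :: "nat \<Rightarrow> nat \<Rightarrow> 'a \<Rightarrow> real"
  assumes meas [measurable]: "\<And>k n. F k n \<in> borel_measurable M"
    and nonneg: "\<And>k n \<omega>. F k n \<omega> \<ge> 0"
    and bound: "\<And>k. \<forall>\<^sub>F n in sequentially. (\<integral>\<^sup>+\<omega>. F k n \<omega> \<partial>M) \<le> ennreal \<rho>"
    and "\<rho> \<ge> 0"
    and lim: "AE \<omega> in M. \<exists>c F'. c \<longlonglongrightarrow> l \<and> (\<forall>k. (\<lambda>n. F k n \<omega>) \<longlonglongrightarrow> F' k) \<and>
      (\<forall>N>0. c N \<le> (\<Sum>k<N. F' k) / real N)"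
  shows "l \<le> \<rho>"
proof -
  define G where "G k \<omega> = liminf (\<lambda>n. ennreal (F k n \<omega>))" for k \<omega>
  have G [measurable]: "G k \<in> borel_measurable M" for k
    unfolding G_def by measurable
  have G_le: "(\<integral>\<^sup>+\<omega>. G k \<omega> \<partial>M) \<le> ennreal \<rho>" for k
  proof -
    have "(\<integral>\<^sup>+\<omega>. G k \<omega> \<partial>M) \<le> liminf (\<lambda>n. \<integral>\<^sup>+\<omega>. ennreal (F k n \<omega>) \<partial>M)"
      unfolding G_def by (rule nn_integral_liminf) measurable
    also have "\<dots> \<le> liminf (\<lambda>n. ennreal \<rho>)"
      by (rule Liminf_mono) (rule bound)
    finally show ?thesis by (simp add: Liminf_const)
  qed
  have "ennreal l = (\<integral>\<^sup>+\<omega>. ennreal l \<partial>M)"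
    by (simp add: emeasure_space_1)
  also have "\<dots> \<le> (\<integral>\<^sup>+\<omega>. liminf (\<lambda>N. (\<Sum>k<N. G k \<omega>) / of_nat N) \<partial>M)"
  proof (rule nn_integral_mono_AE, use lim in eventually_elim)
    fix \<omega>
    assume "\<exists>c F'. c \<longlonglongrightarrow> l \<and> (\<forall>k. (\<lambda>n. F k n \<omega>) \<longlonglongrightarrow> F' k) \<and> (\<forall>N>0. c N \<le> (\<Sum>k<N. F' k) / real N)"
    then obtain c F' where c: "c \<longlonglongrightarrow> l" "\<And>k. (\<lambda>n. F k n \<omega>) \<longlonglongrightarrow> F' k"
      "\<And>N. N > 0 \<Longrightarrow> c N \<le> (\<Sum>k<N. F' k) / real N" by blast
    have F': "F' k \<ge> 0" for k
      using LIMSEQ_le_const[OF c(2)[of k]] nonneg by blast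
    have GF: "G k \<omega> = ennreal (F' k)" for k
      unfolding G_def using c(2) by (intro lim_imp_Liminf tendsto_ennrealI) auto
    have "ennreal l = liminf (\<lambda>N. ennreal (c N))"
      using c(1) by (intro lim_imp_Liminf[symmetric] tendsto_ennrealI) auto
    also have "\<dots> \<le> liminf (\<lambda>N. (\<Sum>k<N. G k \<omega>) / of_nat N)"
    proof (rule Liminf_mono, use eventually_gt_at_top[of 0] in eventually_elim)
      fix N :: nat assume N: "N > 0"
      have "(\<Sum>k<N. G k \<omega>) / of_nat N = ennreal ((\<Sum>k<N. F' k) / real N)"
        using N F' by (simp add: GF sum_ennreal divide_ennreal sum_nonneg flip: ennreal_of_nat_eq_real_of_nat)
          (simp add: ennreal_of_nat_eq_real_of_nat divide_ennreal sum_nonneg F')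
      then show "ennreal (c N) \<le> (\<Sum>k<N. G k \<omega>) / of_nat N"
        using c(3)[OF N] by (simp add: ennreal_leI)
    qed
    finally show "ennreal l \<le> liminf (\<lambda>N. (\<Sum>k<N. G k \<omega>) / of_nat N)" .
  qed
  also have "\<dots> \<le> liminf (\<lambda>N. \<integral>\<^sup>+\<omega>. (\<Sum>k<N. G k \<omega>) / of_nat N \<partial>M)"
    by (rule nn_integral_liminf) measurable
  also have "\<dots> \<le> liminf (\<lambda>N. ennreal \<rho>)"
  proof (rule Liminf_mono, use eventually_gt_at_top[of 0] in eventually_elim)
    fix N :: nat assume N: "N > 0"
    have "(\<integral>\<^sup>+\<omega>. (\<Sum>k<N. G k \<omega>) / of_nat N \<partial>M) = (\<Sum>k<N. \<integral>\<^sup>+\<omega>. G k \<omega> \<partial>M) / of_nat N"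
      by (simp add: nn_integral_divide nn_integral_sum)
    also have "\<dots> \<le> (\<Sum>k<N. ennreal \<rho>) / of_nat N"
      by (intro divide_right_mono_ennreal sum_mono G_le)
    also have "\<dots> = ennreal \<rho>"
      using N by (simp add: ennreal_of_nat_eq_real_of_nat divide_ennreal \<open>\<rho> \<ge> 0\<close> flip: ennreal_mult)
    finally show "(\<integral>\<^sup>+\<omega>. (\<Sum>k<N. G k \<omega>) / of_nat N \<partial>M) \<le> ennreal \<rho>" .
  qed
  finally show ?thesis
    using \<open>\<rho> \<ge> 0\<close> by (simp add: Liminf_const ennreal_le_iff)
qed

text \<open>
  Jensen's inequality; it reduces an exponential moment of a sum over blocks to single blocks.
\<close>

lemma exp_average_le:
  fixes u :: "nat \<Rightarrow> real"
  assumes "N > 0"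
  shows "exp ((\<Sum>k<N. u k) / real N) \<le> (\<Sum>k<N. exp (u k)) / real N"
proof -
  have "exp (\<Sum>k<N. (1 / real N) *\<^sub>R u k) \<le> (\<Sum>k<N. (1 / real N) * exp (u k))"
    by (rule convex_on_sum[OF _ _ exp_convex]) (use assms in auto)
  then show ?thesis by (simp add: sum_divide_distrib)
qed

lemma lagrangian_distance_action:
  "lagrangian_distance H f B x y s t \<omega> = Inf {action H (\<lambda>z. f z \<omega>) (\<lambda>r. B r \<omega>) s t \<gamma> \<gamma>' | \<gamma> \<gamma>'.
     W1inf s t \<gamma> \<gamma>' \<and> \<gamma> s = x \<and> \<gamma> t = y}"
  by (simp add: lagrangian_distance_def action_def)

lemma effective_lagrangian_along_naturals:
  assumes "is_effective_lagrangian P H f B Lbar"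
  shows "AE \<omega> in P. (\<lambda>N. lagrangian_distance H f B 0 (real N *\<^sub>R v) 0 (real N) \<omega> / real N) \<longlonglongrightarrow> Lbar v"
proof -
  have "AE \<omega> in P. ((\<lambda>T. lagrangian_distance H f B 0 (T *\<^sub>R v) 0 T \<omega> / T) \<longlongrightarrow> Lbar v) at_top"
    using assms by (simp add: is_effective_lagrangian_def)
  then show ?thesis
    by eventually_elim (rule filterlim_compose[OF _ filterlim_real_sequentially])
qed

section \<open>Growth of the effective Lagrangian\<close>

text \<open>
  Exponential moments of the norm reduce to Laplace transforms of the coordinates, because the norm is at most
  the dimension times the largest coordinate.
\<close>

lemma exp_norm_le_sum_exp:
  fixes z :: "real ^ 'm"
  assumes "l \<ge> 0"
  defines "c \<equiv> l * real CARD('m)"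
  shows "exp (l * norm z) \<le> (\<Sum>i\<in>UNIV. exp (c * z $ i) + exp (- c * z $ i))"
proof -
  obtain i where i: "\<And>j. \<bar>z $ j\<bar> \<le> \<bar>z $ i\<bar>"
  proof -
    have "Max (range (\<lambda>j. \<bar>z $ j\<bar>)) \<in> range (\<lambda>j. \<bar>z $ j\<bar>)" by (intro Max_in) auto
    then obtain i where "Max (range (\<lambda>j. \<bar>z $ j\<bar>)) = \<bar>z $ i\<bar>" by blast
    then show ?thesis using that[of i] by (metis Max_ge finite_imageI finite_class.finite_UNIV rangeI)
  qed
  have "norm z \<le> (\<Sum>j\<in>UNIV. \<bar>z $ j\<bar>)" by (rule norm_le_l1_cart)
  also have "\<dots> \<le> (\<Sum>j\<in>(UNIV :: 'm set). \<bar>z $ i\<bar>)" by (intro sum_mono i)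
  finally have "l * norm z \<le> c * \<bar>z $ i\<bar>"
    using mult_left_mono[OF _ assms(1), of "norm z" "real CARD('m) * \<bar>z $ i\<bar>"] by (simp add: c_def)
  then have "exp (l * norm z) \<le> exp (c * \<bar>z $ i\<bar>)" by simp
  also have "\<dots> \<le> exp (c * z $ i) + exp (- c * z $ i)"
    by (cases "z $ i \<ge> 0") auto
  also have "\<dots> \<le> (\<Sum>i\<in>UNIV. exp (c * z $ i) + exp (- c * z $ i))"
    by (rule member_le_sum[where f = "\<lambda>i. exp (c * z $ i) + exp (- c * z $ i)"]) (auto intro: add_nonneg_nonneg)
  finally show ?thesis .
qed

lemma fluctuation_cost_nonneg: "C \<ge> 0 \<Longrightarrow> fluctuation_cost C q R M z \<ge> 0"
  by (simp add: fluctuation_cost_def)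

lemma fluctuation_cost_le_exp:
  assumes "C \<ge> 0" "q \<ge> 0" "R \<ge> 0" "M \<ge> 0"
  shows "fluctuation_cost C q R M z \<le> C * ((R + M) powr q * exp (q * norm z) + 1)"
proof -
  have e: "norm z \<le> exp (norm z)" using exp_ge_add_one_self[of "norm z"] by linarith
  have "R * 1 \<le> R * exp (norm z)" using assms by (intro mult_left_mono) auto
  moreover have "M * norm z \<le> M * exp (norm z)" using e assms by (intro mult_left_mono) auto
  ultimately have "R + M * norm z \<le> (R + M) * exp (norm z)"
    by (simp add: distrib_right)
  then have "(R + M * norm z) powr q \<le> ((R + M) * exp (norm z)) powr q"
    using assms by (intro powr_mono2) auto
  also have "\<dots> = (R + M) powr q * exp (q * norm z)"
    using assms powr_mult[of "R + M" "exp (norm z)" q] by (simp add: powr_def[of "exp (norm z)"])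
  finally show ?thesis
    using assms(1) unfolding fluctuation_cost_def by (intro mult_left_mono) auto
qed

context random_forcing
begin

definition noise_moment :: "real \<Rightarrow> real" where
  "noise_moment l = real CARD('m) * (2 * exp ((l * real CARD('m))\<^sup>2 / 2))"

lemma increment_exp_moment:
  assumes "l \<ge> 0" "0 \<le> s" "s < t" "t \<le> s + 1"
  shows "(\<integral>\<^sup>+\<omega>. exp (l * norm (B t \<omega> - B s \<omega>)) \<partial>P) \<le> ennreal (noise_moment l)"
proof -
  define c where "c = l * real CARD('m)"
  have [measurable]: "B t \<in> borel_measurable P" "B s \<in> borel_measurable P"
    using assms by (auto intro: noise_measurable)
  have one: "(\<integral>\<^sup>+\<omega>. exp (u * (B t \<omega> - B s \<omega>) $ i) \<partial>P) \<le> ennreal (exp (c\<^sup>2 / 2))" if "\<bar>u\<bar> = c" for u i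
  proof -
    have "(\<integral>\<^sup>+\<omega>. exp (u * (B t \<omega> - B s \<omega>) $ i) \<partial>P) = (\<integral>\<^sup>+\<omega>. exp (axis i u \<bullet> (B t \<omega> - B s \<omega>)) \<partial>P)"
      by (simp only: inner_axis' inner_real_def)
    also have "\<dots> = ennreal (exp ((t - s) * (norm (axis i u :: real ^ 'm))\<^sup>2 / 2))"
      by (rule brownian_laplace[OF brownian assms(2,3)])
    also have "\<dots> \<le> ennreal (exp (c\<^sup>2 / 2))"
    proof -
      have "(norm (axis i u :: real ^ 'm))\<^sup>2 = c\<^sup>2" using that unfolding power2_norm_eq_inner inner_axis_axis by (auto simp: power2_eq_square)
      then show ?thesis
        using assms by (intro ennreal_leI) (simp add: mult_left_le_one_le)
    qed
    finally show ?thesis .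
  qed
  have "(\<integral>\<^sup>+\<omega>. exp (l * norm (B t \<omega> - B s \<omega>)) \<partial>P)
      \<le> (\<integral>\<^sup>+\<omega>. (\<Sum>i\<in>UNIV. ennreal (exp (c * (B t \<omega> - B s \<omega>) $ i)) + ennreal (exp (- c * (B t \<omega> - B s \<omega>) $ i))) \<partial>P)"
  proof (rule nn_integral_mono)
    fix \<omega>
    have "ennreal (exp (l * norm (B t \<omega> - B s \<omega>)))
        \<le> ennreal (\<Sum>i\<in>UNIV. exp (c * (B t \<omega> - B s \<omega>) $ i) + exp (- c * (B t \<omega> - B s \<omega>) $ i))"
      unfolding c_def by (rule ennreal_leI[OF exp_norm_le_sum_exp[OF assms(1)]])
    also have "\<dots> = (\<Sum>i\<in>UNIV. ennreal (exp (c * (B t \<omega> - B s \<omega>) $ i)) + ennreal (exp (- c * (B t \<omega> - B s \<omega>) $ i)))"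
      by (simp add: add_nonneg_nonneg flip: sum_ennreal ennreal_plus)
    finally show "ennreal (exp (l * norm (B t \<omega> - B s \<omega>)))
        \<le> (\<Sum>i\<in>UNIV. ennreal (exp (c * (B t \<omega> - B s \<omega>) $ i)) + ennreal (exp (- c * (B t \<omega> - B s \<omega>) $ i)))" .
  qed
  also have "\<dots> = (\<Sum>i\<in>UNIV. (\<integral>\<^sup>+\<omega>. exp (c * (B t \<omega> - B s \<omega>) $ i) \<partial>P) + (\<integral>\<^sup>+\<omega>. exp (- c * (B t \<omega> - B s \<omega>) $ i) \<partial>P))"
  proof -
    have [measurable]: "(\<lambda>z :: real ^ 'm. z $ i) \<in> borel_measurable borel" for i
      by (intro borel_measurable_continuous_onI continuous_intros)
    show ?thesis
      by (subst nn_integral_sum) (measurable, intro sum.cong refl nn_integral_add, measurable)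
  qed
  also have "\<dots> \<le> (\<Sum>i\<in>(UNIV :: 'm set). ennreal (exp (c\<^sup>2 / 2)) + ennreal (exp (c\<^sup>2 / 2)))"
    using assms(1) by (intro sum_mono add_mono one) (auto simp: c_def)
  also have "\<dots> = ennreal (noise_moment l)"
    by (simp add: noise_moment_def c_def ennreal_mult ennreal_of_nat_eq_real_of_nat flip: ennreal_plus)
  finally show ?thesis .
qed

text \<open>
  What the noise can take away from the action of any curve over one block.
\<close>

definition block_fluctuation :: "real \<Rightarrow> real \<Rightarrow> real \<Rightarrow> nat \<Rightarrow> 'w \<Rightarrow> real" where
  "block_fluctuation C q R k \<omega> = M\<^sub>0 * norm (B (real k + 1) \<omega> - B (real k) \<omega>)
     + integral {real k..real k + 1} (\<lambda>r. fluctuation_cost C q R M\<^sub>0 (B r \<omega> - B (real k) \<omega>))"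

text \<open>
  The lower bound serves two purposes: it gives the growth of the effective Lagrangian, and it makes the infimum in
  the definition of the distance meaningful, so that every admissible curve is an upper bound.
\<close>

lemma
  fixes H :: "real ^ 'd \<Rightarrow> real"
  assumes H: "admissible_hamiltonian H" and growth: "C > 0" "q > 0" "\<And>p. H p \<le> C * (norm p powr q + 1)"
    and \<omega>: "regular \<omega>"
  shows lagrangian_distance_lower: "real N * (p \<bullet> v) - (\<Sum>k<N. block_fluctuation C q (norm p) k \<omega>)
      \<le> lagrangian_distance H f B 0 (real N *\<^sub>R v) 0 (real N) \<omega>" (is ?lower)
    and lagrangian_distance_le_action: "W1inf 0 (real N) \<gamma> \<gamma>' \<Longrightarrow> \<gamma> 0 = 0 \<Longrightarrow> \<gamma> (real N) = real N *\<^sub>R v \<Longrightarrow>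
      lagrangian_distance H f B 0 (real N *\<^sub>R v) 0 (real N) \<omega>
        \<le> action H (\<lambda>z. f z \<omega>) (\<lambda>r. B r \<omega>) 0 (real N) \<gamma> \<gamma>'" (is "_ \<Longrightarrow> _ \<Longrightarrow> _ \<Longrightarrow> ?upper")
proof -
  define S where "S = {action H (\<lambda>z. f z \<omega>) (\<lambda>r. B r \<omega>) 0 (real N) \<gamma> \<gamma>' | \<gamma> \<gamma>'.
      W1inf 0 (real N) \<gamma> \<gamma>' \<and> \<gamma> 0 = 0 \<and> \<gamma> (real N) = real N *\<^sub>R v}"
  define m where "m = real N * (p \<bullet> v) - (\<Sum>k<N. block_fluctuation C q (norm p) k \<omega>)"
  have lower: "m \<le> a" if a: "a \<in> S" for a
  proof -
    obtain \<gamma> \<gamma>' where \<gamma>: "a = action H (\<lambda>z. f z \<omega>) (\<lambda>r. B r \<omega>) 0 (real N) \<gamma> \<gamma>'"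
        "W1inf 0 (real N) \<gamma> \<gamma>'" "\<gamma> 0 = 0" "\<gamma> (real N) = real N *\<^sub>R v"
      using a unfolding S_def by blast
    have g: "C1b (\<lambda>z. f z \<omega>)" "\<And>x. norm (f x \<omega>) \<le> M\<^sub>0" "\<And>x. norm (total_deriv (\<lambda>z. f z \<omega>) x) \<le> M\<^sub>0"
      and b: "continuous_on {0..} (\<lambda>r. B r \<omega>)"
      using \<omega> by (auto simp: regular_def)
    show ?thesis
      using action_lower_bound_blocks[OF H growth g \<gamma>(2) b, of p] \<gamma>
      by (simp add: m_def block_fluctuation_def)
  qed
  have "W1inf 0 (real N) (\<lambda>r. r *\<^sub>R v) (\<lambda>r. v)"
    by (rule W1inf_C1) (auto intro!: derivative_eq_intros)
  then have "action H (\<lambda>z. f z \<omega>) (\<lambda>r. B r \<omega>) 0 (real N) (\<lambda>r. r *\<^sub>R v) (\<lambda>r. v) \<in> S"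
    unfolding S_def by (intro CollectI exI[of _ "\<lambda>r. r *\<^sub>R v"] exI[of _ "\<lambda>r. v"]) simp
  then have "S \<noteq> {}" by blast
  then show ?lower
    unfolding lagrangian_distance_action S_def[symmetric] m_def[symmetric] by (rule cInf_greatest[OF _ lower])
  show ?upper if "W1inf 0 (real N) \<gamma> \<gamma>'" "\<gamma> 0 = 0" "\<gamma> (real N) = real N *\<^sub>R v"
    unfolding lagrangian_distance_action S_def[symmetric]
  proof (rule cInf_lower)
    show "action H (\<lambda>z. f z \<omega>) (\<lambda>r. B r \<omega>) 0 (real N) \<gamma> \<gamma>' \<in> S" unfolding S_def using that by blast
    show "bdd_below S" using lower by (rule bdd_belowI)
  qed
qed

text \<open>
  The effective Lagrangian grows superlinearly, so the supremum that defines its conjugate is finite. The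
  fluctuations of the blocks have bounded expectations, so on average they contribute at most
  a constant that does not depend on \<open>v\<close>.
\<close>

lemma effective_lagrangian_lower:
  fixes H :: "real ^ 'd \<Rightarrow> real"
  assumes H: "admissible_hamiltonian H" and L: "is_effective_lagrangian P H f B Lbar"
  shows "\<exists>K. \<forall>v. p \<bullet> v - Lbar v \<le> K"
proof -
  obtain C q where growth: "C > 0" "q > 0" "\<And>p. H p \<le> C * (norm p powr q + 1)"
    using admissible_growth[OF H] by blast
  define \<psi> where "\<psi> = (fluctuation_cost C q (norm p) M\<^sub>0 :: real ^ 'm \<Rightarrow> real)"
  define K where "K = M\<^sub>0 * noise_moment 1 + C * ((norm p + M\<^sub>0) powr q * noise_moment q + 1)"
  have K: "K \<ge> 0" using M\<^sub>0 growth(1) by (simp add: K_def noise_moment_def)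
  define F where "F k n \<omega> = M\<^sub>0 * norm (B (real k + 1) \<omega> - B (real k) \<omega>)
      + (\<Sum>i<n. \<psi> (B (real k + real (Suc i) / real n) \<omega> - B (real k) \<omega>)) / real n" for k n \<omega>
  have \<psi>_nonneg: "\<psi> z \<ge> 0" for z
    unfolding \<psi>_def using growth by (simp add: fluctuation_cost_nonneg)
  have \<psi>_meas [measurable]: "\<psi> \<in> borel_measurable borel"
    unfolding \<psi>_def fluctuation_cost_def by measurable
  have B_meas [measurable]: "t \<ge> 0 \<Longrightarrow> B t \<in> borel_measurable P" for t by (rule noise_measurable)
  have F_meas: "F k n \<in> borel_measurable P" for k n
    unfolding F_def by measurable
  have \<psi>_moment: "(\<integral>\<^sup>+\<omega>. \<psi> (B t \<omega> - B s \<omega>) \<partial>P) \<le> ennreal (C * ((norm p + M\<^sub>0) powr q * noise_moment q + 1))"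
    if st: "0 \<le> s" "s < t" "t \<le> s + 1" for s t
  proof -
    have [measurable]: "B t \<in> borel_measurable P" "B s \<in> borel_measurable P" using st by (auto intro: noise_measurable)
    have "(\<integral>\<^sup>+\<omega>. \<psi> (B t \<omega> - B s \<omega>) \<partial>P)
        \<le> (\<integral>\<^sup>+\<omega>. ennreal C * (ennreal ((norm p + M\<^sub>0) powr q) * ennreal (exp (q * norm (B t \<omega> - B s \<omega>))) + 1) \<partial>P)"
    proof (rule nn_integral_mono)
      fix \<omega>
      have "ennreal (\<psi> (B t \<omega> - B s \<omega>)) \<le> ennreal (C * ((norm p + M\<^sub>0) powr q * exp (q * norm (B t \<omega> - B s \<omega>)) + 1))"
        unfolding \<psi>_def using growth M\<^sub>0 by (intro ennreal_leI fluctuation_cost_le_exp) auto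
      also have "\<dots> = ennreal C * (ennreal ((norm p + M\<^sub>0) powr q) * ennreal (exp (q * norm (B t \<omega> - B s \<omega>))) + 1)"
        using growth(1) by (simp add: ennreal_mult ennreal_plus)
      finally show "ennreal (\<psi> (B t \<omega> - B s \<omega>))
          \<le> ennreal C * (ennreal ((norm p + M\<^sub>0) powr q) * ennreal (exp (q * norm (B t \<omega> - B s \<omega>))) + 1)" .
    qed
    also have "\<dots> = ennreal C * (ennreal ((norm p + M\<^sub>0) powr q) * (\<integral>\<^sup>+\<omega>. exp (q * norm (B t \<omega> - B s \<omega>)) \<partial>P) + 1)"
      by (simp add: nn_integral_cmult nn_integral_add emeasure_space_1)
    also have "\<dots> \<le> ennreal C * (ennreal ((norm p + M\<^sub>0) powr q) * ennreal (noise_moment q) + 1)"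
      using growth(2) st by (intro mult_left_mono add_right_mono increment_exp_moment) auto
    also have "\<dots> = ennreal (C * ((norm p + M\<^sub>0) powr q * noise_moment q + 1))"
      using growth(1) by (simp add: ennreal_mult ennreal_plus noise_moment_def)
    finally show ?thesis .
  qed
  have F_bound: "(\<integral>\<^sup>+\<omega>. F k n \<omega> \<partial>P) \<le> ennreal K" if n: "n > 0" for k n
  proof -
    have [measurable]: "B (real k + real (Suc i) / real n) \<in> borel_measurable P" for i
      by (rule noise_measurable) simp
    have "(\<integral>\<^sup>+\<omega>. F k n \<omega> \<partial>P) = (\<integral>\<^sup>+\<omega>. ennreal M\<^sub>0 * ennreal (norm (B (real k + 1) \<omega> - B (real k) \<omega>))
        + (\<Sum>i<n. ennreal (\<psi> (B (real k + real (Suc i) / real n) \<omega> - B (real k) \<omega>))) / of_nat n \<partial>P)"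
    proof (rule nn_integral_cong)
      fix \<omega>
      have "ennreal ((\<Sum>i<n. \<psi> (B (real k + real (Suc i) / real n) \<omega> - B (real k) \<omega>)) / real n)
          = (\<Sum>i<n. ennreal (\<psi> (B (real k + real (Suc i) / real n) \<omega> - B (real k) \<omega>))) / of_nat n"
        using n \<psi>_nonneg
        by (simp add: sum_ennreal sum_nonneg divide_ennreal ennreal_of_nat_eq_real_of_nat del: of_nat_Suc)
      then show "ennreal (F k n \<omega>) = ennreal M\<^sub>0 * ennreal (norm (B (real k + 1) \<omega> - B (real k) \<omega>))
          + (\<Sum>i<n. ennreal (\<psi> (B (real k + real (Suc i) / real n) \<omega> - B (real k) \<omega>))) / of_nat n"
        using M\<^sub>0 \<psi>_nonneg by (simp add: F_def ennreal_plus ennreal_mult sum_nonneg del: of_nat_Suc)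
    qed
    also have "\<dots> = ennreal M\<^sub>0 * (\<integral>\<^sup>+\<omega>. norm (B (real k + 1) \<omega> - B (real k) \<omega>) \<partial>P)
        + (\<Sum>i<n. \<integral>\<^sup>+\<omega>. \<psi> (B (real k + real (Suc i) / real n) \<omega> - B (real k) \<omega>) \<partial>P) / of_nat n"
      by (simp add: nn_integral_add nn_integral_cmult nn_integral_divide nn_integral_sum del: of_nat_Suc)
    also have "\<dots> \<le> ennreal M\<^sub>0 * ennreal (noise_moment 1)
        + (\<Sum>i<n. ennreal (C * ((norm p + M\<^sub>0) powr q * noise_moment q + 1))) / of_nat n"
    proof (intro add_mono mult_left_mono divide_right_mono_ennreal sum_mono \<psi>_moment)
      have "z \<le> exp (1 * z)" for z :: real
        unfolding mult_1 using exp_ge_add_one_self[of z] by linarith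
      then have "(\<integral>\<^sup>+\<omega>. norm (B (real k + 1) \<omega> - B (real k) \<omega>) \<partial>P)
          \<le> (\<integral>\<^sup>+\<omega>. exp (1 * norm (B (real k + 1) \<omega> - B (real k) \<omega>)) \<partial>P)"
        by (intro nn_integral_mono ennreal_leI)
      also have "\<dots> \<le> ennreal (noise_moment 1)" by (rule increment_exp_moment) auto
      finally show "(\<integral>\<^sup>+\<omega>. norm (B (real k + 1) \<omega> - B (real k) \<omega>) \<partial>P) \<le> ennreal (noise_moment 1)" .
    qed (use n in auto)
    also have "\<dots> = ennreal K"
    proof -
      define c where "c = C * ((norm p + M\<^sub>0) powr q * noise_moment q + 1)"
      have "c \<ge> 0" "noise_moment 1 \<ge> 0" using growth(1) by (simp_all add: c_def noise_moment_def)
      then show ?thesis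
        using n M\<^sub>0 unfolding K_def c_def[symmetric]
        by (simp add: ennreal_plus ennreal_mult divide_ennreal ennreal_of_nat_eq_real_of_nat flip: ennreal_mult)
    qed
    finally show ?thesis .
  qed
  have "p \<bullet> v - Lbar v \<le> K" for v
  proof (rule averaged_fatou[OF F_meas _ _ K])
    show "F k n \<omega> \<ge> 0" for k n \<omega>
      using M\<^sub>0 \<psi>_nonneg by (simp add: F_def sum_nonneg)
    show "\<forall>\<^sub>F n in sequentially. (\<integral>\<^sup>+\<omega>. F k n \<omega> \<partial>P) \<le> ennreal K" for k
      using eventually_gt_at_top[of 0] by eventually_elim (rule F_bound)
    show "AE \<omega> in P. \<exists>c F'. c \<longlonglongrightarrow> p \<bullet> v - Lbar v \<and> (\<forall>k. (\<lambda>n. F k n \<omega>) \<longlonglongrightarrow> F' k) \<and>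
        (\<forall>N>0. c N \<le> (\<Sum>k<N. F' k) / real N)"
      using AE_regular effective_lagrangian_along_naturals[OF L, of v]
    proof eventually_elim
      case (elim \<omega>)
      define c where "c N = p \<bullet> v - lagrangian_distance H f B 0 (real N *\<^sub>R v) 0 (real N) \<omega> / real N" for N
      have "c \<longlonglongrightarrow> p \<bullet> v - Lbar v"
        unfolding c_def by (intro tendsto_intros elim(2))
      moreover have "(\<lambda>n. F k n \<omega>) \<longlonglongrightarrow> block_fluctuation C q (norm p) k \<omega>" for k
      proof -
        have "continuous_on {real k..real k + 1} (\<lambda>r. B r \<omega>)"
          using elim(1) by (auto simp: regular_def intro: continuous_on_subset)
        then have "continuous_on {real k..real k + 1} (\<lambda>r. \<psi> (B r \<omega> - B (real k) \<omega>))"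
          unfolding \<psi>_def using growth M\<^sub>0 by (intro continuous_on_fluctuation_cost continuous_intros) auto
        then show ?thesis
          unfolding F_def block_fluctuation_def \<psi>_def[symmetric]
          by (intro tendsto_intros riemann_sums) (auto simp: divide_right_mono)
      qed
      moreover have "c N \<le> (\<Sum>k<N. block_fluctuation C q (norm p) k \<omega>) / real N" if "N > 0" for N
        using divide_right_mono[OF lagrangian_distance_lower[OF H growth elim(1), of N p v], of "real N"] that
        by (simp add: c_def diff_divide_distrib)
      ultimately show ?case
        by (intro exI[of _ c] exI[of _ "\<lambda>k. block_fluctuation C q (norm p) k \<omega>"]) simp
    qed
  qed
  then show ?thesis by blast
qed

end

section \<open>Strict inequality between the Lagrangians\<close>

context random_forcing
begin

lemma detour_derivative:
  "(detour v h k has_vector_derivative (v + (2 * real k + 1 - 2 * r) *\<^sub>R h)) (at r)"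
  unfolding detour_def
  by (auto intro!: derivative_eq_intros simp: algebra_simps)

text \<open>
  The noise part of the action of a detour is the limit of the stochastic sums; the kinetic part is at most \<open>K\<close>,
  because the velocity stays within \<open>norm h\<close> of \<open>v\<close>.
\<close>

lemma detour_action:
  fixes H :: "real ^ 'd \<Rightarrow> real"
  assumes H: "admissible_hamiltonian H" and \<omega>: "regular \<omega>"
    and K: "\<And>u. norm u \<le> norm h \<Longrightarrow> convex_conjugate H (v + u) \<le> K"
  shows "\<exists>\<gamma>' I. W1inf (real k) (real k + 1) (detour v h k) \<gamma>' \<and> (\<lambda>n. ito_sum (detour v h k) k n \<omega>) \<longlonglongrightarrow> I \<and>
    action H (\<lambda>z. f z \<omega>) (\<lambda>r. B r \<omega>) (real k) (real k + 1) (detour v h k) \<gamma>' \<le> K + I"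
proof -
  define \<gamma>' where "\<gamma>' r = v + (2 * real k + 1 - 2 * r) *\<^sub>R h" for r
  define g where "g = (\<lambda>z. f z \<omega>)"
  define b where "b = (\<lambda>r. B r \<omega>)"
  define G' where "G' r = blinfun_apply (total_deriv g (detour v h k r)) (\<gamma>' r)" for r
  have g: "C1b g" and b: "continuous_on {real k..real k + 1} b"
    using \<omega> by (auto simp: regular_def g_def b_def intro: continuous_on_subset)
  have deriv: "(detour v h k has_vector_derivative \<gamma>' r) (at r)" for r
    unfolding \<gamma>'_def by (rule detour_derivative)
  have cont\<gamma>': "continuous_on UNIV \<gamma>'"
    unfolding \<gamma>'_def by (intro continuous_intros)
  have W: "W1inf (real k) (real k + 1) (detour v h k) \<gamma>'"
    by (rule W1inf_C1[OF deriv cont\<gamma>'])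
  have G: "((\<lambda>r. g (detour v h k r)) has_vector_derivative G' r) (at r within {real k..real k + 1})" for r
    unfolding has_vector_derivative_def G'_def
    using has_derivative_compose[OF has_vector_derivative_at_within[OF deriv, unfolded has_vector_derivative_def]
        total_deriv_has_derivative[OF g]]
    by (simp add: blinfun.scaleR_right)
  have contG': "continuous_on {real k..real k + 1} G'"
  proof -
    have "continuous_on UNIV (total_deriv g)" using g by (simp add: C1b_def)
    then have "continuous_on {real k..real k + 1} (\<lambda>r. total_deriv g (detour v h k r))"
      by (rule continuous_on_compose2[OF _ W1inf_continuous[OF W]]) simp
    then show ?thesis
      unfolding G'_def by (intro continuous_intros continuous_on_subset[OF cont\<gamma>']) simp_all
  qed
  define I where "I = path_integral g b (real k) (real k + 1) (detour v h k) \<gamma>'"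
  have "set_integrable lborel {real k..real k + 1} (\<lambda>r. G' r \<bullet> b r)"
    by (intro borel_integrable_atLeastAtMost' continuous_intros contG' b)
  then have "I = g (detour v h k (real k + 1)) \<bullet> b (real k + 1) - g (detour v h k (real k)) \<bullet> b (real k)
      - integral {real k..real k + 1} (\<lambda>r. G' r \<bullet> b r)"
    unfolding I_def path_integral_def G'_def by (simp add: set_borel_integral_eq_integral(2))
  then have "(\<lambda>n. ito_sum (detour v h k) k n \<omega>) \<longlonglongrightarrow> I"
    using ito_sums[OF G contG' b] by (simp only: ito_sum_def increment_def g_def b_def)
  moreover have "(LBINT r:{real k..real k + 1}. convex_conjugate H (\<gamma>' r)) \<le> K"
  proof -
    have "(LBINT r:{real k..real k + 1}. convex_conjugate H (\<gamma>' r)) \<le> (LBINT r:{real k..real k + 1}. K)"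
    proof (rule set_integral_mono)
      show "set_integrable lborel {real k..real k + 1} (\<lambda>r. convex_conjugate H (\<gamma>' r))"
        by (rule W1inf_integrable_continuous[OF W conjugate_continuous[OF H]])
      show "set_integrable lborel {real k..real k + 1} (\<lambda>r. K)"
        by (rule borel_integrable_atLeastAtMost') (rule continuous_on_const)
      fix r assume "r \<in> {real k..real k + 1}"
      then have "\<bar>2 * real k + 1 - 2 * r\<bar> \<le> 1" by auto
      then have "norm ((2 * real k + 1 - 2 * r) *\<^sub>R h) \<le> norm h"
        by (simp add: mult_left_le_one_le)
      then show "convex_conjugate H (\<gamma>' r) \<le> K" unfolding \<gamma>'_def by (rule K)
    qed
    also have "\<dots> = K" by (simp add: set_lebesgue_integral_def)
    finally show ?thesis .
  qed
  then have "action H g b (real k) (real k + 1) (detour v h k) \<gamma>' \<le> K + I"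
    by (simp add: action_def I_def)
  ultimately show ?thesis using W unfolding g_def b_def by blast
qed

text \<open>
  Concatenate, block by block, the cheaper of the straight line and the detour. The action is at most
  \<open>N * e\<close> plus the sum of the block gains, and \<open>block_gain\<close> with \<open>averaged_fatou\<close>, applied to
  exponentials of the mean cost relative to \<open>e\<close>, shows that the limit of the means lies strictly below \<open>e\<close>.
\<close>

lemma effective_lagrangian_strict_upper:
  fixes H :: "real ^ 'd \<Rightarrow> real"
  assumes H: "admissible_hamiltonian H" and L: "is_effective_lagrangian P H f B Lbar"
    and nontrivial: "\<not> (AE \<omega> in P. (\<lambda>x. f x \<omega>) constant_on UNIV)"
  shows "Lbar v < convex_conjugate H v"
proof -
  obtain h0 where h0: "\<not> (AE \<omega> in P. f 0 \<omega> = f h0 \<omega>)"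
    using field_difference_nontrivial[OF nontrivial] by blast
  \<comment> \<open>The detour reaches only a quarter of its parameter at the midpoint of a block.\<close>
  define h where "h = 4 *\<^sub>R h0"
  define e where "e = convex_conjugate H v"
  \<comment> \<open>An upper bound for the kinetic cost of the detour per unit of time.\<close>
  obtain c where c: "c \<ge> 0" "\<And>u. norm u \<le> norm h \<Longrightarrow> convex_conjugate H (v + u) \<le> e + c"
  proof -
    have "bounded (convex_conjugate H ` cball v (norm h))"
      by (rule compact_imp_bounded[OF compact_continuous_image[OF conjugate_continuous[OF H] compact_cball]])
    then obtain b where b: "\<And>z. z \<in> cball v (norm h) \<Longrightarrow> norm (convex_conjugate H z) \<le> b"
      unfolding bounded_iff by blast
    have "convex_conjugate H (v + u) \<le> e + max 0 (b - e)" if "norm u \<le> norm h" for u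
      using b[of "v + u"] that by (auto simp: dist_norm)
    then show ?thesis using that[of "max 0 (b - e)"] by simp
  qed
  have "\<not> (AE \<omega> in P. f 0 \<omega> = f ((1 / 4) *\<^sub>R h) \<omega>)" using h0 by (simp add: h_def)
  from block_gain[OF this c(1), of v] obtain \<theta> \<rho> where \<theta>: "\<theta> > 0" and \<rho>: "0 \<le> \<rho>" "\<rho> < 1"
    and gain: "\<And>k. \<forall>\<^sub>F n in sequentially.
      (\<integral>\<^sup>+\<omega>. exp (\<theta> * min (ito_sum (detour v 0 k) k n \<omega>) (c + ito_sum (detour v h k) k n \<omega>)) \<partial>P) \<le> ennreal \<rho>"
    by blast
  obtain C q where growth: "C > 0" "q > 0" "\<And>p. H p \<le> C * (norm p powr q + 1)"
    using admissible_growth[OF H] by blast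
  have "exp (\<theta> * (Lbar v - e)) \<le> \<rho>"
  proof (rule averaged_fatou[OF _ _ gain \<rho>(1)])
    show "AE \<omega> in P. \<exists>a F'. a \<longlonglongrightarrow> exp (\<theta> * (Lbar v - e)) \<and>
        (\<forall>k. (\<lambda>n. exp (\<theta> * min (ito_sum (detour v 0 k) k n \<omega>) (c + ito_sum (detour v h k) k n \<omega>))) \<longlonglongrightarrow> F' k) \<and>
        (\<forall>N>0. a N \<le> (\<Sum>k<N. F' k) / real N)"
      using AE_regular effective_lagrangian_along_naturals[OF L, of v]
    proof eventually_elim
      case (elim \<omega>)
      define g where "g = (\<lambda>z. f z \<omega>)"
      define b where "b = (\<lambda>r. B r \<omega>)"
      have g: "C1b g" and b: "continuous_on {0..} b"
        using elim(1) by (auto simp: regular_def g_def b_def)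
      have ends: "detour v u k (real k) = real k *\<^sub>R v" "detour v u k (real k + 1) = real (Suc k) *\<^sub>R v" for u k
        by (simp_all add: detour_def)
      have "\<exists>\<gamma>' I. W1inf (real k) (real k + 1) (detour v 0 k) \<gamma>' \<and> (\<lambda>n. ito_sum (detour v 0 k) k n \<omega>) \<longlonglongrightarrow> I \<and>
          action H g b (real k) (real k + 1) (detour v 0 k) \<gamma>' \<le> e + I" for k
        unfolding g_def b_def by (rule detour_action[OF H elim(1)]) (simp add: e_def)
      then obtain \<gamma>0' I0 where straight: "\<And>k. W1inf (real k) (real k + 1) (detour v 0 k) (\<gamma>0' k)"
          "\<And>k. (\<lambda>n. ito_sum (detour v 0 k) k n \<omega>) \<longlonglongrightarrow> I0 k"
          "\<And>k. action H g b (real k) (real k + 1) (detour v 0 k) (\<gamma>0' k) \<le> e + I0 k"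
        by metis
      have "\<exists>\<gamma>' I. W1inf (real k) (real k + 1) (detour v h k) \<gamma>' \<and> (\<lambda>n. ito_sum (detour v h k) k n \<omega>) \<longlonglongrightarrow> I \<and>
          action H g b (real k) (real k + 1) (detour v h k) \<gamma>' \<le> (e + c) + I" for k
        unfolding g_def b_def by (rule detour_action[OF H elim(1) c(2)])
      then obtain \<gamma>1' I1 where bent: "\<And>k. W1inf (real k) (real k + 1) (detour v h k) (\<gamma>1' k)"
          "\<And>k. (\<lambda>n. ito_sum (detour v h k) k n \<omega>) \<longlonglongrightarrow> I1 k"
          "\<And>k. action H g b (real k) (real k + 1) (detour v h k) (\<gamma>1' k) \<le> (e + c) + I1 k"
        by metis
      define u where "u k = min (I0 k) (c + I1 k)" for k
      have blocks: "\<exists>\<gamma> \<gamma>'. W1inf (real k) (real k + 1) \<gamma> \<gamma>' \<and> \<gamma> (real k) = real k *\<^sub>R v \<and>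
          \<gamma> (real k + 1) = real (Suc k) *\<^sub>R v \<and> action H g b (real k) (real k + 1) \<gamma> \<gamma>' \<le> e + u k" for k
      proof (cases "I0 k \<le> c + I1 k")
        case True
        then show ?thesis
          using straight(1)[of k] straight(3)[of k] ends[of 0 k]
          by (intro exI[of _ "detour v 0 k"] exI[of _ "\<gamma>0' k"]) (simp add: u_def del: of_nat_Suc)
      next
        case False
        then show ?thesis
          using bent(1)[of k] bent(3)[of k] ends[of h k]
          by (intro exI[of _ "detour v h k"] exI[of _ "\<gamma>1' k"]) (simp add: u_def del: of_nat_Suc)
      qed
      define a where "a N = exp (\<theta> * (lagrangian_distance H f B 0 (real N *\<^sub>R v) 0 (real N) \<omega> / real N - e))" for N
      have "a \<longlonglongrightarrow> exp (\<theta> * (Lbar v - e))"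
        unfolding a_def by (intro tendsto_intros elim(2))
      moreover have "(\<lambda>n. exp (\<theta> * min (ito_sum (detour v 0 k) k n \<omega>) (c + ito_sum (detour v h k) k n \<omega>)))
          \<longlonglongrightarrow> exp (\<theta> * u k)" for k
        unfolding u_def by (intro tendsto_intros straight bent)
      moreover have "a N \<le> (\<Sum>k<N. exp (\<theta> * u k)) / real N" if N: "N > 0" for N
      proof -
        obtain \<gamma> \<gamma>' where \<gamma>: "W1inf 0 (real N) \<gamma> \<gamma>'" "\<gamma> 0 = real 0 *\<^sub>R v" "\<gamma> (real N) = real N *\<^sub>R v"
            "action H g b 0 (real N) \<gamma> \<gamma>' \<le> (\<Sum>k<N. e + u k)"
          using concatenate_blocks[OF H g b, of "\<lambda>k. real k *\<^sub>R v" "\<lambda>k. e + u k" N] blocks by blast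
        have "lagrangian_distance H f B 0 (real N *\<^sub>R v) 0 (real N) \<omega> \<le> action H g b 0 (real N) \<gamma> \<gamma>'"
          unfolding g_def b_def
          by (rule lagrangian_distance_le_action[OF H growth elim(1) \<gamma>(1)]) (use \<gamma> in simp_all)
        then have "lagrangian_distance H f B 0 (real N *\<^sub>R v) 0 (real N) \<omega> \<le> real N * e + (\<Sum>k<N. u k)"
          using \<gamma>(4) by (simp add: sum.distrib)
        from divide_right_mono[OF this, of "real N"]
        have "lagrangian_distance H f B 0 (real N *\<^sub>R v) 0 (real N) \<omega> / real N - e \<le> (\<Sum>k<N. u k) / real N"
          using N by (simp add: add_divide_distrib)
        then have "a N \<le> exp (\<theta> * ((\<Sum>k<N. u k) / real N))"
          unfolding a_def exp_le_cancel_iff using \<theta> by (intro mult_left_mono) simp_all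
        also have "\<dots> = exp ((\<Sum>k<N. \<theta> * u k) / real N)" by (simp add: sum_distrib_left)
        also have "\<dots> \<le> (\<Sum>k<N. exp (\<theta> * u k)) / real N" by (rule exp_average_le[OF N])
        finally show ?thesis .
      qed
      ultimately show ?case
        by (intro exI[of _ a] exI[of _ "\<lambda>k. exp (\<theta> * u k)"]) simp
    qed
  qed (auto intro: borel_measurable_exp)
  then have "exp (\<theta> * (Lbar v - e)) < exp 0"
    unfolding exp_zero using \<rho>(2) by (rule order_le_less_trans)
  then have "\<theta> * (Lbar v - e) < 0" by (simp only: exp_less_cancel_iff)
  then show ?thesis using \<theta> by (simp add: mult_less_0_iff e_def)
qed

end

section \<open>Strict enhancement of the Hamiltonian\<close>

theorem theorem1p2:
  fixes P :: "'w measure"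
    and \<tau> :: "real ^ 'd \<Rightarrow> 'w \<Rightarrow> 'w"
    and f :: "real ^ 'd \<Rightarrow> 'w \<Rightarrow> real ^ 'm"
    and B :: "real \<Rightarrow> 'w \<Rightarrow> real ^ 'm"
    and \<kappa> M\<^sub>0 :: real
    and H Lbar Hbar :: "real ^ 'd \<Rightarrow> real"
  assumes "admissible_hamiltonian H"
    and "random_forcing P \<tau> f B \<kappa> M\<^sub>0"
    and "\<not> (AE \<omega> in P. (\<lambda>x. f x \<omega>) constant_on UNIV)"
    and "is_effective_lagrangian P H f B Lbar"
    and "Hbar = convex_conjugate Lbar"
  shows "\<forall>p. Hbar p > H p"
proof
  interpret random_forcing P \<tau> f B \<kappa> M\<^sub>0 by fact
  fix p
  obtain v where v: "convex_conjugate H v = p \<bullet> v - H p"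
    using conjugate_attained[OF assms(1)] by blast
  obtain K where K: "\<And>w. p \<bullet> w - Lbar w \<le> K"
    using effective_lagrangian_lower[OF assms(1,4), of p] by blast
  have "H p < p \<bullet> v - Lbar v"
    using effective_lagrangian_strict_upper[OF assms(1,4,3), of v] v by simp
  also have "\<dots> = v \<bullet> p - Lbar v" by (simp add: inner_commute)
  also have "\<dots> \<le> convex_conjugate Lbar p"
    unfolding convex_conjugate_def
  proof (rule cSUP_upper2[OF _ UNIV_I order_refl])
    show "bdd_above (range (\<lambda>w. w \<bullet> p - Lbar w))"
      using K by (intro bdd_aboveI2[of _ _ K]) (simp add: inner_commute)
  qed
  finally show "Hbar p > H p" by (simp add: assms(5))
qed

end
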